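(* Let $E$ be a graph and $R$ a commutative ring with unit. There exists a unique algebraic conditional expectation $E_M$ of $L_R(E)$ onto $M_R(E)$ such that $$E_M(x)=\begin{cases}x & \text{if } x\in G_E^M,\\ 0 & \text{if } x\in G_E\setminus G_E^M.\end{cases}$$ Furthermore, for the essentially aperiodic representation $\Pi_{\rm ap}:L_R(E)\to\mathcal{E}$ and the algebraic conditional expectation $E_{\rm ap}:\mathcal{E}\to\mathcal{E}$ we have: (i) $\Pi_{\rm ap}\circ E_M=E_{\rm ap}\circ\Pi_{\rm ap}$; and (ii) $E_{\rm ap}(T)=T$ for every $T\in\mathcal{P}'$, where $\mathcal{P}'=\{T\in\mathcal{E}: TP_\alpha=P_\alpha T \text{ for every } \alpha\in\mathrm{Path}(E)\}$.
   Context: A graph $E=(E^0,E^1,r,s)$ consists of arbitrary sets $E^0$ (vertices), $E^1$ (edges) and maps $r,s:E^1\to E^0$. A sink is a vertex $v$ with $s^{-1}(v)=\emptyset$; $v$ is regular if $s^{-1}(v)$ is finite and nonempty. A path is a vertex (length $0$, $s(v)=r(v)=v$) or a finite sequence $\mu=e_1\cdots e_n$ of edges with $r(e_i)=s(e_{i+1})$; $l(\mu)=n$, $s(\mu)=s(e_1)$, $r(\mu)=r(e_n)$; $\mathrm{Path}(E)$ is the set of all paths. A path of positive length is closed if $r(e_n)=s(e_1)$, and a closed path is a cycle if $s(e_i)\ne s(e_j)$ for $i\ne j$. An exit for $\mu=e_1\cdots e_n$ is an edge $e$ with $s(e)=s(e_i)$, $e\neq e_i$ for some $i$. The Leavitt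 path algebra $L_R(E)$ is the universal $R$-algebra generated by pairwise orthogonal idempotents $\{v:v\in E^0\}$ and elements $\{e,e^*:e\in E^1\}$ subject to: $s(e)e=e=er(e)$; $r(e)e^*=e^*=e^*s(e)$; $e^*e=r(e)$ and $e^*f=0$ for $e\ne f$; $v=\sum_{s(e)=v}ee^*$ for every regular vertex $v$. For $\mu=e_1\cdots e_n$, $\mu^*=e_n^*\cdots e_1^*$ (and $v^*=v$). The $R$-linear involution on $L_R(E)$ is $(\sum r_i\alpha_i\beta_i^* )^*=\sum r_i\beta_i\alpha_i^*$. Put $G_E=\{\mu\nu^*:\mu,\nu\in\mathrm{Path}(E),\ r(\mu)=r(\nu)\}\subset L_R(E)$; it spans $L_R(E)$ over $R$. An element $x$ is normal if $xx^*=x^*x$. $G_E^M$ is the set of normal elements of $G_E$, and the commutative core $M_R(E)$ is the $R$-subalgebra (not necessarily unital) of $L_R(E)$ generated by $G_E^M$. For an $R$-algebra $\mathcal{A}$ and $R$-subalgebra $\mathcal{B}$, an algebraic conditional expectation of $\mathcal{A}$ onto $\mathcal{B}$ is an $R$-linear idempotent map $\mathbb{E}$ on $\mathcal{A}$ with image $\mathcal{B}$ such that $\mathbb{E}(ba)=b\mathbb{E}(a)$ and $\mathbb{E}(ab)=\mathbb{E}(a)b$ for all $a\in\mathcal{A}$, $b\in\mathcal{B}$. A trail is either a finite path (possibly of length zero) whose range is a sink, or an infinite sequence $e_1e_2\cdots$ of edges with $r(e_n)=s(e_{n+1})$ for all $n$; $s(\tau)$ is its starting vertex. If $r(\alpha)=s(\tau)$,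 $\alpha\tau$ is the concatenation; $\alpha\le\tau$ means that the path $\alpha$ is an initial segment of $\tau$, i.e. $\tau=\alpha\beta$ for a trail $\beta$ with $s(\beta)=r(\alpha)$. An infinite trail is periodic if there are $j,k\ge1$ with $e_{n+k}=e_n$ for all $n\ge j$; with $j+k$ chosen minimal, its period is $e_j\cdots e_{j+k-1}$. A trail is essentially aperiodic if it is finite, or periodic with period a closed path (necessarily a cycle) without exits, or infinite and not periodic. $\mathfrak{T}_E$ is the set of essentially aperiodic trails. Let $M$ be the free $R$-module with basis $\{\xi_\tau^n:n\in\mathbb{Z},\tau\in\mathfrak{T}_E\}$, graded by $M_i=\mathrm{span}_R\{\xi_\tau^i:\tau\in\mathfrak{T}_E\}$. Let $\mathcal{E}_i=\{f\in\mathrm{End}_R(M): f(M_t)\subseteq M_{t+i}\ \forall t\}$ and $\mathcal{E}=\bigoplus_{i\in\mathbb{Z}}\mathcal{E}_i\subseteq\mathrm{End}_R(M)$. For a path $\alpha$ define $S_\alpha,S_{\alpha}^{*}\in\mathcal{E}$ by $S_\alpha(\xi_\tau^n)=\xi_{\alpha\tau}^{l(\alpha)+n}$ if $r(\alpha)=s(\tau)$ and $0$ otherwise; $S_{\alpha}^{*}(\xi_\tau^n)=\xi_\beta^{n-l(\alpha)}$ if $\tau=\alpha\beta$ and $0$ if $\alpha\not\le\tau$. The essentially aperiodic representation is the $R$-algebra homomorphism $\Pi_{\rm ap}:L_R(E)\to\mathcal{E}$ with $\Pi_{\rm ap}(\alpha\beta^* )=S_\alpha S_\beta^*$. Put $P_\alpha=S_\alpha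 S_\alpha^*$, i.e. $P_\alpha(\xi_\tau^n)=\xi_\tau^n$ if $\alpha\le\tau$ and $0$ otherwise. For $\tau\in\mathfrak{T}_E$ let $Q_\tau\in\mathcal{E}$ be given by $Q_\tau(\xi_{\tau'}^n)=\xi_\tau^n$ if $\tau'=\tau$ and $0$ otherwise. For each $m\in M$ there is a unique minimal finite subset $\{\tau_1,\dots,\tau_n\}\subset\mathfrak{T}_E$ with $(\sum_i Q_{\tau_i})(m)=m$; for $T\in\mathcal{E}$ define $E_{\rm ap}(T)(m)=\left(\sum_{i=1}^nQ_{\tau_i}TQ_{\tau_i}\right)(m)$. The map $E_{\rm ap}$ is an algebraic conditional expectation of $\mathcal{E}$ onto $\{T\in\mathcal{E}:TQ_\tau=Q_\tau T\ \forall\tau\in\mathfrak{T}_E\}$. *)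

theory Defs
  imports
    "HOL-Library.FuncSet"
    "HOL-Library.Poly_Mapping"
    "HOL-Library.Stream"
    "Graph_Theory.Arc_Walk"
begin

text \<open>
  The sort \<open>{comm_ring, comm_monoid_mult}\<close> is that of all commutative rings with unit; unlike
  \<^class>\<open>comm_ring_1\<close> it does not exclude the zero ring.  Graphs are those of the
  \<open>Graph_Theory\<close> entry: \<^const>\<open>tail\<close> is the source map and \<^const>\<open>head\<close> the range map.
  Functions between carriers are extensional, i.e.\ \<^const>\<open>undefined\<close> outside their domain.
\<close>

section \<open>Algebras that need not be unital\<close>

record ('r, 'a) alg =
  acarrier :: "'a set"
  azero :: 'a
  aadd :: "'a \<Rightarrow> 'a \<Rightarrow> 'a"
  amult :: "'a \<Rightarrow> 'a \<Rightarrow> 'a"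
  ascale :: "'r \<Rightarrow> 'a \<Rightarrow> 'a"

definition alg_linear :: "('r, 'a) alg \<Rightarrow> ('r, 'b) alg \<Rightarrow> ('a \<Rightarrow> 'b) \<Rightarrow> bool" where
  "alg_linear A B f \<longleftrightarrow>
     f \<in> acarrier A \<rightarrow>\<^sub>E acarrier B \<and>
     (\<forall>x\<in>acarrier A. \<forall>y\<in>acarrier A. f (aadd A x y) = aadd B (f x) (f y)) \<and>
     (\<forall>c. \<forall>x\<in>acarrier A. f (ascale A c x) = ascale B c (f x))"

definition alg_hom :: "('r, 'a) alg \<Rightarrow> ('r, 'b) alg \<Rightarrow> ('a \<Rightarrow> 'b) \<Rightarrow> bool" where
  "alg_hom A B f \<longleftrightarrow>
     alg_linear A B f \<and>
     (\<forall>x\<in>acarrier A. \<forall>y\<in>acarrier A. f (amult A x y) = amult B (f x) (f y))"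

definition subalgebra :: "('r, 'a) alg \<Rightarrow> 'a set \<Rightarrow> bool" where
  "subalgebra A B \<longleftrightarrow>
     B \<subseteq> acarrier A \<and> azero A \<in> B \<and>
     (\<forall>x\<in>B. \<forall>y\<in>B. aadd A x y \<in> B) \<and>
     (\<forall>x\<in>B. \<forall>y\<in>B. amult A x y \<in> B) \<and>
     (\<forall>c. \<forall>x\<in>B. ascale A c x \<in> B)"

definition subalgebra_generated :: "('r, 'a) alg \<Rightarrow> 'a set \<Rightarrow> 'a set" where
  "subalgebra_generated A X = \<Inter>{B. subalgebra A B \<and> X \<subseteq> B}"

definition algebraic_conditional_expectation ::
    "('r, 'a) alg \<Rightarrow> 'a set \<Rightarrow> ('a \<Rightarrow> 'a) \<Rightarrow> bool" where
  "algebraic_conditional_expectation A B F \<longleftrightarrow>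
     subalgebra A B \<and>
     alg_linear A A F \<and>
     (\<forall>a\<in>acarrier A. F (F a) = F a) \<and>
     F ` acarrier A = B \<and>
     (\<forall>a\<in>acarrier A. \<forall>b\<in>B. F (amult A b a) = amult A b (F a) \<and> F (amult A a b) = amult A (F a) b)"

section \<open>Paths\<close>

text \<open>
  A path is a pair of its source and its list of edges, so that the vertices are the
  pairs \<open>(v, [])\<close>.
\<close>

type_synonym ('v, 'e) path = "'v \<times> 'e list"

definition path_length :: "('v, 'e) path \<Rightarrow> nat" where
  "path_length \<alpha> = length (snd \<alpha>)"

definition path_range :: "('v, 'e) pre_digraph \<Rightarrow> ('v, 'e) path \<Rightarrow> 'v" where
  "path_range E \<alpha> = (if snd \<alpha> = [] then fst \<alpha> else head E (last (snd \<alpha>)))"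

definition paths :: "('v, 'e) pre_digraph \<Rightarrow> ('v, 'e) path set" where
  "paths E = {\<alpha>. pre_digraph.awalk E (fst \<alpha>) (snd \<alpha>) (path_range E \<alpha>)}"

definition closed_path :: "('v, 'e) pre_digraph \<Rightarrow> 'e list \<Rightarrow> bool" where
  "closed_path E p \<longleftrightarrow> p \<noteq> [] \<and> (\<exists>u. pre_digraph.awalk E u p u)"

definition sink :: "('v, 'e) pre_digraph \<Rightarrow> 'v \<Rightarrow> bool" where
  "sink E v \<longleftrightarrow> v \<in> verts E \<and> out_arcs E v = {}"

definition regular_vertex :: "('v, 'e) pre_digraph \<Rightarrow> 'v \<Rightarrow> bool" where
  "regular_vertex E v \<longleftrightarrow> v \<in> verts E \<and> finite (out_arcs E v) \<and> out_arcs E v \<noteq> {}"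

definition has_exit :: "('v, 'e) pre_digraph \<Rightarrow> 'e list \<Rightarrow> bool" where
  "has_exit E p \<longleftrightarrow> (\<exists>i<length p. \<exists>e\<in>arcs E. tail E e = tail E (p ! i) \<and> e \<noteq> p ! i)"

section \<open>Leavitt path algebras\<close>

datatype 'x word = Word (letters: "'x list")

instantiation word :: (type) monoid_add
begin

definition zero_word :: "'a word" where
  "zero_word = Word []"

definition plus_word :: "'a word \<Rightarrow> 'a word \<Rightarrow> 'a word" where
  "plus_word u w = Word (letters u @ letters w)"

instance
  by standard (simp_all add: zero_word_def plus_word_def)

end

datatype ('v, 'e) gen = Vertex 'v | Edge 'e | Ghost 'e

definition generators :: "('v, 'e) pre_digraph \<Rightarrow> ('v, 'e) gen set" where
  "generators E = Vertex ` verts E \<union> Edge ` arcs E \<union> Ghost ` arcs E"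

definition pm_scale :: "'r::comm_ring \<Rightarrow> ('k \<Rightarrow>\<^sub>0 'r) \<Rightarrow> ('k \<Rightarrow>\<^sub>0 'r)" where
  "pm_scale c x = Poly_Mapping.map (\<lambda>a. c * a) x"

text \<open>
  By the instance for \<^class>\<open>monoid_add\<close> above, the multiplication of
  \<^typ>\<open>'x word \<Rightarrow>\<^sub>0 'r\<close> is that of noncommutative polynomials.  The free algebra is not
  unital: the empty word does not occur.
\<close>

definition free_algebra ::
    "('v, 'e) pre_digraph \<Rightarrow> (('v, 'e) gen word \<Rightarrow>\<^sub>0 'r::{comm_ring, comm_monoid_mult}) set" where
  "free_algebra E =
     {x. \<forall>w\<in>Poly_Mapping.keys x. letters w \<noteq> [] \<and> set (letters w) \<subseteq> generators E}"

definition free_gen ::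
    "('v, 'e) gen \<Rightarrow> (('v, 'e) gen word \<Rightarrow>\<^sub>0 'r::{comm_ring, comm_monoid_mult})" where
  "free_gen g = Poly_Mapping.single (Word [g]) 1"

inductive_set leavitt_relators ::
    "('v, 'e) pre_digraph \<Rightarrow> (('v, 'e) gen word \<Rightarrow>\<^sub>0 'r::{comm_ring, comm_monoid_mult}) set"
  for E :: "('v, 'e) pre_digraph" where
  idem: "v \<in> verts E \<Longrightarrow>
    free_gen (Vertex v) * free_gen (Vertex v) - free_gen (Vertex v) \<in> leavitt_relators E"
| orth: "v \<in> verts E \<Longrightarrow> w \<in> verts E \<Longrightarrow> v \<noteq> w \<Longrightarrow>
    free_gen (Vertex v) * free_gen (Vertex w) \<in> leavitt_relators E"
| edge_source: "e \<in> arcs E \<Longrightarrow>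
    free_gen (Vertex (tail E e)) * free_gen (Edge e) - free_gen (Edge e) \<in> leavitt_relators E"
| edge_range: "e \<in> arcs E \<Longrightarrow>
    free_gen (Edge e) * free_gen (Vertex (head E e)) - free_gen (Edge e) \<in> leavitt_relators E"
| ghost_range: "e \<in> arcs E \<Longrightarrow>
    free_gen (Vertex (head E e)) * free_gen (Ghost e) - free_gen (Ghost e) \<in> leavitt_relators E"
| ghost_source: "e \<in> arcs E \<Longrightarrow>
    free_gen (Ghost e) * free_gen (Vertex (tail E e)) - free_gen (Ghost e) \<in> leavitt_relators E"
| ck1_same: "e \<in> arcs E \<Longrightarrow>
    free_gen (Ghost e) * free_gen (Edge e) - free_gen (Vertex (head E e)) \<in> leavitt_relators E"
| ck1_diff: "e \<in> arcs E \<Longrightarrow> f \<in> arcs E \<Longrightarrow> e \<noteq> f \<Longrightarrow>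
    free_gen (Ghost e) * free_gen (Edge f) \<in> leavitt_relators E"
| ck2: "regular_vertex E v \<Longrightarrow>
    free_gen (Vertex v) - (\<Sum>e\<in>out_arcs E v. free_gen (Edge e) * free_gen (Ghost e))
      \<in> leavitt_relators E"

text \<open>The two-sided algebra ideal of the free algebra generated by the relators.\<close>

inductive_set leavitt_ideal ::
    "('v, 'e) pre_digraph \<Rightarrow> (('v, 'e) gen word \<Rightarrow>\<^sub>0 'r::{comm_ring, comm_monoid_mult}) set"
  for E :: "('v, 'e) pre_digraph" where
  zero: "0 \<in> leavitt_ideal E"
| relator: "x \<in> leavitt_relators E \<Longrightarrow> x \<in> leavitt_ideal E"
| add: "x \<in> leavitt_ideal E \<Longrightarrow> y \<in> leavitt_ideal E \<Longrightarrow> x + y \<in> leavitt_ideal E"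
| scale: "x \<in> leavitt_ideal E \<Longrightarrow> pm_scale c x \<in> leavitt_ideal E"
| mult_left: "a \<in> free_algebra E \<Longrightarrow> x \<in> leavitt_ideal E \<Longrightarrow> a * x \<in> leavitt_ideal E"
| mult_right: "a \<in> free_algebra E \<Longrightarrow> x \<in> leavitt_ideal E \<Longrightarrow> x * a \<in> leavitt_ideal E"

type_synonym ('v, 'e, 'r) lpa = "(('v, 'e) gen word \<Rightarrow>\<^sub>0 'r) set"

definition leavitt_class ::
    "('v, 'e) pre_digraph \<Rightarrow> (('v, 'e) gen word \<Rightarrow>\<^sub>0 'r::{comm_ring, comm_monoid_mult}) \<Rightarrow>
     ('v, 'e, 'r) lpa" where
  "leavitt_class E x = {y \<in> free_algebra E. y - x \<in> leavitt_ideal E}"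

definition leavitt_path_algebra ::
    "('v, 'e) pre_digraph \<Rightarrow> ('r::{comm_ring, comm_monoid_mult}, ('v, 'e, 'r) lpa) alg" where
  "leavitt_path_algebra E =
     \<lparr>acarrier = leavitt_class E ` free_algebra E,
      azero = leavitt_class E 0,
      aadd = (\<lambda>A B. \<Union>a\<in>A. \<Union>b\<in>B. leavitt_class E (a + b)),
      amult = (\<lambda>A B. \<Union>a\<in>A. \<Union>b\<in>B. leavitt_class E (a * b)),
      ascale = (\<lambda>c A. \<Union>a\<in>A. leavitt_class E (pm_scale c a))\<rparr>"

definition path_elt ::
    "('v, 'e) pre_digraph \<Rightarrow> ('v, 'e) path \<Rightarrow>
     ('v, 'e, 'r::{comm_ring, comm_monoid_mult}) lpa" where
  "path_elt E \<alpha> = leavitt_class E (Poly_Mapping.single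
     (Word (if snd \<alpha> = [] then [Vertex (fst \<alpha>)] else map Edge (snd \<alpha>))) 1)"

definition ghost_elt ::
    "('v, 'e) pre_digraph \<Rightarrow> ('v, 'e) path \<Rightarrow>
     ('v, 'e, 'r::{comm_ring, comm_monoid_mult}) lpa" where
  "ghost_elt E \<alpha> = leavitt_class E (Poly_Mapping.single
     (Word (if snd \<alpha> = [] then [Vertex (fst \<alpha>)] else map Ghost (rev (snd \<alpha>)))) 1)"

definition leavitt_monomial ::
    "('v, 'e) pre_digraph \<Rightarrow> ('v, 'e) path \<Rightarrow> ('v, 'e) path \<Rightarrow>
     ('v, 'e, 'r::{comm_ring, comm_monoid_mult}) lpa" where
  "leavitt_monomial E \<mu> \<nu> = amult (leavitt_path_algebra E) (path_elt E \<mu>) (ghost_elt E \<nu>)"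

definition leavitt_involution ::
    "('v, 'e) pre_digraph \<Rightarrow>
     ('v, 'e, 'r::{comm_ring, comm_monoid_mult}) lpa \<Rightarrow> ('v, 'e, 'r) lpa" where
  "leavitt_involution E = (THE f.
     alg_linear (leavitt_path_algebra E) (leavitt_path_algebra E) f \<and>
     (\<forall>\<alpha>\<in>paths E. \<forall>\<beta>\<in>paths E. f (leavitt_monomial E \<alpha> \<beta>) = leavitt_monomial E \<beta> \<alpha>))"

definition leavitt_normal ::
    "('v, 'e) pre_digraph \<Rightarrow> ('v, 'e, 'r::{comm_ring, comm_monoid_mult}) lpa \<Rightarrow> bool" where
  "leavitt_normal E x \<longleftrightarrow>
     amult (leavitt_path_algebra E) x (leavitt_involution E x) =
     amult (leavitt_path_algebra E) (leavitt_involution E x) x"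

definition leavitt_monomials ::
    "('v, 'e) pre_digraph \<Rightarrow> ('v, 'e, 'r::{comm_ring, comm_monoid_mult}) lpa set" where
  "leavitt_monomials E =
     {leavitt_monomial E \<mu> \<nu> | \<mu> \<nu>.
        \<mu> \<in> paths E \<and> \<nu> \<in> paths E \<and> path_range E \<mu> = path_range E \<nu>}"

definition normal_monomials ::
    "('v, 'e) pre_digraph \<Rightarrow> ('v, 'e, 'r::{comm_ring, comm_monoid_mult}) lpa set" where
  "normal_monomials E = {x \<in> leavitt_monomials E. leavitt_normal E x}"

definition commutative_core ::
    "('v, 'e) pre_digraph \<Rightarrow> ('v, 'e, 'r::{comm_ring, comm_monoid_mult}) lpa set" where
  "commutative_core E = subalgebra_generated (leavitt_path_algebra E) (normal_monomials E)"

section \<open>Trails\<close>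

datatype ('v, 'e) trail = Fin_Trail "('v, 'e) path" | Inf_Trail "'e stream"

fun is_trail :: "('v, 'e) pre_digraph \<Rightarrow> ('v, 'e) trail \<Rightarrow> bool" where
  "is_trail E (Fin_Trail \<alpha>) \<longleftrightarrow> \<alpha> \<in> paths E \<and> sink E (path_range E \<alpha>)"
| "is_trail E (Inf_Trail \<omega>) \<longleftrightarrow>
     sset \<omega> \<subseteq> arcs E \<and> (\<forall>n. head E (\<omega> !! n) = tail E (\<omega> !! Suc n))"

fun trail_source :: "('v, 'e) pre_digraph \<Rightarrow> ('v, 'e) trail \<Rightarrow> 'v" where
  "trail_source E (Fin_Trail \<alpha>) = fst \<alpha>"
| "trail_source E (Inf_Trail \<omega>) = tail E (shd \<omega>)"

text \<open>Meaningful only if the range of the path is the source of the trail.\<close>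

fun trail_append :: "('v, 'e) path \<Rightarrow> ('v, 'e) trail \<Rightarrow> ('v, 'e) trail" where
  "trail_append \<alpha> (Fin_Trail \<beta>) = Fin_Trail (fst \<alpha>, snd \<alpha> @ snd \<beta>)"
| "trail_append \<alpha> (Inf_Trail \<omega>) = Inf_Trail (snd \<alpha> @- \<omega>)"

definition trail_remainder ::
    "('v, 'e) pre_digraph \<Rightarrow> ('v, 'e) path \<Rightarrow> ('v, 'e) trail \<Rightarrow> ('v, 'e) trail \<Rightarrow> bool" where
  "trail_remainder E \<alpha> \<tau> \<beta> \<longleftrightarrow>
     is_trail E \<beta> \<and> trail_source E \<beta> = path_range E \<alpha> \<and> \<tau> = trail_append \<alpha> \<beta>"

definition initial_segment ::
    "('v, 'e) pre_digraph \<Rightarrow> ('v, 'e) path \<Rightarrow> ('v, 'e) trail \<Rightarrow> bool" where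
  "initial_segment E \<alpha> \<tau> \<longleftrightarrow> (\<exists>\<beta>. trail_remainder E \<alpha> \<tau> \<beta>)"

text \<open>Streams are indexed from \<open>0\<close>, so the index \<open>j\<close> below is one less than usual.\<close>

definition periodic_from :: "nat \<Rightarrow> nat \<Rightarrow> 'e stream \<Rightarrow> bool" where
  "periodic_from j k \<omega> \<longleftrightarrow> k \<ge> 1 \<and> (\<forall>n\<ge>j. \<omega> !! (n + k) = \<omega> !! n)"

definition periodic :: "'e stream \<Rightarrow> bool" where
  "periodic \<omega> \<longleftrightarrow> (\<exists>j k. periodic_from j k \<omega>)"

definition period :: "'e stream \<Rightarrow> 'e list" where
  "period \<omega> = (THE p. \<exists>j k. periodic_from j k \<omega> \<and>
     (\<forall>j' k'. periodic_from j' k' \<omega> \<longrightarrow> j + k \<le> j' + k') \<and> p = stake k (sdrop j \<omega>))"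

fun essentially_aperiodic :: "('v, 'e) pre_digraph \<Rightarrow> ('v, 'e) trail \<Rightarrow> bool" where
  "essentially_aperiodic E (Fin_Trail \<alpha>) \<longleftrightarrow> True"
| "essentially_aperiodic E (Inf_Trail \<omega>) \<longleftrightarrow>
     (periodic \<omega> \<and> closed_path E (period \<omega>) \<and> \<not> has_exit E (period \<omega>)) \<or>
     \<not> periodic \<omega>"

definition ess_aperiodic_trails :: "('v, 'e) pre_digraph \<Rightarrow> ('v, 'e) trail set" where
  "ess_aperiodic_trails E = {\<tau>. is_trail E \<tau> \<and> essentially_aperiodic E \<tau>}"

section \<open>The essentially aperiodic representation\<close>

type_synonym ('v, 'e, 'r) trail_comb = "(int \<times> ('v, 'e) trail) \<Rightarrow>\<^sub>0 'r"
type_synonym ('v, 'e, 'r) trail_op = "('v, 'e, 'r) trail_comb \<Rightarrow> ('v, 'e, 'r) trail_comb"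

definition trail_module ::
    "('v, 'e) pre_digraph \<Rightarrow> ('v, 'e, 'r::{comm_ring, comm_monoid_mult}) trail_comb set" where
  "trail_module E = {m. snd ` Poly_Mapping.keys m \<subseteq> ess_aperiodic_trails E}"

definition trail_module_deg ::
    "('v, 'e) pre_digraph \<Rightarrow> int \<Rightarrow>
     ('v, 'e, 'r::{comm_ring, comm_monoid_mult}) trail_comb set" where
  "trail_module_deg E i = {m \<in> trail_module E. fst ` Poly_Mapping.keys m \<subseteq> {i}}"

definition \<xi> ::
    "int \<Rightarrow> ('v, 'e) trail \<Rightarrow> ('v, 'e, 'r::{comm_ring, comm_monoid_mult}) trail_comb" where
  "\<xi> n \<tau> = Poly_Mapping.single (n, \<tau>) 1"

definition trail_endos ::
    "('v, 'e) pre_digraph \<Rightarrow> ('v, 'e, 'r::{comm_ring, comm_monoid_mult}) trail_op set" where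
  "trail_endos E = {f \<in> trail_module E \<rightarrow>\<^sub>E trail_module E.
     (\<forall>x\<in>trail_module E. \<forall>y\<in>trail_module E. f (x + y) = f x + f y) \<and>
     (\<forall>c. \<forall>x\<in>trail_module E. f (pm_scale c x) = pm_scale c (f x))}"

definition trail_endos_deg ::
    "('v, 'e) pre_digraph \<Rightarrow> int \<Rightarrow>
     ('v, 'e, 'r::{comm_ring, comm_monoid_mult}) trail_op set" where
  "trail_endos_deg E i =
     {f \<in> trail_endos E. \<forall>t. f ` trail_module_deg E t \<subseteq> trail_module_deg E (t + i)}"

text \<open>
  The carrier consists of the sums of finitely many homogeneous endomorphisms.
\<close>

definition graded_endos ::
    "('v, 'e) pre_digraph \<Rightarrow>
     ('r::{comm_ring, comm_monoid_mult}, ('v, 'e, 'r) trail_op) alg" where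
  "graded_endos E =
     \<lparr>acarrier = {f \<in> trail_endos E. \<exists>F g. finite F \<and> (\<forall>i\<in>F. g i \<in> trail_endos_deg E i) \<and>
                    (\<forall>m\<in>trail_module E. f m = (\<Sum>i\<in>F. g i m))},
      azero = (\<lambda>m\<in>trail_module E. 0),
      aadd = (\<lambda>f g. \<lambda>m\<in>trail_module E. f m + g m),
      amult = (\<lambda>f g. compose (trail_module E) f g),
      ascale = (\<lambda>c f. \<lambda>m\<in>trail_module E. pm_scale c (f m))\<rparr>"

definition lin_op ::
    "('v, 'e) pre_digraph \<Rightarrow>
     (int \<Rightarrow> ('v, 'e) trail \<Rightarrow> ('v, 'e, 'r::{comm_ring, comm_monoid_mult}) trail_comb) \<Rightarrow>
     ('v, 'e, 'r) trail_op" where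
  "lin_op E b = (\<lambda>m\<in>trail_module E.
     \<Sum>(n, \<tau>)\<in>Poly_Mapping.keys m. pm_scale (Poly_Mapping.lookup m (n, \<tau>)) (b n \<tau>))"

definition S_op ::
    "('v, 'e) pre_digraph \<Rightarrow> ('v, 'e) path \<Rightarrow>
     ('v, 'e, 'r::{comm_ring, comm_monoid_mult}) trail_op" where
  "S_op E \<alpha> = lin_op E (\<lambda>n \<tau>.
     if path_range E \<alpha> = trail_source E \<tau>
     then \<xi> (int (path_length \<alpha>) + n) (trail_append \<alpha> \<tau>) else 0)"

definition S_star_op ::
    "('v, 'e) pre_digraph \<Rightarrow> ('v, 'e) path \<Rightarrow>
     ('v, 'e, 'r::{comm_ring, comm_monoid_mult}) trail_op" where
  "S_star_op E \<alpha> = lin_op E (\<lambda>n \<tau>.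
     if initial_segment E \<alpha> \<tau>
     then \<xi> (n - int (path_length \<alpha>)) (THE \<beta>. trail_remainder E \<alpha> \<tau> \<beta>) else 0)"

definition P_op ::
    "('v, 'e) pre_digraph \<Rightarrow> ('v, 'e) path \<Rightarrow>
     ('v, 'e, 'r::{comm_ring, comm_monoid_mult}) trail_op" where
  "P_op E \<alpha> = amult (graded_endos E) (S_op E \<alpha>) (S_star_op E \<alpha>)"

definition Q_op ::
    "('v, 'e) pre_digraph \<Rightarrow> ('v, 'e) trail \<Rightarrow>
     ('v, 'e, 'r::{comm_ring, comm_monoid_mult}) trail_op" where
  "Q_op E \<tau> = lin_op E (\<lambda>n \<tau>'. if \<tau>' = \<tau> then \<xi> n \<tau> else 0)"

definition \<Pi>_ap ::
    "('v, 'e) pre_digraph \<Rightarrow>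
     ('v, 'e, 'r::{comm_ring, comm_monoid_mult}) lpa \<Rightarrow> ('v, 'e, 'r) trail_op" where
  "\<Pi>_ap E = (THE f.
     alg_hom (leavitt_path_algebra E) (graded_endos E) f \<and>
     (\<forall>\<alpha>\<in>paths E. \<forall>\<beta>\<in>paths E.
        f (leavitt_monomial E \<alpha> \<beta>) = amult (graded_endos E) (S_op E \<alpha>) (S_star_op E \<beta>)))"

definition trail_support ::
    "('v, 'e) pre_digraph \<Rightarrow> ('v, 'e, 'r::{comm_ring, comm_monoid_mult}) trail_comb \<Rightarrow>
     ('v, 'e) trail set" where
  "trail_support E m = (THE F. finite F \<and> F \<subseteq> ess_aperiodic_trails E \<and>
     (\<Sum>\<tau>\<in>F. Q_op E \<tau> m) = m \<and> (\<forall>F'. F' \<subset> F \<longrightarrow> (\<Sum>\<tau>\<in>F'. Q_op E \<tau> m) \<noteq> m))"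

definition E_ap ::
    "('v, 'e) pre_digraph \<Rightarrow>
     ('v, 'e, 'r::{comm_ring, comm_monoid_mult}) trail_op \<Rightarrow> ('v, 'e, 'r) trail_op" where
  "E_ap E T = (\<lambda>m\<in>trail_module E. \<Sum>\<tau>\<in>trail_support E m. Q_op E \<tau> (T (Q_op E \<tau> m)))"

definition P_commutant ::
    "('v, 'e) pre_digraph \<Rightarrow> ('v, 'e, 'r::{comm_ring, comm_monoid_mult}) trail_op set" where
  "P_commutant E = {T \<in> acarrier (graded_endos E). \<forall>\<alpha>\<in>paths E.
     amult (graded_endos E) T (P_op E \<alpha>) = amult (graded_endos E) (P_op E \<alpha>) T}"

end

theory Submission
  imports Defs
begin

text \<open>
  A word in the generators acts by a partial map on the pairs \<open>(\<mu>, \<nu>)\<close> of paths with a common range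
  (left multiplication of \<open>\<mu>\<nu>\<^sup>*\<close>) and on the trails. A function \<open>T\<close> of such pairs with
  \<open>T (\<mu>, \<nu>) = (\<Sum>e. T (\<mu>e, \<nu>e))\<close> whenever the common range is regular, the sum being over the
  edges that start there, induces a linear map on words that kills the relations, hence a linear
  map \<open>\<mu>\<nu>\<^sup>* \<mapsto> T (\<mu>, \<nu>)\<close> on the Leavitt path algebra. The involution is obtained in this way,
  and so is the expectation, with \<open>T (\<mu>, \<nu>)\<close> equal to \<open>\<mu>\<nu>\<^sup>*\<close> if this monomial is normal and to
  \<open>0\<close> otherwise.

  Instead of cycles without exits, one compares the actions on trails: over a nontrivial ring,
  \<open>\<mu>\<nu>\<^sup>*\<close> is normal iff \<open>\<mu>\<beta> = \<nu>\<beta>\<close> for every trail \<open>\<beta>\<close> starting at the common range. This is an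
  equivalence relation on paths, and \<open>\<mu>\<close>, \<open>\<nu>\<close> are related iff \<open>\<mu>\<gamma>\<close>, \<open>\<nu>\<gamma>\<close> are; this
  gives both the condition on \<open>T\<close> and the module property. If \<open>\<mu>\<beta> = \<nu>\<beta>\<close> for a single
  essentially aperiodic \<open>\<beta>\<close>, then \<open>\<beta>\<close> is the only trail from its source or \<open>\<mu> = \<nu>\<close>, so
  \<open>\<mu>\<nu>\<^sup>*\<close> is normal; hence \<open>E_ap\<close> keeps the normal monomials and kills the others. Finally, paths
  separate trails, so an operator that commutes with all \<open>P_\<alpha>\<close> is diagonal.
\<close>

section \<open>Linear extension\<close>

text \<open>The obstacle is the sum relation at regular vertices: it makes the monomials linearly
  dependent, and a basis would require the choice of an edge at each regular vertex. No basis is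
  chosen. The other relations send a monomial to a monomial or to zero, so partial maps can satisfy
  them exactly, and only the sum relation becomes a condition on \<open>T\<close>. The reduction of
  words behind these maps need not yield a normal form of the algebra: it is enough that it is
  correct modulo the ideal and that the induced map kills the ideal. Non-membership in the ideal
  matters only for differences of idempotents \<open>\<mu>\<mu>\<^sup>*\<close> and
  \<open>\<nu>\<nu>\<^sup>*\<close>, where it is detected by the action on trails.

  That test needs all trails; the action is restricted to the essentially aperiodic ones only for
  the representation. The coefficient ring may be the zero ring, over which every monomial is normal
  whatever its paths are; this is the origin of the disjuncts \<open>1 = 0\<close>.\<close>

lemma lookup_pm_scale [simp]:
  "Poly_Mapping.lookup (pm_scale c x) k = c * Poly_Mapping.lookup x k"
  unfolding pm_scale_def by (simp add: Poly_Mapping.map.rep_eq when_def)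

lemma pm_scale_add: "pm_scale c (x + y) = pm_scale c x + pm_scale c y"
  by (rule poly_mapping_eqI) (simp add: lookup_add distrib_left)

lemma pm_scale_left_add: "pm_scale (a + b) x = pm_scale a x + pm_scale b x"
  by (rule poly_mapping_eqI) (simp add: lookup_add distrib_right)

lemma pm_scale_diff: "pm_scale c (x - y) = pm_scale c x - pm_scale c y"
  by (rule poly_mapping_eqI) (simp add: lookup_minus right_diff_distrib)

lemma pm_scale_zero [simp]: "pm_scale c 0 = 0"
  by (rule poly_mapping_eqI) simp

lemma pm_scale_zero_left [simp]: "pm_scale 0 x = 0"
  by (rule poly_mapping_eqI) simp

lemma pm_scale_scale [simp]: "pm_scale a (pm_scale b x) = pm_scale (a * b) x"
  by (rule poly_mapping_eqI) (simp add: mult.assoc)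

lemma pm_scale_one [simp]: "pm_scale (1 :: 'r::{comm_ring, comm_monoid_mult}) x = x"
  by (rule poly_mapping_eqI) simp

lemma pm_scale_minus_one:
  "pm_scale (- 1 :: 'r::{comm_ring, comm_monoid_mult}) x = - x"
  by (rule poly_mapping_eqI) (simp flip: minus_mult_left)

lemma pm_scale_sum: "pm_scale c (sum f A) = (\<Sum>a\<in>A. pm_scale c (f a))"
  by (induction A rule: infinite_finite_induct) (simp_all add: pm_scale_add)

lemma pm_scale_single [simp]:
  "pm_scale c (Poly_Mapping.single k d) = Poly_Mapping.single k (c * d)"
  by (rule poly_mapping_eqI) (simp add: lookup_single when_def)

lemma keys_pm_scale: "Poly_Mapping.keys (pm_scale c x) \<subseteq> Poly_Mapping.keys x"
  by (auto simp: in_keys_iff)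

lemma pm_induct [case_names zero single_add]:
  fixes x :: "'k \<Rightarrow>\<^sub>0 'r::comm_monoid_add"
  assumes "P 0"
    and "\<And>k c x. P x \<Longrightarrow> k \<notin> Poly_Mapping.keys x \<Longrightarrow> c \<noteq> 0 \<Longrightarrow> P (Poly_Mapping.single k c + x)"
  shows "P x"
proof (induction x rule: update_induct)
  case const
  then show ?case by (simp add: assms(1))
next
  case (update x k c)
  have "Poly_Mapping.update k c x = Poly_Mapping.single k c + x"
    using update(1) by (intro poly_mapping_eqI)
      (auto simp: lookup_update lookup_add lookup_single when_def in_keys_iff)
  then show ?case
    using assms(2) update by simp
qed

text \<open>Serves two kinds of basis: words for the free algebra, and degrees paired with trails
  for the trail module. Functions on path pairs enter through the reduction of words.\<close>

definition linext :: "('k \<Rightarrow> 'm \<Rightarrow>\<^sub>0 'r::{comm_ring, comm_monoid_mult}) \<Rightarrow> ('k \<Rightarrow>\<^sub>0 'r) \<Rightarrow> ('m \<Rightarrow>\<^sub>0 'r)" where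
  "linext f x = (\<Sum>k\<in>Poly_Mapping.keys x. pm_scale (Poly_Mapping.lookup x k) (f k))"

lemma linext_superset:
  assumes "finite A" "Poly_Mapping.keys x \<subseteq> A"
  shows "linext f x = (\<Sum>k\<in>A. pm_scale (Poly_Mapping.lookup x k) (f k))"
  unfolding linext_def using assms
  by (intro sum.mono_neutral_left) (auto simp: in_keys_iff)

lemma linext_zero [simp]: "linext f 0 = 0"
  by (simp add: linext_def)

lemma linext_add: "linext f (x + y) = linext f x + linext f y"
proof -
  let ?A = "Poly_Mapping.keys x \<union> Poly_Mapping.keys y"
  have "linext f (x + y) = (\<Sum>k\<in>?A. pm_scale (Poly_Mapping.lookup (x + y) k) (f k))"
    by (rule linext_superset) (auto simp: keys_add)
  also have "\<dots> = (\<Sum>k\<in>?A. pm_scale (Poly_Mapping.lookup x k) (f k))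
      + (\<Sum>k\<in>?A. pm_scale (Poly_Mapping.lookup y k) (f k))"
    by (simp add: lookup_add pm_scale_left_add sum.distrib)
  also have "\<dots> = linext f x + linext f y"
    by (simp add: linext_superset[of ?A])
  finally show ?thesis .
qed

lemma linext_scale: "linext f (pm_scale c x) = pm_scale c (linext f x)"
  by (simp add: linext_superset[OF finite_keys keys_pm_scale])
    (simp add: linext_def pm_scale_sum)

lemma linext_minus: "linext f (x - y) = linext f x - linext f y"
  using linext_add[of f "x - y" y] by (simp add: algebra_simps)

lemma linext_sum: "linext f (sum g A) = (\<Sum>a\<in>A. linext f (g a))"
  by (induction A rule: infinite_finite_induct) (simp_all add: linext_add)

lemma linext_single [simp]: "linext f (Poly_Mapping.single k c) = pm_scale c (f k)"
  by (simp add: linext_superset[of "{k}"])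

lemma linext_cong:
  "(\<And>k. k \<in> Poly_Mapping.keys x \<Longrightarrow> f k = g k) \<Longrightarrow> linext f x = linext g x"
  by (simp add: linext_def)

lemma linext_linext: "linext f (linext g x) = linext (\<lambda>k. linext f (g k)) x"
  by (simp add: linext_def[of g] linext_sum linext_scale) (simp add: linext_def)

lemma linext_id: "linext (\<lambda>k. Poly_Mapping.single k 1) x = x"
  by (induction x rule: pm_induct) (simp_all add: linext_add)

lemma linext_fun_sum: "linext (\<lambda>k. \<Sum>a\<in>A. f a k) x = (\<Sum>a\<in>A. linext (f a) x)"
  by (simp add: linext_def pm_scale_sum sum.swap[of _ _ A])

lemma linext_fun_zero [simp]: "linext (\<lambda>k. 0) x = 0"
  by (simp add: linext_def)

text \<open>Both sides are linear in each factor, so it suffices to multiply single terms. In this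
  form, multiplication by an element of the free algebra becomes the insertion of letters before or
  after a word.\<close>

lemma linext_mult:
  "linext f (x * y) = linext (\<lambda>a. linext (\<lambda>b. f (a + b)) y) x"
proof (induction x rule: pm_induct)
  case (single_add k c x)
  have "linext f (Poly_Mapping.single k c * y) = pm_scale c (linext (\<lambda>b. f (k + b)) y)"
  proof (induction y rule: pm_induct)
    case (single_add j d y)
    then show ?case
      by (simp add: distrib_left linext_add mult_single pm_scale_add)
  qed simp
  with single_add show ?case
    by (simp add: distrib_right linext_add)
qed simp

lemma linext_commute:
  "linext (\<lambda>a. linext (\<lambda>b. f a b) y) x = linext (\<lambda>b. linext (\<lambda>a. f a b) x) y"
  by (simp add: linext_def pm_scale_sum mult.commute sum.swap[of _ "Poly_Mapping.keys y"])

text \<open>The target \<open>J\<close> of a vanishing statement: \<open>{0}\<close> for the action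
  on trails, the Leavitt ideal for maps into the algebra. One induction over the ideal thus serves
  both.\<close>

definition submodule :: "('k \<Rightarrow>\<^sub>0 'r::{comm_ring, comm_monoid_mult}) set \<Rightarrow> bool" where
  "submodule J \<longleftrightarrow> 0 \<in> J \<and> (\<forall>x\<in>J. \<forall>y\<in>J. x + y \<in> J) \<and> (\<forall>c. \<forall>x\<in>J. pm_scale c x \<in> J)"

lemma submoduleD:
  assumes "submodule J"
  shows "0 \<in> J" "x \<in> J \<Longrightarrow> y \<in> J \<Longrightarrow> x + y \<in> J" "x \<in> J \<Longrightarrow> pm_scale c x \<in> J"
    "x \<in> J \<Longrightarrow> - x \<in> J" "x \<in> J \<Longrightarrow> y \<in> J \<Longrightarrow> x - y \<in> J"
proof -
  show *: "0 \<in> J" "x \<in> J \<Longrightarrow> y \<in> J \<Longrightarrow> x + y \<in> J" "x \<in> J \<Longrightarrow> pm_scale c x \<in> J" for x y c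
    using assms by (auto simp: submodule_def)
  show **: "x \<in> J \<Longrightarrow> - x \<in> J" for x
    using *(3)[of x "- 1"] by (simp add: pm_scale_minus_one)
  show "x \<in> J \<Longrightarrow> y \<in> J \<Longrightarrow> x - y \<in> J"
    using *(2)[of x "- y"] **[of y] by simp
qed

lemma submodule_sum:
  assumes "submodule J" "\<And>a. a \<in> A \<Longrightarrow> f a \<in> J"
  shows "sum f A \<in> J"
  using assms(2) by (induction A rule: infinite_finite_induct)
    (auto intro: submoduleD[OF assms(1)])

lemma submodule_linext:
  assumes "submodule J" "\<And>k. k \<in> Poly_Mapping.keys x \<Longrightarrow> f k \<in> J"
  shows "linext f x \<in> J"
  unfolding linext_def using assms by (intro submodule_sum submoduleD(3)) auto

lemma linext_fun_diff: "linext (\<lambda>k. f k - g k) x = linext f x - linext g x"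
  by (simp add: linext_def pm_scale_diff sum_subtractf)

lemma submodule_trivial: "submodule {0}"
  by (simp add: submodule_def)

lemma mult_eq_linext:
  "x * y = linext (\<lambda>a. linext (\<lambda>b. Poly_Mapping.single (a + b) 1) y) x"
  using linext_mult[of "\<lambda>k. Poly_Mapping.single k 1" x y] by (simp add: linext_id)

lemma pm_scale_mult_left:
  fixes x y :: "'k::monoid_add \<Rightarrow>\<^sub>0 'r::{comm_ring, comm_monoid_mult}"
  shows "pm_scale c x * y = pm_scale c (x * y)"
  by (simp add: mult_eq_linext linext_scale)

lemma pm_scale_mult_right:
  fixes x y :: "'k::monoid_add \<Rightarrow>\<^sub>0 'r::{comm_ring, comm_monoid_mult}"
  shows "x * pm_scale c y = pm_scale c (x * y)"
  by (simp add: mult_eq_linext linext_scale)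
    (simp add: linext_def pm_scale_sum mult.left_commute)

section \<open>The quotient of the free algebra\<close>

lemma plus_Word [simp]: "Word u + Word w = Word (u @ w)"
  by (simp add: plus_word_def)

lemma letters_plus [simp]: "letters (u + w) = letters u @ letters w"
  by (simp add: plus_word_def)

text \<open>The operations on classes are unions over all representatives; independence of the
  representatives makes such a union a single class.\<close>

lemma UN_eq_const: "A \<noteq> {} \<Longrightarrow> (\<And>a. a \<in> A \<Longrightarrow> f a = c) \<Longrightarrow> (\<Union>a\<in>A. f a) = c"
  by auto

context wf_digraph
begin

abbreviation "lcarrier \<equiv> acarrier (leavitt_path_algebra G)"
abbreviation "lzero \<equiv> azero (leavitt_path_algebra G)"
abbreviation "ladd \<equiv> aadd (leavitt_path_algebra G)"
abbreviation "lmult \<equiv> amult (leavitt_path_algebra G)"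
abbreviation "lscale \<equiv> ascale (leavitt_path_algebra G)"

lemma free_algebra_submodule: "submodule (free_algebra G)"
  using keys_add keys_pm_scale unfolding submodule_def free_algebra_def by fastforce

lemmas free_algebraD = submoduleD[OF free_algebra_submodule]

lemma free_algebra_mult: "x \<in> free_algebra G \<Longrightarrow> y \<in> free_algebra G \<Longrightarrow> x * y \<in> free_algebra G"
  using keys_mult[of x y] unfolding free_algebra_def by fastforce

lemma free_algebra_single:
  "w \<noteq> [] \<Longrightarrow> set w \<subseteq> generators G \<Longrightarrow> Poly_Mapping.single (Word w) c \<in> free_algebra G"
  unfolding free_algebra_def by (auto simp: keys_single split: if_splits)

lemma Vertex_generator [simp]: "Vertex v \<in> generators G \<longleftrightarrow> v \<in> verts G"
  and Edge_generator [simp]: "Edge e \<in> generators G \<longleftrightarrow> e \<in> arcs G"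
  and Ghost_generator [simp]: "Ghost e \<in> generators G \<longleftrightarrow> e \<in> arcs G"
  by (auto simp: generators_def)

lemma free_gen_mult: "free_gen g * free_gen h = Poly_Mapping.single (Word [g, h]) 1"
  by (simp add: free_gen_def mult_single)

lemma leavitt_relators_free_algebra: "leavitt_relators G \<subseteq> free_algebra G"
proof
  fix x :: "('a, 'b) gen word \<Rightarrow>\<^sub>0 'c"
  assume "x \<in> leavitt_relators G"
  then show "x \<in> free_algebra G"
    by cases (auto simp: free_gen_mult free_gen_def regular_vertex_def out_arcs_def
        intro!: free_algebraD(5) free_algebra_mult free_algebra_single submodule_sum[OF free_algebra_submodule])
qed

lemma leavitt_ideal_submodule: "submodule (leavitt_ideal G)"
  unfolding submodule_def by (auto intro: leavitt_ideal.intros)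

lemmas leavitt_idealD = submoduleD[OF leavitt_ideal_submodule]

lemma leavitt_ideal_free_algebra: "x \<in> leavitt_ideal G \<Longrightarrow> x \<in> free_algebra G"
  by (induction rule: leavitt_ideal.induct)
    (use leavitt_relators_free_algebra in \<open>auto intro: free_algebraD free_algebra_mult\<close>)

lemma mem_leavitt_class: "x \<in> free_algebra G \<Longrightarrow> x \<in> leavitt_class G x"
  by (simp add: leavitt_class_def leavitt_ideal.zero)

lemma leavitt_class_eqI: "x - y \<in> leavitt_ideal G \<Longrightarrow> leavitt_class G x = leavitt_class G y"
proof -
  assume xy: "x - y \<in> leavitt_ideal G"
  have "z - x \<in> leavitt_ideal G \<longleftrightarrow> z - y \<in> leavitt_ideal G" for z
  proof
    show "z - y \<in> leavitt_ideal G" if "z - x \<in> leavitt_ideal G"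
      using leavitt_idealD(2)[OF that xy] by simp
    show "z - x \<in> leavitt_ideal G" if "z - y \<in> leavitt_ideal G"
      using leavitt_idealD(5)[OF that xy] by simp
  qed
  then show ?thesis by (simp add: leavitt_class_def)
qed

lemma leavitt_class_eq_iff:
  assumes "x \<in> free_algebra G"
  shows "leavitt_class G x = leavitt_class G y \<longleftrightarrow> x - y \<in> leavitt_ideal G"
proof
  assume "leavitt_class G x = leavitt_class G y"
  with mem_leavitt_class[OF assms] have "x \<in> leavitt_class G y" by simp
  then show "x - y \<in> leavitt_ideal G" by (simp add: leavitt_class_def)
qed (rule leavitt_class_eqI)

lemma leavitt_class_add:
  assumes "x \<in> free_algebra G" "y \<in> free_algebra G"
  shows "ladd (leavitt_class G x) (leavitt_class G y)
    = leavitt_class G (x + y)"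
proof -
  have "leavitt_class G (a + b) = leavitt_class G (x + y)"
    if "a \<in> leavitt_class G x" "b \<in> leavitt_class G y" for a b
  proof (rule leavitt_class_eqI)
    have "(a - x) + (b - y) \<in> leavitt_ideal G"
      using that by (intro leavitt_idealD(2)) (simp_all add: leavitt_class_def)
    then show "a + b - (x + y) \<in> leavitt_ideal G"
      by (simp only: add_diff_add)
  qed
  moreover have "leavitt_class G x \<noteq> {}" "leavitt_class G y \<noteq> {}"
    using assms[THEN mem_leavitt_class] by auto
  ultimately show ?thesis
    unfolding leavitt_path_algebra_def alg.simps
    by (intro UN_eq_const) assumption+
qed

lemma leavitt_class_mult:
  assumes "x \<in> free_algebra G" "y \<in> free_algebra G"
  shows "lmult (leavitt_class G x) (leavitt_class G y)
    = leavitt_class G (x * y)"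
proof -
  have "leavitt_class G (a * b) = leavitt_class G (x * y)"
    if "a \<in> leavitt_class G x" "b \<in> leavitt_class G y" for a b
  proof (rule leavitt_class_eqI)
    have "(a - x) * b + x * (b - y) \<in> leavitt_ideal G"
      using that assms
      by (intro leavitt_ideal.add leavitt_ideal.mult_left leavitt_ideal.mult_right)
        (auto simp: leavitt_class_def)
    then show "a * b - x * y \<in> leavitt_ideal G"
      by (simp add: algebra_simps)
  qed
  moreover have "leavitt_class G x \<noteq> {}" "leavitt_class G y \<noteq> {}"
    using assms[THEN mem_leavitt_class] by auto
  ultimately show ?thesis
    unfolding leavitt_path_algebra_def alg.simps
    by (intro UN_eq_const) assumption+
qed

lemma leavitt_class_scale:
  assumes "x \<in> free_algebra G"
  shows "lscale c (leavitt_class G x) = leavitt_class G (pm_scale c x)"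
proof -
  have "leavitt_class G (pm_scale c a) = leavitt_class G (pm_scale c x)"
    if "a \<in> leavitt_class G x" for a
  proof (rule leavitt_class_eqI)
    have "pm_scale c (a - x) \<in> leavitt_ideal G"
      using that by (intro leavitt_idealD(3)) (simp add: leavitt_class_def)
    then show "pm_scale c a - pm_scale c x \<in> leavitt_ideal G"
      by (simp only: pm_scale_diff)
  qed
  moreover have "leavitt_class G x \<noteq> {}"
    using mem_leavitt_class[OF assms] by auto
  ultimately show ?thesis
    unfolding leavitt_path_algebra_def alg.simps
    by (intro UN_eq_const) assumption+
qed

lemma leavitt_zero: "lzero = leavitt_class G 0"
  by (simp add: leavitt_path_algebra_def)

lemma leavitt_carrierI:
  "x \<in> free_algebra G \<Longrightarrow> leavitt_class G x \<in> lcarrier"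
  by (simp add: leavitt_path_algebra_def)

lemma leavitt_carrierE:
  assumes "X \<in> lcarrier"
  obtains x where "x \<in> free_algebra G" "X = leavitt_class G x"
  using assms by (auto simp: leavitt_path_algebra_def)

end

section \<open>Partial actions of the generators\<close>

text \<open>The last letter acts first, as in a product of operators; \<open>None\<close> stands for
  zero.\<close>

definition wact :: "('g \<Rightarrow> 'z \<Rightarrow> 'z option) \<Rightarrow> 'g list \<Rightarrow> 'z \<Rightarrow> 'z option" where
  "wact act w z = foldr (\<lambda>g y. Option.bind y (act g)) w (Some z)"

lemma wact_Nil [simp]: "wact act [] z = Some z"
  and wact_Cons [simp]: "wact act (g # w) z = Option.bind (wact act w z) (act g)"
  by (simp_all add: wact_def)

lemma wact_append [simp]: "wact act (u @ w) z = Option.bind (wact act w z) (wact act u)"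
  by (induction u) auto

definition opt_ext :: "('z \<Rightarrow> 'm::zero) \<Rightarrow> 'z option \<Rightarrow> 'm" where
  "opt_ext T y = (case y of None \<Rightarrow> 0 | Some z \<Rightarrow> T z)"

lemma opt_ext_simps [simp]: "opt_ext T None = 0" "opt_ext T (Some z) = T z"
  by (simp_all add: opt_ext_def)

text \<open>Each relator except the one at a regular vertex is a monomial or a difference of two
  monomials, so it is imposed on the partial maps themselves. The remaining one is a sum: it is
  imposed on the values of \<open>T\<close>, modulo \<open>J\<close>, and with an arbitrary prefix
  \<open>a\<close>, since left factors act after it.\<close>

locale leavitt_action = wf_digraph G for G :: "('v, 'e) pre_digraph" (structure) +
  fixes Z :: "'z set" and act :: "('v, 'e) gen \<Rightarrow> 'z \<Rightarrow> 'z option"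
    and T :: "'z \<Rightarrow> 'm \<Rightarrow>\<^sub>0 'r::{comm_ring, comm_monoid_mult}" and J :: "('m \<Rightarrow>\<^sub>0 'r) set"
  assumes closed: "g \<in> generators G \<Longrightarrow> z \<in> Z \<Longrightarrow> act g z = Some z' \<Longrightarrow> z' \<in> Z"
    and act_idem: "v \<in> verts G \<Longrightarrow> z \<in> Z \<Longrightarrow>
      wact act [Vertex v, Vertex v] z = wact act [Vertex v] z"
    and act_orth: "v \<in> verts G \<Longrightarrow> w \<in> verts G \<Longrightarrow> v \<noteq> w \<Longrightarrow> z \<in> Z \<Longrightarrow>
      wact act [Vertex v, Vertex w] z = None"
    and act_edge_source: "e \<in> arcs G \<Longrightarrow> z \<in> Z \<Longrightarrow>
      wact act [Vertex (tail G e), Edge e] z = wact act [Edge e] z"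
    and act_edge_range: "e \<in> arcs G \<Longrightarrow> z \<in> Z \<Longrightarrow>
      wact act [Edge e, Vertex (head G e)] z = wact act [Edge e] z"
    and act_ghost_range: "e \<in> arcs G \<Longrightarrow> z \<in> Z \<Longrightarrow>
      wact act [Vertex (head G e), Ghost e] z = wact act [Ghost e] z"
    and act_ghost_source: "e \<in> arcs G \<Longrightarrow> z \<in> Z \<Longrightarrow>
      wact act [Ghost e, Vertex (tail G e)] z = wact act [Ghost e] z"
    and act_ck1_same: "e \<in> arcs G \<Longrightarrow> z \<in> Z \<Longrightarrow>
      wact act [Ghost e, Edge e] z = wact act [Vertex (head G e)] z"
    and act_ck1_diff: "e \<in> arcs G \<Longrightarrow> f \<in> arcs G \<Longrightarrow> e \<noteq> f \<Longrightarrow> z \<in> Z \<Longrightarrow>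
      wact act [Ghost e, Edge f] z = None"
    and submodule: "submodule J"
    and act_ck2: "regular_vertex G v \<Longrightarrow> set a \<subseteq> generators G \<Longrightarrow> z \<in> Z \<Longrightarrow>
      opt_ext T (wact act (a @ [Vertex v]) z)
        - (\<Sum>e\<in>out_arcs G v. opt_ext T (wact act (a @ [Edge e, Ghost e]) z)) \<in> J"
begin

lemma wact_closed: "set w \<subseteq> generators G \<Longrightarrow> z \<in> Z \<Longrightarrow> wact act w z = Some z' \<Longrightarrow> z' \<in> Z"
  by (induction w arbitrary: z') (auto simp: Option.bind_eq_Some_conv intro: closed)

text \<open>The fixed prefix \<open>a\<close> is what makes the induction over the ideal go through.\<close>

lemma linext_leavitt_ideal:
  assumes "x \<in> leavitt_ideal G" "set a \<subseteq> generators G" "z \<in> Z"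
  shows "linext (\<lambda>w. opt_ext T (wact act (a @ letters w) z)) x \<in> J"
  using assms
proof (induction arbitrary: a z rule: leavitt_ideal.induct)
  case zero
  then show ?case by (simp add: submoduleD[OF submodule])
next
  case (relator x)
  have eq: "linext (\<lambda>w. opt_ext T (wact act (a @ letters w) z))
        (Poly_Mapping.single (Word u) 1 - Poly_Mapping.single (Word w) 1) \<in> J"
    if "wact act u z = wact act w z" for u w
    using that by (simp add: linext_minus submoduleD[OF submodule])
  have eq0: "linext (\<lambda>w. opt_ext T (wact act (a @ letters w) z)) (Poly_Mapping.single (Word u) 1) \<in> J"
    if "wact act u z = None" for u
    using that by (simp add: submoduleD[OF submodule])
  from relator(1) show ?case
  proof cases
    case (idem v)
    then show ?thesis using eq act_idem relator(3) by (simp only: free_gen_mult) (simp only: free_gen_def)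
  next
    case (orth v w)
    then show ?thesis using eq0 act_orth relator(3) by (simp only: free_gen_mult simp_thms)
  next
    case (edge_source e)
    then show ?thesis using eq act_edge_source relator(3) by (simp only: free_gen_mult) (simp only: free_gen_def)
  next
    case (edge_range e)
    then show ?thesis using eq act_edge_range relator(3) by (simp only: free_gen_mult) (simp only: free_gen_def)
  next
    case (ghost_range e)
    then show ?thesis using eq act_ghost_range relator(3) by (simp only: free_gen_mult) (simp only: free_gen_def)
  next
    case (ghost_source e)
    then show ?thesis using eq act_ghost_source relator(3) by (simp only: free_gen_mult) (simp only: free_gen_def)
  next
    case (ck1_same e)
    then show ?thesis using eq act_ck1_same relator(3) by (simp only: free_gen_mult) (simp only: free_gen_def)
  next
    case (ck1_diff e f)
    then show ?thesis using eq0 act_ck1_diff relator(3) by (simp only: free_gen_mult simp_thms)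
  next
    case (ck2 v)
    then show ?thesis
      using act_ck2[OF _ relator(2,3), of v]
      by (simp only: free_gen_mult) (simp add: free_gen_def linext_minus linext_sum)
  qed
next
  case (add x y)
  then show ?case by (simp add: linext_add submoduleD[OF submodule])
next
  case (scale x c)
  then show ?case by (simp add: linext_scale submoduleD[OF submodule])
next
  case (mult_left b x)
  have "linext (\<lambda>w. opt_ext T (wact act (a @ letters w) z)) (b * x) =
      linext (\<lambda>u. linext (\<lambda>w. opt_ext T (wact act ((a @ letters u) @ letters w) z)) x) b"
    by (simp only: linext_mult letters_plus append_assoc)
  also have "\<dots> \<in> J"
    using mult_left by (intro submodule_linext[OF submodule] mult_left.IH)
      (auto simp: free_algebra_def)
  finally show ?case .
next
  case (mult_right b x)
  have "linext (\<lambda>w. opt_ext T (wact act (a @ letters w) z)) (x * b) =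
      linext (\<lambda>w. linext (\<lambda>u. opt_ext T (wact act (a @ letters w @ letters u) z)) b) x"
    by (simp only: linext_mult letters_plus)
  also have "\<dots> = linext (\<lambda>u. linext (\<lambda>w. opt_ext T (wact act (a @ letters w @ letters u) z)) x) b"
    by (rule linext_commute)
  also have "\<dots> \<in> J"
  proof (rule submodule_linext[OF submodule])
    fix u assume u: "u \<in> Poly_Mapping.keys b"
    show "linext (\<lambda>w. opt_ext T (wact act (a @ letters w @ letters u) z)) x \<in> J"
    \<comment> \<open>A right factor acts before \<open>x\<close>: it moves the starting point to
      some \<open>z'\<close>, to which the induction hypothesis applies because \<open>Z\<close> is
      closed. Left factors only lengthen the prefix.\<close>
    proof (cases "wact act (letters u) z")
      case None
      then show ?thesis by (simp add: submoduleD[OF submodule])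
    next
      case (Some z')
      have "set (letters u) \<subseteq> generators G"
        using mult_right.hyps(1) u by (simp add: free_algebra_def)
      then have "z' \<in> Z"
        using wact_closed mult_right.prems(2) Some by blast
      moreover have "wact act (a @ letters w @ letters u) z = wact act (a @ letters w) z'" for w
        by (simp add: Some)
      ultimately show ?thesis
        using mult_right.IH[of a z'] mult_right.prems(1) by (simp only:)
    qed
  qed
  finally show ?case .
qed

end

section \<open>Paths and the reduction of words\<close>

text \<open>Agrees with \<open>awalk\<close> (see \<open>awalk_iff_walk\<close>), but recurses along
  the edges and leaves the end vertex to \<open>path_range\<close>, which suits inductions that
  strip the first edge.\<close>

fun walk :: "('v, 'e) pre_digraph \<Rightarrow> 'v \<Rightarrow> 'e list \<Rightarrow> bool" where
  "walk E u [] \<longleftrightarrow> u \<in> verts E"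
| "walk E u (e # p) \<longleftrightarrow> e \<in> arcs E \<and> tail E e = u \<and> walk E (head E e) p"

lemma path_range_Nil [simp]: "path_range E (u, []) = u"
  and path_range_Cons [simp]: "path_range E (u, e # p) = path_range E (head E e, p)"
  and path_range_snoc [simp]: "path_range E (u, p @ [e]) = head E e"
  by (auto simp: path_range_def)

lemma path_range_append [simp]:
  "path_range E (u, p @ q) = path_range E (path_range E (u, p), q)"
  by (induction p arbitrary: u) auto

definition path_snoc :: "('v, 'e) path \<Rightarrow> 'e \<Rightarrow> ('v, 'e) path" where
  "path_snoc \<mu> e = (fst \<mu>, snd \<mu> @ [e])"

lemma path_snoc_simps [simp]:
  "path_snoc (u, p) e = (u, p @ [e])" "path_range E (path_snoc \<mu> e) = head E e"
  by (simp_all add: path_snoc_def)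

text \<open>Letters change the first path at its start. If that path is trivial, a ghost letter
  passes to the other side by \<open>e\<^sup>*\<nu>\<^sup>* = (\<nu>e)\<^sup>*\<close> and lengthens
  the second path at its end.\<close>

fun pact :: "('v, 'e) pre_digraph \<Rightarrow> ('v, 'e) gen \<Rightarrow> ('v, 'e) path \<times> ('v, 'e) path \<Rightarrow>
    (('v, 'e) path \<times> ('v, 'e) path) option" where
  "pact E (Vertex v) ((u, p), \<nu>) = (if u = v then Some ((u, p), \<nu>) else None)"
| "pact E (Edge e) ((u, p), \<nu>) = (if head E e = u then Some ((tail E e, e # p), \<nu>) else None)"
| "pact E (Ghost e) ((u, []), \<nu>) =
     (if tail E e = u then Some ((head E e, []), path_snoc \<nu> e) else None)"
| "pact E (Ghost e) ((u, f # p), \<nu>) = (if e = f then Some ((head E e, p), \<nu>) else None)"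

definition path_pairs :: "('v, 'e) pre_digraph \<Rightarrow> (('v, 'e) path \<times> ('v, 'e) path) set" where
  "path_pairs E = {(\<mu>, \<nu>). \<mu> \<in> paths E \<and> \<nu> \<in> paths E \<and> path_range E \<mu> = path_range E \<nu>}"

definition ck2_compatible :: "('v, 'e) pre_digraph \<Rightarrow> ('m \<Rightarrow>\<^sub>0 'r::{comm_ring, comm_monoid_mult}) set \<Rightarrow>
    (('v, 'e) path \<times> ('v, 'e) path \<Rightarrow> 'm \<Rightarrow>\<^sub>0 'r) \<Rightarrow> bool" where
  "ck2_compatible E J T \<longleftrightarrow> submodule J \<and>
     (\<forall>\<mu> \<nu>. (\<mu>, \<nu>) \<in> path_pairs E \<longrightarrow> regular_vertex E (path_range E \<mu>) \<longrightarrow>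
        T (\<mu>, \<nu>) - (\<Sum>e\<in>out_arcs E (path_range E \<mu>). T (path_snoc \<mu> e, path_snoc \<nu> e)) \<in> J)"

text \<open>The vertex \<open>v\<close> with \<open>g v = g\<close> in the algebra; for an edge this
  is its head, because the right neighbour of a letter acts first.\<close>

fun gen_source :: "('v, 'e) pre_digraph \<Rightarrow> ('v, 'e) gen \<Rightarrow> 'v" where
  "gen_source E (Vertex v) = v"
| "gen_source E (Edge e) = head E e"
| "gen_source E (Ghost e) = tail E e"

definition vertex_pair :: "'v \<Rightarrow> ('v, 'e) path \<times> ('v, 'e) path" where
  "vertex_pair v = ((v, []), (v, []))"

text \<open>There is no unit to apply a word to, so it is applied to the vertex that its last letter
  absorbs on the right. The empty word, for which \<open>last\<close> is unspecified, does not occur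
  in the free algebra.\<close>

definition red :: "('v, 'e) pre_digraph \<Rightarrow> ('v, 'e) gen list \<Rightarrow>
    (('v, 'e) path \<times> ('v, 'e) path) option" where
  "red E w = wact (pact E) w (vertex_pair (gen_source E (last w)))"

definition path_word :: "('v, 'e) path \<Rightarrow> ('v, 'e) gen list" where
  "path_word \<alpha> = (if snd \<alpha> = [] then [Vertex (fst \<alpha>)] else map Edge (snd \<alpha>))"

definition ghost_word :: "('v, 'e) path \<Rightarrow> ('v, 'e) gen list" where
  "ghost_word \<alpha> = (if snd \<alpha> = [] then [Vertex (fst \<alpha>)] else map Ghost (rev (snd \<alpha>)))"

text \<open>Vertex letters of trivial paths are kept, so that this is literally the word of the
  product in \<open>leavitt_monomial\<close>.\<close>

definition monomial_word :: "('v, 'e) path \<times> ('v, 'e) path \<Rightarrow> ('v, 'e) gen list" where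
  "monomial_word p = path_word (fst p) @ ghost_word (snd p)"

definition monomial :: "('v, 'e) path \<times> ('v, 'e) path \<Rightarrow>
    (('v, 'e) gen word \<Rightarrow>\<^sub>0 'r::{comm_ring, comm_monoid_mult})" where
  "monomial p = Poly_Mapping.single (Word (monomial_word p)) 1"

definition pair_ext :: "('v, 'e) pre_digraph \<Rightarrow>
    (('v, 'e) path \<times> ('v, 'e) path \<Rightarrow> 'm \<Rightarrow>\<^sub>0 'r::{comm_ring, comm_monoid_mult}) \<Rightarrow>
    (('v, 'e) gen word \<Rightarrow>\<^sub>0 'r) \<Rightarrow> 'm \<Rightarrow>\<^sub>0 'r" where
  "pair_ext E T x = linext (\<lambda>w. opt_ext T (red E (letters w))) x"

context wf_digraph
begin

lemma walk_source: "walk G u p \<Longrightarrow> u \<in> verts G"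
  by (cases p) auto

lemma walk_range: "walk G u p \<Longrightarrow> path_range G (u, p) \<in> verts G"
  by (induction p arbitrary: u) auto

lemma walk_append [simp]:
  "walk G u (p @ q) \<longleftrightarrow> walk G u p \<and> walk G (path_range G (u, p)) q"
  by (induction p arbitrary: u) (auto dest: walk_source)

lemma walk_arcs: "walk G u p \<Longrightarrow> set p \<subseteq> arcs G"
  by (induction p arbitrary: u) auto

lemma awalk_iff_walk: "awalk u p v \<longleftrightarrow> walk G u p \<and> v = path_range G (u, p)"
  by (induction p arbitrary: u) (auto simp: awalk_Cons_iff awalk_Nil_iff)

lemma paths_iff_walk: "\<alpha> \<in> paths G \<longleftrightarrow> walk G (fst \<alpha>) (snd \<alpha>)"
  by (simp add: paths_def awalk_iff_walk)

lemma path_pairs_iff: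
  "((u, p), (w, q)) \<in> path_pairs G \<longleftrightarrow>
     walk G u p \<and> walk G w q \<and> path_range G (u, p) = path_range G (w, q)"
  by (simp add: path_pairs_def paths_iff_walk)

lemma path_pairs_swap: "(\<mu>, \<nu>) \<in> path_pairs G \<Longrightarrow> (\<nu>, \<mu>) \<in> path_pairs G"
  by (simp add: path_pairs_def)

lemma path_pairs_snoc:
  assumes "(\<mu>, \<nu>) \<in> path_pairs G" "e \<in> out_arcs G (path_range G \<mu>)"
  shows "(path_snoc \<mu> e, path_snoc \<nu> e) \<in> path_pairs G"
  using assms by (cases \<mu>; cases \<nu>) (auto simp: path_pairs_iff out_arcs_def)

lemma vertex_pair_mem: "v \<in> verts G \<Longrightarrow> vertex_pair v \<in> path_pairs G"
  by (simp add: vertex_pair_def path_pairs_iff)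

lemma gen_source_verts: "g \<in> generators G \<Longrightarrow> gen_source G g \<in> verts G"
  by (cases g) auto

lemma pact_closed:
  assumes "g \<in> generators G" "p \<in> path_pairs G" "pact G g p = Some p'"
  shows "p' \<in> path_pairs G"
proof -
  obtain u q \<nu> where p: "p = ((u, q), \<nu>)" by (metis prod.collapse)
  show ?thesis
    using assms by (cases g; cases q; cases \<nu>) (auto simp: p path_pairs_iff split: if_splits)
qed

text \<open>Appending \<open>e\<close> to both paths inserts \<open>ee\<^sup>*\<close> between them,
  and this commutes with every letter that acts on the first path alone. The exception is a ghost
  letter \<open>f\<close> at a trivial first path: it annihilates all summands but
  \<open>e = f\<close>, and the surviving one equals the result without insertion. The induction is
  from the right end, where the letters act first.\<close>

lemma pact_ck2_tail:
  assumes T: "ck2_compatible G J T" and a: "set a \<subseteq> generators G"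
    and p: "(\<mu>, \<nu>) \<in> path_pairs G" and reg: "regular_vertex G (path_range G \<mu>)"
  shows "opt_ext T (wact (pact G) a (\<mu>, \<nu>))
      - (\<Sum>e\<in>out_arcs G (path_range G \<mu>).
          opt_ext T (wact (pact G) a (path_snoc \<mu> e, path_snoc \<nu> e))) \<in> J"
  using a p reg
proof (induction a arbitrary: \<mu> \<nu> rule: rev_induct)
  case Nil
  then show ?case using T unfolding ck2_compatible_def wact_Nil opt_ext_simps by blast
next
  case (snoc g a)
  obtain u p where \<mu>: "\<mu> = (u, p)" by (cases \<mu>)
  have J: "0 \<in> J" using T submoduleD(1) by (auto simp: ck2_compatible_def)
  show ?case
  proof (cases "\<exists>f. g = Ghost f \<and> p = []")
    case True
    then obtain f where g: "g = Ghost f" and p: "p = []" by blast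
    show ?thesis
    proof (cases "tail G f = u")
      case True
      then have f: "f \<in> out_arcs G u" "finite (out_arcs G u)"
        using snoc.prems by (auto simp: g \<mu> p out_arcs_def regular_vertex_def)
      have "(\<Sum>e\<in>out_arcs G u. opt_ext T (wact (pact G) (a @ [g]) (path_snoc \<mu> e, path_snoc \<nu> e)))
        = (\<Sum>e\<in>out_arcs G u. if e = f
            then opt_ext T (wact (pact G) a ((head G f, []), path_snoc \<nu> f)) else 0)"
        by (intro sum.cong) (auto simp: g \<mu> p)
      also have "\<dots> = opt_ext T (wact (pact G) a ((head G f, []), path_snoc \<nu> f))"
        using f by simp
      finally show ?thesis using True J by (simp add: g \<mu> p)
    next
      case False
      have "(\<Sum>e\<in>out_arcs G u. opt_ext T (wact (pact G) (a @ [g]) (path_snoc \<mu> e, path_snoc \<nu> e)))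
        = (\<Sum>e\<in>out_arcs G u. 0)"
        using False by (intro sum.cong) (auto simp: g \<mu> p out_arcs_def)
      with False show ?thesis using J by (simp add: g \<mu> p)
    qed
  next
    case False
    show ?thesis
    proof (cases "pact G g (\<mu>, \<nu>)")
      case None
      then have "pact G g (path_snoc \<mu> e, path_snoc \<nu> e) = None" for e
        using False by (cases g; cases p) (auto simp: \<mu> split: if_splits)
      with None show ?thesis using J by simp
    next
      case (Some z)
      then obtain \<mu>' where z: "z = (\<mu>', \<nu>)" "path_range G \<mu>' = path_range G \<mu>"
        "\<And>e. pact G g (path_snoc \<mu> e, path_snoc \<nu> e) = Some (path_snoc \<mu>' e, path_snoc \<nu> e)"
        using False by (cases g; cases p) (auto simp: \<mu> split: if_splits)
      have "(\<mu>', \<nu>) \<in> path_pairs G"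
        using pact_closed[OF _ _ Some] snoc.prems z by simp
      with Some z show ?thesis
        using snoc.IH[of \<mu>' \<nu>] snoc.prems by simp
    qed
  qed
qed

lemma leavitt_action_pact:
  assumes T: "ck2_compatible G J T"
  shows "leavitt_action G (path_pairs G) (pact G) T J"
proof
  show "z' \<in> path_pairs G"
    if "g \<in> generators G" "z \<in> path_pairs G" "pact G g z = Some z'" for g z z'
    using that by (rule pact_closed)
  show "submodule J" using T by (simp add: ck2_compatible_def)
  have J: "0 \<in> J" using T submoduleD(1) by (auto simp: ck2_compatible_def)
  fix z :: "('a, 'b) path \<times> ('a, 'b) path"
  assume z: "z \<in> path_pairs G"
  obtain u p w q where zeq: "z = ((u, p), (w, q))" by (metis prod.collapse)
  have p: "p \<noteq> [] \<Longrightarrow> tail G (hd p) = u"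
    using z by (cases p) (auto simp: zeq path_pairs_iff)
  show "wact (pact G) [Vertex v, Vertex v] z = wact (pact G) [Vertex v] z" for v
    by (simp add: zeq)
  show "wact (pact G) [Vertex v, Vertex v'] z = None" if "v \<noteq> v'" for v v'
    using that by (simp add: zeq)
  show "wact (pact G) [Vertex (tail G e), Edge e] z = wact (pact G) [Edge e] z" for e
    by (simp add: zeq)
  show "wact (pact G) [Edge e, Vertex (head G e)] z = wact (pact G) [Edge e] z" for e
    by (simp add: zeq)
  show "wact (pact G) [Vertex (head G e), Ghost e] z = wact (pact G) [Ghost e] z" for e
    by (cases p) (auto simp: zeq)
  show "wact (pact G) [Ghost e, Vertex (tail G e)] z = wact (pact G) [Ghost e] z" for e
    using p by (cases p) (auto simp: zeq)
  show "wact (pact G) [Ghost e, Edge e] z = wact (pact G) [Vertex (head G e)] z" for e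
    by (simp add: zeq)
  show "wact (pact G) [Ghost e, Edge f] z = None" if "e \<noteq> f" for e f
    using that by (simp add: zeq)
  show "opt_ext T (wact (pact G) (a @ [Vertex v]) z)
        - (\<Sum>e\<in>out_arcs G v. opt_ext T (wact (pact G) (a @ [Edge e, Ghost e]) z)) \<in> J"
    if v: "regular_vertex G v" and a: "set a \<subseteq> generators G" for v a
  proof (cases "u = v")
    case False
    have "(\<Sum>e\<in>out_arcs G v. opt_ext T (wact (pact G) (a @ [Edge e, Ghost e]) z))
        = (\<Sum>e\<in>out_arcs G v. 0)"
      using False p by (intro sum.cong) (cases p; auto simp: zeq out_arcs_def)+
    with False J show ?thesis by (simp add: zeq)
  next
    case u: True
    show ?thesis
    \<comment> \<open>If the first path is trivial, the word \<open>ee\<^sup>*\<close> appends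
      \<open>e\<close> to both paths, and the condition on \<open>T\<close> is needed. Otherwise
      \<open>ee\<^sup>*\<close> fixes the pair when \<open>e\<close> is its first edge and kills it
      for all other \<open>e\<close>.\<close>
    proof (cases p)
      case Nil
      have "(\<Sum>e\<in>out_arcs G v. opt_ext T (wact (pact G) (a @ [Edge e, Ghost e]) z))
        = (\<Sum>e\<in>out_arcs G v. opt_ext T (wact (pact G) a (path_snoc (u, p) e, path_snoc (w, q) e)))"
        by (intro sum.cong) (auto simp: zeq Nil u out_arcs_def)
      with u show ?thesis
        using pact_ck2_tail[OF T a, of "(u, p)" "(w, q)"] z v by (simp add: zeq Nil)
    next
      case (Cons f p')
      have f: "f \<in> out_arcs G v" "finite (out_arcs G v)"
        using z u v by (auto simp: zeq Cons path_pairs_iff out_arcs_def regular_vertex_def)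
      have "(\<Sum>e\<in>out_arcs G v. opt_ext T (wact (pact G) (a @ [Edge e, Ghost e]) z))
        = (\<Sum>e\<in>out_arcs G v. if e = f then opt_ext T (wact (pact G) a z) else 0)"
        using p by (intro sum.cong) (auto simp: zeq u Cons)
      also have "\<dots> = opt_ext T (wact (pact G) a z)"
        using f by simp
      finally show ?thesis using J u by (simp add: zeq)
    qed
  qed
qed

lemma wact_pact_source:
  assumes "w \<noteq> []" "v \<noteq> gen_source G (last w)"
  shows "wact (pact G) w (vertex_pair v) = None"
proof -
  have "pact G (last w) (vertex_pair v) = None"
    using assms(2) by (cases "last w") (auto simp: vertex_pair_def)
  then show ?thesis
    using wact_append[of "pact G" "butlast w" "[last w]" "vertex_pair v"] assms(1) by simp
qed

text \<open>\<open>red\<close> starts each word at a vertex of its own, whereas the induction over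
  the ideal works with one fixed start. Summing over the finitely many vertices that occur
  reconciles the two, as a word is zero at every vertex but its own.\<close>

theorem pair_ext_leavitt_ideal:
  assumes T: "ck2_compatible G J T" and x: "x \<in> leavitt_ideal G"
  shows "pair_ext G T x \<in> J"
proof -
  interpret leavitt_action G "path_pairs G" "pact G" T J
    by (rule leavitt_action_pact[OF T])
  have keys: "letters w \<noteq> []" "set (letters w) \<subseteq> generators G" if "w \<in> Poly_Mapping.keys x" for w
    using leavitt_ideal_free_algebra[OF x] that by (auto simp: free_algebra_def)
  define V where "V = (\<lambda>w. gen_source G (last (letters w))) ` Poly_Mapping.keys x"
  have V: "finite V" "V \<subseteq> verts G"
    using keys gen_source_verts last_in_set by (fastforce simp: V_def)+
  have "opt_ext T (red G (letters w))
      = (\<Sum>v\<in>V. opt_ext T (wact (pact G) ([] @ letters w) (vertex_pair v)))"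
    if "w \<in> Poly_Mapping.keys x" for w
  proof -
    have "(\<Sum>v\<in>V. opt_ext T (wact (pact G) ([] @ letters w) (vertex_pair v)))
        = (\<Sum>v\<in>V. if v = gen_source G (last (letters w)) then opt_ext T (red G (letters w)) else 0)"
      using keys(1)[OF that] wact_pact_source by (intro sum.cong) (auto simp: red_def)
    then show ?thesis using V that by (simp add: V_def)
  qed
  then have "pair_ext G T x
      = (\<Sum>v\<in>V. linext (\<lambda>w. opt_ext T (wact (pact G) ([] @ letters w) (vertex_pair v))) x)"
    unfolding pair_ext_def linext_fun_sum[symmetric] by (rule linext_cong)
  also have "\<dots> \<in> J"
    using V by (intro submodule_sum[OF submodule] linext_leavitt_ideal[OF x] vertex_pair_mem) auto
  finally show ?thesis .
qed

subsection \<open>Reduction modulo the ideal\<close>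

text \<open>The type token in \<open>weq\<close> and \<open>wnull\<close> fixes the coefficient ring.\<close>

definition weq :: "'r::{comm_ring, comm_monoid_mult} itself \<Rightarrow>
    ('a, 'b) gen list \<Rightarrow> ('a, 'b) gen list \<Rightarrow> bool" where
  "weq _ u w \<longleftrightarrow>
     Poly_Mapping.single (Word u) (1::'r) - Poly_Mapping.single (Word w) 1 \<in> leavitt_ideal G"

definition wnull :: "'r::{comm_ring, comm_monoid_mult} itself \<Rightarrow> ('a, 'b) gen list \<Rightarrow> bool" where
  "wnull _ u \<longleftrightarrow> Poly_Mapping.single (Word u) (1::'r) \<in> leavitt_ideal G"

lemma single_Nil_mult [simp]:
  fixes x :: "('v, 'e) gen word \<Rightarrow>\<^sub>0 'r::{comm_ring, comm_monoid_mult}"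
  shows "Poly_Mapping.single (Word []) 1 * x = x" "x * Poly_Mapping.single (Word []) 1 = x"
  by (induction x rule: pm_induct)
    (simp_all add: distrib_left distrib_right mult_single plus_word_def)

text \<open>Empty contexts are split off: the empty word is a unit for the product, but it lies
  outside the free algebra, from which the multipliers of the ideal are taken.\<close>

lemma leavitt_ideal_context:
  assumes "x \<in> leavitt_ideal G" "set a \<subseteq> generators G" "set b \<subseteq> generators G"
  shows "Poly_Mapping.single (Word a) 1 * x * Poly_Mapping.single (Word b) 1 \<in> leavitt_ideal G"
proof -
  have "Poly_Mapping.single (Word a) 1 * x \<in> leavitt_ideal G"
    using assms by (cases "a = []") (auto intro!: leavitt_ideal.mult_left free_algebra_single)
  then show ?thesis
    using assms by (cases "b = []") (auto intro!: leavitt_ideal.mult_right free_algebra_single)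
qed

lemma weq_refl [simp]: "weq t u u"
  by (simp add: weq_def leavitt_ideal.zero)

lemma weq_sym: "weq t u w \<Longrightarrow> weq t w u"
  using leavitt_idealD(4) by (fastforce simp: weq_def)

lemma weq_trans [trans]: "weq t u v \<Longrightarrow> weq t v w \<Longrightarrow> weq t u w"
  using leavitt_idealD(2) by (fastforce simp: weq_def)

lemma wnull_weq [trans]: "weq t u w \<Longrightarrow> wnull t w \<Longrightarrow> wnull t u"
  using leavitt_idealD(2) by (fastforce simp: weq_def wnull_def)

lemma weq_context:
  "weq t u w \<Longrightarrow> set a \<subseteq> generators G \<Longrightarrow> set b \<subseteq> generators G \<Longrightarrow> weq t (a @ u @ b) (a @ w @ b)"
  unfolding weq_def by (drule leavitt_ideal_context[of _ a b])
    (auto simp: algebra_simps mult_single)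

lemma wnull_context:
  "wnull t u \<Longrightarrow> set a \<subseteq> generators G \<Longrightarrow> set b \<subseteq> generators G \<Longrightarrow> wnull t (a @ u @ b)"
  unfolding wnull_def by (drule leavitt_ideal_context[of _ a b])
    (auto simp: algebra_simps mult_single)

lemmas leavitt_relators_words =
  leavitt_relators.intros[of _ G, unfolded free_gen_mult, unfolded free_gen_def]

lemma weq_relators:
  "v \<in> verts G \<Longrightarrow> weq t [Vertex v, Vertex v] [Vertex v]"
  "e \<in> arcs G \<Longrightarrow> weq t [Vertex (tail G e), Edge e] [Edge e]"
  "e \<in> arcs G \<Longrightarrow> weq t [Edge e, Vertex (head G e)] [Edge e]"
  "e \<in> arcs G \<Longrightarrow> weq t [Vertex (head G e), Ghost e] [Ghost e]"
  "e \<in> arcs G \<Longrightarrow> weq t [Ghost e, Vertex (tail G e)] [Ghost e]"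
  "e \<in> arcs G \<Longrightarrow> weq t [Ghost e, Edge e] [Vertex (head G e)]"
  unfolding weq_def
  by (intro leavitt_ideal.relator leavitt_relators_words; assumption)+

lemma wnull_relators:
  "v \<in> verts G \<Longrightarrow> w \<in> verts G \<Longrightarrow> v \<noteq> w \<Longrightarrow> wnull t [Vertex v, Vertex w]"
  "e \<in> arcs G \<Longrightarrow> f \<in> arcs G \<Longrightarrow> e \<noteq> f \<Longrightarrow> wnull t [Ghost e, Edge f]"
  unfolding wnull_def
  by (intro leavitt_ideal.relator leavitt_relators_words; assumption)+

end

text \<open>Uses an arbitrary representative; by \<open>leavitt_ext_class\<close> the choice is
  immaterial once \<open>T\<close> is compatible with the sum relation modulo the ideal.\<close>

definition leavitt_ext :: "('v, 'e) pre_digraph \<Rightarrow>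
    (('v, 'e) path \<times> ('v, 'e) path \<Rightarrow> ('v, 'e) gen word \<Rightarrow>\<^sub>0 'r::{comm_ring, comm_monoid_mult}) \<Rightarrow>
    ('v, 'e, 'r) lpa \<Rightarrow> ('v, 'e, 'r) lpa" where
  "leavitt_ext E T =
     (\<lambda>X\<in>acarrier (leavitt_path_algebra E). leavitt_class E (pair_ext E T (SOME x. x \<in> X)))"

context wf_digraph
begin

lemma weq_Cons: "g \<in> generators G \<Longrightarrow> weq t u w \<Longrightarrow> weq t (g # u) (g # w)"
  using weq_context[of t u w "[g]" "[]"] by simp

lemma wnull_Cons: "g \<in> generators G \<Longrightarrow> wnull t u \<Longrightarrow> wnull t (g # u)"
  using wnull_context[of t u "[g]" "[]"] by simp

lemma weq_prefix:
  assumes "set b \<subseteq> generators G"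
  shows "v \<in> verts G \<Longrightarrow> weq t (Vertex v # Vertex v # b) (Vertex v # b)"
    "e \<in> arcs G \<Longrightarrow> weq t (Vertex (tail G e) # Edge e # b) (Edge e # b)"
    "e \<in> arcs G \<Longrightarrow> weq t (Edge e # Vertex (head G e) # b) (Edge e # b)"
    "e \<in> arcs G \<Longrightarrow> weq t (Vertex (head G e) # Ghost e # b) (Ghost e # b)"
    "e \<in> arcs G \<Longrightarrow> weq t (Ghost e # Vertex (tail G e) # b) (Ghost e # b)"
    "e \<in> arcs G \<Longrightarrow> weq t (Ghost e # Edge e # b) (Vertex (head G e) # b)"
  using weq_context[OF weq_relators(1), of v "[]" b] weq_context[OF weq_relators(2), of e "[]" b]
    weq_context[OF weq_relators(3), of e "[]" b] weq_context[OF weq_relators(4), of e "[]" b]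
    weq_context[OF weq_relators(5), of e "[]" b] weq_context[OF weq_relators(6), of e "[]" b] assms
  by simp_all

lemma wnull_prefix:
  assumes "set b \<subseteq> generators G"
  shows "v \<in> verts G \<Longrightarrow> w \<in> verts G \<Longrightarrow> v \<noteq> w \<Longrightarrow> wnull t (Vertex v # Vertex w # b)"
    "e \<in> arcs G \<Longrightarrow> f \<in> arcs G \<Longrightarrow> e \<noteq> f \<Longrightarrow> wnull t (Ghost e # Edge f # b)"
  using wnull_context[OF wnull_relators(1), of v w "[]" b]
    wnull_context[OF wnull_relators(2), of e f "[]" b] assms
  by simp_all

lemma path_word_generators: "\<alpha> \<in> paths G \<Longrightarrow> set (path_word \<alpha>) \<subseteq> generators G"
  using walk_arcs[of "fst \<alpha>" "snd \<alpha>"] walk_source[of "fst \<alpha>" "snd \<alpha>"]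
  by (auto simp: paths_iff_walk path_word_def)

lemma ghost_word_generators: "\<alpha> \<in> paths G \<Longrightarrow> set (ghost_word \<alpha>) \<subseteq> generators G"
  using walk_arcs[of "fst \<alpha>" "snd \<alpha>"] walk_source[of "fst \<alpha>" "snd \<alpha>"]
  by (auto simp: paths_iff_walk ghost_word_def)

lemma path_word_nonempty [simp]: "path_word \<alpha> \<noteq> []" and ghost_word_nonempty [simp]: "ghost_word \<alpha> \<noteq> []"
  by (simp_all add: path_word_def ghost_word_def)

lemma monomial_word_generators: "p \<in> path_pairs G \<Longrightarrow> set (monomial_word p) \<subseteq> generators G"
  using path_word_generators ghost_word_generators
  by (fastforce simp: monomial_word_def path_pairs_def)

lemma monomial_free_algebra: "p \<in> path_pairs G \<Longrightarrow> monomial p \<in> free_algebra G"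
  unfolding monomial_def using monomial_word_generators
  by (intro free_algebra_single) (auto simp: monomial_word_def)

lemma pact_reduction:
  assumes g: "g \<in> generators G" and p: "p \<in> path_pairs G"
  shows "case pact G g p of None \<Rightarrow> wnull t (g # monomial_word p)
    | Some p' \<Rightarrow> weq t (g # monomial_word p) (monomial_word p')"
proof -
  obtain u r w q where peq: "p = ((u, r), (w, q))" by (metis prod.collapse)
  define b where "b = ghost_word (w, q)"
  have b: "set b \<subseteq> generators G"
    using p ghost_word_generators by (auto simp: b_def peq path_pairs_def)
  have walks: "walk G u r" "walk G w q" "path_range G (u, r) = path_range G (w, q)"
    using p by (auto simp: peq path_pairs_iff)
  have u: "u \<in> verts G" using walks walk_source by blast
  show ?thesis
  proof (cases r)
    case Nil
    have word: "monomial_word p = Vertex u # b"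
      by (simp add: peq Nil monomial_word_def path_word_def b_def)
    show ?thesis
    proof (cases g)
      case (Vertex v)
      then show ?thesis
        using g u weq_prefix(1)[OF b, of v t] wnull_prefix(1)[OF b, of v u t]
        by (auto simp: word) (auto simp: peq Nil monomial_word_def path_word_def b_def)
    next
      case (Edge e)
      show ?thesis
      proof (cases "head G e = u")
        case True
        then show ?thesis
          using g b weq_prefix(3) Edge
          by (simp add: word) (auto simp: peq Nil monomial_word_def path_word_def b_def)
      next
        case False
        have "weq t (Edge e # Vertex u # b) (Edge e # Vertex (head G e) # Vertex u # b)"
          using g b u Edge by (intro weq_sym[OF weq_prefix(3)]) auto
        also have "wnull t (Edge e # Vertex (head G e) # Vertex u # b)"
          using g b u Edge False by (intro wnull_Cons wnull_prefix) auto
        finally show ?thesis using False Edge by (simp add: peq Nil monomial_word_def path_word_def b_def)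
      qed
    next
      case (Ghost e)
      show ?thesis
      proof (cases "tail G e = u")
        case True
        have q: "set (map Ghost (rev q)) \<subseteq> generators G"
          using walk_arcs[OF walks(2)] by auto
        have "weq t (Ghost e # Vertex u # b) (Ghost e # map Ghost (rev q))"
        \<comment> \<open>The ghost word of a trivial path is a vertex letter and not the empty
          word; the new ghost letter has to absorb it.\<close>
        proof (cases "q = []")
          case q: True
          have "weq t (Ghost e # Vertex u # b) (Ghost e # [Vertex u])"
            using g walks u weq_Cons[OF g, of t] weq_prefix(1)[of "[]" u t] Ghost
            by (simp add: b_def ghost_word_def q Nil)
          also have "weq t \<dots> [Ghost e]"
            using g u weq_prefix(5)[of "[]" e t] Ghost True by simp
          finally show ?thesis by (simp add: q)
        next
          case False
          then show ?thesis
            using g b u Ghost True weq_prefix(5)[of b e t] by (simp add: b_def ghost_word_def)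
        qed
        also have "weq t \<dots> (Vertex (head G e) # Ghost e # map Ghost (rev q))"
          using g q Ghost by (intro weq_sym[OF weq_prefix(4)]) auto
        finally show ?thesis
          using True Ghost
          by (cases "q = []") (simp_all add: peq Nil monomial_word_def path_word_def ghost_word_def b_def)
      next
        case False
        have "weq t (Ghost e # Vertex u # b) (Ghost e # Vertex (tail G e) # Vertex u # b)"
          using g b u Ghost by (intro weq_sym[OF weq_prefix(5)]) auto
        also have "wnull t (Ghost e # Vertex (tail G e) # Vertex u # b)"
          using g b u Ghost False by (intro wnull_Cons wnull_prefix) auto
        finally show ?thesis using False Ghost by (simp add: peq Nil monomial_word_def path_word_def b_def)
      qed
    qed
  next
    case (Cons f r')
    define c where "c = map Edge r' @ b"
    have word: "monomial_word p = Edge f # c"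
      by (simp add: peq Cons monomial_word_def path_word_def b_def c_def)
    have f: "f \<in> arcs G" "tail G f = u" "walk G (head G f) r'"
      using walks by (auto simp: Cons)
    have c: "set c \<subseteq> generators G"
      using b walk_arcs[OF f(3)] by (auto simp: c_def)
    have c': "set (Edge f # c) \<subseteq> generators G"
      using c f by simp
    show ?thesis
    proof (cases g)
      case (Vertex v)
      show ?thesis
      proof (cases "v = u")
        case True
        then show ?thesis
          using f c weq_prefix(2)[of c f t] Vertex by (simp add: peq Cons monomial_word_def path_word_def b_def c_def)
      next
        case False
        have "weq t (Vertex v # Edge f # c) (Vertex v # Vertex u # Edge f # c)"
          using f c g Vertex weq_prefix(2)[of c f t] by (intro weq_Cons weq_sym[of _ "Vertex u # _"]) auto
        also have "wnull t \<dots>"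
          using g u c' Vertex False by (intro wnull_prefix) auto
        finally show ?thesis using False Vertex by (simp add: peq Cons monomial_word_def path_word_def b_def c_def)
      qed
    next
      case (Edge e)
      show ?thesis
      proof (cases "head G e = u")
        case True
        then show ?thesis
          using Edge by (simp add: word) (simp add: peq Cons monomial_word_def path_word_def c_def b_def)
      next
        case False
        have "weq t (Edge e # Edge f # c) (Edge e # Vertex (head G e) # Edge f # c)"
          using g c' Edge by (intro weq_sym[OF weq_prefix(3)]) auto
        also have "weq t \<dots> (Edge e # Vertex (head G e) # Vertex u # Edge f # c)"
          using g f c Edge weq_prefix(2)[of c f t]
          by (intro weq_Cons weq_sym[of _ "Vertex u # _"]) auto
        also have "wnull t \<dots>"
          using g u c' Edge False by (intro wnull_Cons wnull_prefix) auto
        finally show ?thesis using False Edge by (simp add: peq Cons monomial_word_def path_word_def b_def c_def)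
      qed
    next
      case (Ghost e)
      show ?thesis
      proof (cases "e = f")
        case True
        have "weq t (Ghost f # Edge f # c) (Vertex (head G f) # c)"
          by (rule weq_prefix(6)) (use f c in auto)
        also have "weq t \<dots> (path_word (head G f, r') @ b)"
        proof (cases r')
          case (Cons h s)
          then have "set (map Edge s @ b) \<subseteq> generators G" "h \<in> arcs G" "tail G h = head G f"
            using c f by (auto simp: c_def)
          then show ?thesis
            using weq_prefix(2)[of "map Edge s @ b" h t] by (simp add: c_def path_word_def Cons)
        qed (simp add: c_def path_word_def)
        finally show ?thesis
          using True Ghost by (simp add: peq Cons monomial_word_def path_word_def b_def c_def)
      next
        case False
        then show ?thesis
          using g f c wnull_prefix(2)[of c e f t] Ghost by (simp add: peq Cons monomial_word_def path_word_def b_def c_def)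
      qed
    qed
  qed
qed

lemma wact_reduction:
  assumes "set w \<subseteq> generators G" "p \<in> path_pairs G"
  shows "case wact (pact G) w p of None \<Rightarrow> wnull t (w @ monomial_word p)
    | Some p' \<Rightarrow> p' \<in> path_pairs G \<and> weq t (w @ monomial_word p) (monomial_word p')"
  using assms(1)
proof (induction w)
  case Nil
  then show ?case using assms by simp
next
  case (Cons g w)
  show ?case
  proof (cases "wact (pact G) w p")
    case None
    then show ?thesis using Cons by (auto intro: wnull_Cons)
  next
    case (Some p')
    with Cons have p': "p' \<in> path_pairs G" "weq t (g # w @ monomial_word p) (g # monomial_word p')"
      by (auto intro: weq_Cons)
    then show ?thesis
      using pact_reduction[of g p' t] Cons.prems Some pact_closed[of g p']
      by (auto split: option.splits intro: weq_trans wnull_weq)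
  qed
qed

lemma red_reduction:
  assumes "w \<noteq> []" "set w \<subseteq> generators G"
  shows "case red G w of None \<Rightarrow> wnull t w
    | Some p \<Rightarrow> p \<in> path_pairs G \<and> weq t w (monomial_word p)"
proof -
  define v where "v = gen_source G (last w)"
  have w: "w = butlast w @ [last w]" "set (butlast w) \<subseteq> generators G" "last w \<in> generators G"
    using assms by (auto dest: in_set_butlastD)
  have v: "v \<in> verts G" using w gen_source_verts by (simp add: v_def)
  \<comment> \<open>The monomial of a vertex pair is the two-letter word \<open>v v\<close>, so the
    right vertex of the last letter is inserted twice.\<close>
  have "weq t [last w] ([last w] @ monomial_word (vertex_pair v))"
  proof (cases "last w")
    case (Vertex u)
    then have "u \<in> verts G" "v = u" using w v by (auto simp: v_def)
    have "weq t [Vertex u] [Vertex u, Vertex u]"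
      by (rule weq_sym[OF weq_prefix(1)]) (use \<open>u \<in> verts G\<close> in auto)
    also have "weq t \<dots> [Vertex u, Vertex u, Vertex u]"
      by (rule weq_sym[OF weq_prefix(1)]) (use \<open>u \<in> verts G\<close> in auto)
    finally show ?thesis
      by (simp add: Vertex \<open>v = u\<close> monomial_word_def vertex_pair_def path_word_def ghost_word_def)
  next
    case (Edge e)
    then have e: "e \<in> arcs G" "v = head G e" using w v by (auto simp: v_def)
    have "weq t [Edge e] [Edge e, Vertex v]"
      unfolding e by (rule weq_sym[OF weq_prefix(3)]) (use e in auto)
    also have "weq t \<dots> [Edge e, Vertex v, Vertex v]"
      unfolding e by (rule weq_sym[OF weq_prefix(3)]) (use e in auto)
    finally show ?thesis
      by (simp add: Edge monomial_word_def vertex_pair_def path_word_def ghost_word_def)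
  next
    case (Ghost e)
    then have e: "e \<in> arcs G" "v = tail G e" using w v by (auto simp: v_def)
    have "weq t [Ghost e] [Ghost e, Vertex v]"
      unfolding e by (rule weq_sym[OF weq_prefix(5)]) (use e in auto)
    also have "weq t \<dots> [Ghost e, Vertex v, Vertex v]"
      unfolding e by (rule weq_sym[OF weq_prefix(5)]) (use e in auto)
    finally show ?thesis
      by (simp add: Ghost monomial_word_def vertex_pair_def path_word_def ghost_word_def)
  qed
  then have "weq t (butlast w @ [last w] @ [])
      (butlast w @ ([last w] @ monomial_word (vertex_pair v)) @ [])"
    using w by (intro weq_context) auto
  then have *: "weq t w (w @ monomial_word (vertex_pair v))"
    using w(1) by (metis append_Nil2 append_assoc)
  show ?thesis
    using wact_reduction[OF assms(2) vertex_pair_mem[OF v], of t] weq_trans[OF *] wnull_weq[OF *]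
    by (auto simp: red_def v_def split: option.splits)
qed

text \<open>With \<open>T = monomial\<close>, \<open>pair_ext\<close> replaces each word by its
  reduction. Hence the monomials span the algebra, and each element has a representative that is a
  combination of them.\<close>

lemma diff_pair_ext_monomial:
  assumes x: "x \<in> free_algebra G"
  shows "x - pair_ext G monomial x \<in> leavitt_ideal G"
proof -
  have "x - pair_ext G monomial x
      = linext (\<lambda>w. Poly_Mapping.single w 1 - opt_ext monomial (red G (letters w))) x"
    by (simp add: linext_fun_diff linext_id pair_ext_def)
  also have "\<dots> \<in> leavitt_ideal G"
  proof (rule submodule_linext[OF leavitt_ideal_submodule])
    fix w assume "w \<in> Poly_Mapping.keys x"
    then have w: "letters w \<noteq> []" "set (letters w) \<subseteq> generators G"
      using x by (auto simp: free_algebra_def)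
    show "Poly_Mapping.single w (1::'c) - opt_ext monomial (red G (letters w)) \<in> leavitt_ideal G"
      using red_reduction[OF w, where t = "TYPE('c)"]
      by (auto simp: wnull_def weq_def monomial_def split: option.splits)
  qed
  finally show ?thesis .
qed

section \<open>Products of monomials, by comparison of the two inner paths\<close>

lemma path_word_act:
  "walk G u p \<Longrightarrow> wact (pact G) (path_word (u, p)) ((v, c), \<nu>)
    = (if v = path_range G (u, p) then Some ((u, p @ c), \<nu>) else None)"
proof -
  have "wact (pact G) (map Edge p) ((v, c), \<nu>)
    = (if v = path_range G (u, p) then Some ((u, p @ c), \<nu>) else None)"
    if "walk G u p" "p \<noteq> []"
    using that
  proof (induction p arbitrary: u)
    case (Cons e p)
    then show ?case
      by (cases "p = []"; cases \<nu>) (auto simp: Option.bind_eq_Some_conv)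
  qed simp
  then show "walk G u p \<Longrightarrow> ?thesis"
    by (auto simp: path_word_def)
qed

lemma ghost_word_act_longer:
  assumes "walk G w q"
  shows "wact (pact G) (ghost_word (w, q)) ((w, q @ c), \<nu>) = Some ((path_range G (w, q), c), \<nu>)"
proof -
  have "wact (pact G) (map Ghost (rev q)) ((w, q @ c), \<nu>) = Some ((path_range G (w, q), c), \<nu>)"
    using assms by (induction q arbitrary: w) auto
  then show ?thesis by (auto simp: ghost_word_def)
qed

lemma ghost_word_act_shorter:
  assumes "walk G w (q @ c)"
  shows "wact (pact G) (ghost_word (w, q @ c)) ((w, q), (w', r))
    = Some ((path_range G (w, q @ c), []), (w', r @ c))"
proof -
  have *: "wact (pact G) (map Ghost (rev c)) ((u, []), (w', r))
      = Some ((path_range G (u, c), []), (w', r @ c))" if "walk G u c" for u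
    using that by (induction c arbitrary: u r) auto
  have "wact (pact G) (map Ghost (rev q)) ((w, q), (w', r)) = Some ((path_range G (w, q), []), (w', r))"
    using assms ghost_word_act_longer[of w q "[]" "(w', r)"]
    by (cases "q = []") (auto simp: ghost_word_def)
  with * assms show ?thesis by (auto simp: ghost_word_def)
qed

text \<open>In \<open>\<nu>\<^sup>*\<mu>\<close> the edges cancel from the start as long as they
  agree, and the first disagreement gives zero; so a nonzero product forces one path to extend the
  other.\<close>

lemma ghost_word_actD:
  assumes "walk G w q" "walk G u p" "wact (pact G) (ghost_word (w, q)) ((u, p), \<nu>) \<noteq> None"
  shows "u = w \<and> (\<exists>c. p = q @ c \<or> q = p @ c)"
proof -
  have "u = w \<and> (\<exists>c. p = q @ c \<or> q = p @ c)"
    if "q \<noteq> []" "wact (pact G) (map Ghost (rev q)) ((u, p), \<nu>) \<noteq> None"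
    using that assms(1,2)
  proof (induction q arbitrary: u w p \<nu>)
    case (Cons e q)
    show ?case
    proof (cases p)
      case Nil
      with Cons.prems show ?thesis by (auto split: if_splits)
    next
      case p: (Cons f p')
      with Cons.prems have "e = f" "wact (pact G) (map Ghost (rev q)) ((head G e, p'), \<nu>) \<noteq> None"
        by (auto split: if_splits)
      with Cons.IH[of "head G e" p' \<nu> "head G e"] Cons.prems p show ?thesis
        by (cases "q = []") auto
    qed
  qed simp
  with assms show ?thesis
    by (cases "q = []") (auto simp: ghost_word_def split: if_splits)
qed

lemma monomial_word_act_longer:
  assumes "((u, p), (w, q)) \<in> path_pairs G"
  shows "wact (pact G) (monomial_word ((u, p), (w, q))) ((w, q @ c), \<nu>) = Some ((u, p @ c), \<nu>)"
  using assms by (simp add: monomial_word_def ghost_word_act_longer path_word_act path_pairs_iff)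

lemma monomial_word_act_shorter:
  assumes "((u, p), (w, q @ c)) \<in> path_pairs G"
  shows "wact (pact G) (monomial_word ((u, p), (w, q @ c))) ((w, q), (w', r)) = Some ((u, p), (w', r @ c))"
  using assms by (auto simp: monomial_word_def ghost_word_act_shorter path_word_act path_pairs_iff)

lemma monomial_word_actD:
  assumes "((u, p), (w, q)) \<in> path_pairs G" "walk G u' p'"
    "wact (pact G) (monomial_word ((u, p), (w, q))) ((u', p'), \<nu>) \<noteq> None"
  shows "u' = w \<and> (\<exists>c. p' = q @ c \<or> q = p' @ c)"
  using assms ghost_word_actD[of w q u' p' \<nu>]
  by (cases "wact (pact G) (ghost_word (w, q)) ((u', p'), \<nu>)")
    (auto simp: monomial_word_def path_pairs_iff)

lemma gen_source_last_ghost_word: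
  "walk G w q \<Longrightarrow> gen_source G (last (ghost_word (w, q))) = w"
  by (cases q) (auto simp: ghost_word_def)

lemma red_append_ghost_word:
  assumes "walk G w q"
  shows "red G (a @ ghost_word (w, q)) = wact (pact G) a ((path_range G (w, q), []), (w, q))"
  using assms ghost_word_act_shorter[of w "[]" q w "[]"]
  by (simp add: red_def gen_source_last_ghost_word vertex_pair_def)

lemma red_monomial_word:
  assumes "\<mu> \<in> paths G" "\<nu> \<in> paths G"
  shows "red G (monomial_word (\<mu>, \<nu>))
    = (if path_range G \<mu> = path_range G \<nu> then Some (\<mu>, \<nu>) else None)"
  using assms by (cases \<mu>; cases \<nu>)
    (auto simp: monomial_word_def red_append_ghost_word path_word_act paths_iff_walk)

lemma pair_ext_monomial [simp]: "p \<in> path_pairs G \<Longrightarrow> pair_ext G T (monomial p) = T p"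
  by (auto simp: pair_ext_def monomial_def red_monomial_word path_pairs_def)

text \<open>The description of the involution quantifies also over paths with different ranges; both
  monomials involved are then zero.\<close>

lemma monomial_null:
  assumes "\<mu> \<in> paths G" "\<nu> \<in> paths G" "path_range G \<mu> \<noteq> path_range G \<nu>"
  shows "monomial (\<mu>, \<nu>) \<in> leavitt_ideal G"
  using red_reduction[of "monomial_word (\<mu>, \<nu>)"] red_monomial_word[OF assms(1,2)] assms
    path_word_generators[of \<mu>] ghost_word_generators[of \<nu>]
  by (auto simp: monomial_def wnull_def monomial_word_def)

lemma leavitt_monomial_eq:
  assumes "\<mu> \<in> paths G" "\<nu> \<in> paths G"
  shows "(leavitt_monomial G \<mu> \<nu> :: ('a, 'b, 'r::{comm_ring, comm_monoid_mult}) lpa)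
    = leavitt_class G (monomial (\<mu>, \<nu>))"
proof -
  have "path_elt G \<mu> = leavitt_class G (Poly_Mapping.single (Word (path_word \<mu>)) (1::'r))"
    "ghost_elt G \<nu> = leavitt_class G (Poly_Mapping.single (Word (ghost_word \<nu>)) (1::'r))"
    by (simp_all only: path_elt_def path_word_def ghost_elt_def ghost_word_def)
  then show ?thesis
    using assms path_word_generators ghost_word_generators
    by (simp add: leavitt_monomial_def leavitt_class_mult free_algebra_single mult_single
        monomial_def monomial_word_def)
qed

lemma leavitt_monomials_eq:
  "leavitt_monomials G = (\<lambda>p. leavitt_class G (monomial p)) ` path_pairs G"
  unfolding leavitt_monomials_def path_pairs_def using leavitt_monomial_eq by fastforce

lemma monomial_mult:
  assumes "p \<in> path_pairs G" "p' \<in> path_pairs G"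
  shows "lmult (leavitt_class G (monomial p)) (leavitt_class G (monomial p'))
    = leavitt_class G (opt_ext monomial (wact (pact G) (monomial_word p) p') :: _ \<Rightarrow>\<^sub>0 'r::{comm_ring, comm_monoid_mult})"
proof -
  have "monomial p * monomial p' = (Poly_Mapping.single (Word (monomial_word p @ monomial_word p')) 1 :: _ \<Rightarrow>\<^sub>0 'r)"
    by (simp add: monomial_def mult_single)
  moreover have "(\<dots>) - opt_ext monomial (wact (pact G) (monomial_word p) p') \<in> leavitt_ideal G"
    using wact_reduction[OF monomial_word_generators[OF assms(1)] assms(2), where t = "TYPE('r)"]
    by (auto simp: monomial_def wnull_def weq_def split: option.splits)
  ultimately show ?thesis
    using assms by (simp add: leavitt_class_mult monomial_free_algebra leavitt_class_eqI)
qed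

text \<open>Multiply the relator at the common range by \<open>\<mu>\<close> on the left and by
  \<open>\<nu>\<^sup>*\<close> on the right, and reduce each of the resulting words to its
  monomial.\<close>

lemma ck2_compatible_monomial: "ck2_compatible G (leavitt_ideal G) monomial"
  unfolding ck2_compatible_def
proof (intro conjI allI impI)
  show "submodule (leavitt_ideal G)" by (rule leavitt_ideal_submodule)
  fix \<mu> \<nu> assume p: "(\<mu>, \<nu>) \<in> path_pairs G" and reg: "regular_vertex G (path_range G \<mu>)"
  define v where "v = path_range G \<mu>"
  obtain u r w q where eq: "\<mu> = (u, r)" "\<nu> = (w, q)" by (metis prod.collapse)
  have walks: "walk G u r" "walk G w q" "path_range G (u, r) = v" "path_range G (w, q) = v"
    using p by (auto simp: eq path_pairs_iff v_def)
  have gens: "set (path_word \<mu>) \<subseteq> generators G" "set (ghost_word \<nu>) \<subseteq> generators G"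
    using p path_word_generators ghost_word_generators by (auto simp: path_pairs_def)
  have v: "v \<in> verts G" using reg by (simp add: regular_vertex_def v_def)
  have red: "weq TYPE('c) (path_word \<mu> @ a @ ghost_word \<nu>) (monomial_word (\<mu>', \<nu>'))"
    if "set a \<subseteq> generators G" "wact (pact G) (path_word \<mu> @ a) ((v, []), (w, q)) = Some (\<mu>', \<nu>')"
    for a \<mu>' \<nu>'
    using red_reduction[of "path_word \<mu> @ a @ ghost_word \<nu>" "TYPE('c)"] gens that
      red_append_ghost_word[OF walks(2), of "path_word \<mu> @ a"]
    by (auto simp: eq walks)
  let ?P = "Poly_Mapping.single (Word (path_word \<mu>)) (1::'c)"
  let ?Q = "Poly_Mapping.single (Word (ghost_word \<nu>)) (1::'c)"
  let ?s = "\<lambda>w. Poly_Mapping.single (Word w) (1::'c)"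
  have "?P * (free_gen (Vertex v) - (\<Sum>e\<in>out_arcs G v. free_gen (Edge e) * free_gen (Ghost e))) * ?Q
      \<in> leavitt_ideal G"
    using reg gens by (intro leavitt_ideal_context leavitt_ideal.relator leavitt_relators.ck2)
      (auto simp: v_def)
  then have 1: "?s (path_word \<mu> @ [Vertex v] @ ghost_word \<nu>)
      - (\<Sum>e\<in>out_arcs G v. ?s (path_word \<mu> @ [Edge e, Ghost e] @ ghost_word \<nu>)) \<in> leavitt_ideal G"
    by (simp add: free_gen_mult right_diff_distrib left_diff_distrib sum_distrib_left sum_distrib_right mult_single)
      (simp add: free_gen_def mult_single)
  have 2: "?s (path_word \<mu> @ [Vertex v] @ ghost_word \<nu>) - monomial (\<mu>, \<nu>) \<in> leavitt_ideal G"
    using red[of "[Vertex v]" \<mu> \<nu>] v walks by (auto simp: eq path_word_act weq_def monomial_def)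
  have 3: "(\<Sum>e\<in>out_arcs G v. ?s (path_word \<mu> @ [Edge e, Ghost e] @ ghost_word \<nu>)
      - monomial (path_snoc \<mu> e, path_snoc \<nu> e)) \<in> leavitt_ideal G"
  proof (intro submodule_sum[OF leavitt_ideal_submodule])
    fix e assume "e \<in> out_arcs G v"
    then show "?s (path_word \<mu> @ [Edge e, Ghost e] @ ghost_word \<nu>)
      - monomial (path_snoc \<mu> e, path_snoc \<nu> e) \<in> leavitt_ideal G"
      using red[of "[Edge e, Ghost e]" "path_snoc \<mu> e" "path_snoc \<nu> e"] walks
      by (auto simp: out_arcs_def eq path_word_act weq_def monomial_def)
  qed
  have "monomial (\<mu>, \<nu>) - (\<Sum>e\<in>out_arcs G v. monomial (path_snoc \<mu> e, path_snoc \<nu> e))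
     = (?s (path_word \<mu> @ [Vertex v] @ ghost_word \<nu>)
      - (\<Sum>e\<in>out_arcs G v. ?s (path_word \<mu> @ [Edge e, Ghost e] @ ghost_word \<nu>)))
     - (?s (path_word \<mu> @ [Vertex v] @ ghost_word \<nu>) - monomial (\<mu>, \<nu>))
     + (\<Sum>e\<in>out_arcs G v. ?s (path_word \<mu> @ [Edge e, Ghost e] @ ghost_word \<nu>)
      - monomial (path_snoc \<mu> e, path_snoc \<nu> e))"
    by (simp add: sum_subtractf)
  also have "\<dots> \<in> leavitt_ideal G"
    by (rule leavitt_idealD(2)[OF leavitt_idealD(5)[OF 1 2] 3])
  finally show "monomial (\<mu>, \<nu>) - (\<Sum>e\<in>out_arcs G (path_range G \<mu>). monomial (path_snoc \<mu> e, path_snoc \<nu> e))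
      \<in> (leavitt_ideal G :: (('a, 'b) gen word \<Rightarrow>\<^sub>0 'c) set)"
    by (simp add: v_def)
qed

end

section \<open>Linear maps on the Leavitt path algebra\<close>

lemma pair_ext_add: "pair_ext E T (x + y) = pair_ext E T x + pair_ext E T y"
  and pair_ext_scale: "pair_ext E T (pm_scale c x) = pm_scale c (pair_ext E T x)"
  by (simp_all add: pair_ext_def linext_add linext_scale)

context wf_digraph
begin

lemma leavitt_add_closed:
  "X \<in> lcarrier \<Longrightarrow> Y \<in> lcarrier \<Longrightarrow>
    ladd X Y \<in> lcarrier"
  by (elim leavitt_carrierE) (simp add: leavitt_class_add leavitt_carrierI free_algebraD(2))

lemma leavitt_mult_closed:
  "X \<in> lcarrier \<Longrightarrow> Y \<in> lcarrier \<Longrightarrow>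
    lmult X Y \<in> lcarrier"
  by (elim leavitt_carrierE) (simp add: leavitt_class_mult leavitt_carrierI free_algebra_mult)

lemma leavitt_scale_closed:
  "X \<in> lcarrier \<Longrightarrow>
    lscale c X \<in> lcarrier"
  by (elim leavitt_carrierE) (simp add: leavitt_class_scale leavitt_carrierI free_algebraD(3))

lemma leavitt_zero_closed: "lzero \<in> lcarrier"
  by (simp add: leavitt_zero leavitt_carrierI free_algebraD(1))

lemmas leavitt_closed =
  leavitt_add_closed leavitt_mult_closed leavitt_scale_closed leavitt_zero_closed

lemma leavitt_monomial_closed:
  "p \<in> path_pairs G \<Longrightarrow> leavitt_class G (monomial p) \<in> lcarrier"
  by (simp add: leavitt_carrierI monomial_free_algebra)

lemma leavitt_distrib:
  assumes "X \<in> lcarrier" "Y \<in> lcarrier"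
    "Z \<in> lcarrier"
  shows "lmult (ladd X Y) Z
      = ladd (lmult X Z) (lmult Y Z)"
    and "lmult Z (ladd X Y)
      = ladd (lmult Z X) (lmult Z Y)"
    and "lmult (lscale c X) Z
      = lscale c (lmult X Z)"
    and "lmult Z (lscale c X)
      = lscale c (lmult Z X)"
  using assms
  by (elim leavitt_carrierE; simp add: leavitt_class_add leavitt_class_mult leavitt_class_scale
      free_algebraD free_algebra_mult distrib_left distrib_right pm_scale_mult_left
      pm_scale_mult_right)+

lemma leavitt_mult_zero:
  assumes "X \<in> lcarrier"
  shows "lmult lzero X = lzero"
    and "lmult X lzero = lzero"
  using assms
  by (elim leavitt_carrierE; simp add: leavitt_zero leavitt_class_mult free_algebraD)+

lemma wact_pact_closed:
  assumes "set w \<subseteq> generators G" "p \<in> path_pairs G" "wact (pact G) w p = Some p'"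
  shows "p' \<in> path_pairs G"
  using assms by (induction w arbitrary: p')
    (auto simp: Option.bind_eq_Some_conv intro: pact_closed)

lemma red_closed:
  assumes "w \<noteq> []" "set w \<subseteq> generators G" "red G w = Some p"
  shows "p \<in> path_pairs G"
proof (rule wact_pact_closed)
  show "vertex_pair (gen_source G (last w)) \<in> path_pairs G"
    using assms by (intro vertex_pair_mem gen_source_verts) auto
qed (use assms in \<open>auto simp: red_def\<close>)

lemma pair_ext_free_algebra:
  assumes T: "\<And>p. p \<in> path_pairs G \<Longrightarrow> T p \<in> free_algebra G" and x: "x \<in> free_algebra G"
  shows "pair_ext G T x \<in> free_algebra G"
  unfolding pair_ext_def
proof (rule submodule_linext[OF free_algebra_submodule])
  fix w assume "w \<in> Poly_Mapping.keys x"
  then have w: "letters w \<noteq> []" "set (letters w) \<subseteq> generators G"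
    using x by (auto simp: free_algebra_def)
  show "opt_ext T (red G (letters w)) \<in> free_algebra G"
  proof (cases "red G (letters w)")
    case (Some p)
    then have "p \<in> path_pairs G" using red_closed[OF w] by simp
    with Some show ?thesis by (simp add: T)
  qed (simp add: free_algebraD(1))
qed

lemma leavitt_ext_class:
  assumes T: "ck2_compatible G (leavitt_ideal G) T" and x: "x \<in> free_algebra G"
  shows "leavitt_ext G T (leavitt_class G x) = leavitt_class G (pair_ext G T x)"
proof -
  define y where "y = (SOME y. y \<in> leavitt_class G x)"
  have "y \<in> leavitt_class G x"
    unfolding y_def using mem_leavitt_class[OF x] by (rule someI)
  then have "y - x \<in> leavitt_ideal G" by (simp add: leavitt_class_def)
  from pair_ext_leavitt_ideal[OF T this]
  have "leavitt_class G (pair_ext G T y) = leavitt_class G (pair_ext G T x)"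
    by (intro leavitt_class_eqI) (simp add: pair_ext_def linext_minus)
  then show ?thesis
    using leavitt_carrierI[OF x] by (simp add: leavitt_ext_def y_def)
qed

lemma alg_linear_leavitt_ext:
  assumes T: "ck2_compatible G (leavitt_ideal G) T"
    and FA: "\<And>p. p \<in> path_pairs G \<Longrightarrow> T p \<in> free_algebra G"
  shows "alg_linear (leavitt_path_algebra G) (leavitt_path_algebra G) (leavitt_ext G T)"
  unfolding alg_linear_def
proof (intro conjI ballI allI)
  show "leavitt_ext G T
      \<in> lcarrier \<rightarrow>\<^sub>E lcarrier"
  proof (rule PiE_I, goal_cases)
    case (1 X)
    then show ?case
      by (elim leavitt_carrierE)
        (simp add: leavitt_ext_class[OF T] leavitt_carrierI pair_ext_free_algebra FA)
  qed (simp add: leavitt_ext_def)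
qed (elim leavitt_carrierE; simp add: leavitt_class_add leavitt_class_scale
      leavitt_ext_class[OF T] free_algebraD pair_ext_free_algebra[OF FA]
      pair_ext_add pair_ext_scale)+

lemma leavitt_ext_monomial:
  assumes "ck2_compatible G (leavitt_ideal G) T" "p \<in> path_pairs G"
  shows "leavitt_ext G T (leavitt_class G (monomial p)) = leavitt_class G (T p)"
  using assms by (simp add: leavitt_ext_class monomial_free_algebra)

text \<open>The induction follows the support of a representative \<open>x\<close>, but speaks of
  the class of \<open>pair_ext G monomial x\<close>: this is the same class, and each word
  contributes to it a multiple of a monomial or nothing.\<close>

lemma leavitt_induct [consumes 1, case_names zero monomial_add]:
  fixes X :: "('a, 'b, 'r::{comm_ring, comm_monoid_mult}) lpa"
  assumes X: "X \<in> lcarrier"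
    and zero: "P lzero"
    and add: "\<And>c p X. p \<in> path_pairs G \<Longrightarrow> X \<in> lcarrier \<Longrightarrow> P X \<Longrightarrow>
      P (ladd
          (lscale c (leavitt_class G (monomial p))) X)"
  shows "P X"
proof -
  obtain x where x: "x \<in> free_algebra G" "X = leavitt_class G x"
    using X by (rule leavitt_carrierE)
  have "P (leavitt_class G (pair_ext G monomial x))" using x(1)
  proof (induction x rule: pm_induct)
    case zero
    then show ?case using assms(2) by (simp add: pair_ext_def leavitt_zero)
  next
    case (single_add w c x)
    have "Poly_Mapping.keys (Poly_Mapping.single w c + x) = insert w (Poly_Mapping.keys x)"
      using single_add.hyps
      by (auto simp: in_keys_iff lookup_add lookup_single when_def split: if_splits)
    then have w: "letters w \<noteq> []" "set (letters w) \<subseteq> generators G" and x: "x \<in> free_algebra G"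
      using single_add.prems by (auto simp: free_algebra_def)
    have split: "pair_ext G monomial (Poly_Mapping.single w c + x)
        = pm_scale c (opt_ext monomial (red G (letters w))) + pair_ext G monomial x"
      by (simp add: pair_ext_def linext_add)
    show ?case
    proof (cases "red G (letters w)")
      case None
      then show ?thesis using single_add.IH x by (simp add: split)
    next
      case (Some p)
      then have "p \<in> path_pairs G" using red_closed[OF w] by simp
      then show ?thesis
        using add[OF _ leavitt_carrierI[of "pair_ext G monomial x"], of p c] single_add.IH x Some
        by (simp add: split leavitt_class_add leavitt_class_scale pair_ext_free_algebra
            monomial_free_algebra free_algebraD)
    qed
  qed
  then show ?thesis
    using leavitt_class_eqI[OF diff_pair_ext_monomial[OF x(1)]] x(2) by simp
qed

text \<open>The target \<open>B\<close> is an arbitrary record of operations, so agreement at zero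
  is not a consequence of linearity and is assumed.\<close>

lemma alg_linear_leavitt_eqI:
  assumes f: "alg_linear (leavitt_path_algebra G) B f" and g: "alg_linear (leavitt_path_algebra G) B g"
    and zero: "f lzero = g lzero"
    and eq: "\<And>p. p \<in> path_pairs G \<Longrightarrow>
      f (leavitt_class G (monomial p)) = g (leavitt_class G (monomial p))"
  shows "f = g"
proof
  fix X
  show "f X = g X"
  proof (cases "X \<in> lcarrier")
    case True
    then show ?thesis
    proof (induction rule: leavitt_induct)
      case (monomial_add c p X)
      then show ?case
        using f g eq by (simp add: alg_linear_def leavitt_closed leavitt_monomial_closed)
    qed (rule zero)
  next
    case False
    then show ?thesis using f g by (auto simp: alg_linear_def PiE_def extensional_def)
  qed
qed

lemma alg_linear_leavitt_zero:
  assumes "alg_linear (leavitt_path_algebra G) (leavitt_path_algebra G) f"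
  shows "f lzero = lzero"
proof -
  have "lscale 0 X = lzero"
    if "X \<in> lcarrier" for X
    using that by (elim leavitt_carrierE) (simp add: leavitt_zero leavitt_class_scale)
  moreover have "f lzero \<in> lcarrier"
    using assms leavitt_zero_closed by (auto simp: alg_linear_def)
  ultimately show ?thesis
    using assms leavitt_zero_closed unfolding alg_linear_def by metis
qed

lemma alg_linear_leavitt_eqI':
  assumes "alg_linear (leavitt_path_algebra G) (leavitt_path_algebra G) f"
    and "alg_linear (leavitt_path_algebra G) (leavitt_path_algebra G) g"
    and "\<And>p. p \<in> path_pairs G \<Longrightarrow>
      f (leavitt_class G (monomial p)) = g (leavitt_class G (monomial p))"
  shows "f = g"
  using assms by (intro alg_linear_leavitt_eqI) (simp_all add: alg_linear_leavitt_zero)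

text \<open>The condition on \<open>T\<close> treats both paths alike, so it survives their
  exchange; this gives a linear map as described by \<open>THE\<close>. It is the only one, since
  linear maps are determined by their values at monomials.\<close>

lemma leavitt_involution_monomial:
  assumes "(\<mu>, \<nu>) \<in> path_pairs G"
  shows "leavitt_involution G (leavitt_class G (monomial (\<mu>, \<nu>)))
    = leavitt_class G (monomial (\<nu>, \<mu>) :: _ \<Rightarrow>\<^sub>0 'r::{comm_ring, comm_monoid_mult})"
proof -
  define T :: "('a, 'b) path \<times> ('a, 'b) path \<Rightarrow> ('a, 'b) gen word \<Rightarrow>\<^sub>0 'r"
    where "T = (\<lambda>p. monomial (snd p, fst p))"
  have T: "ck2_compatible G (leavitt_ideal G) T"
    unfolding ck2_compatible_def
  proof (intro conjI allI impI)
    show "submodule (leavitt_ideal G :: (('a, 'b) gen word \<Rightarrow>\<^sub>0 'r) set)"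
      by (rule leavitt_ideal_submodule)
    fix \<mu> \<nu>
    assume p: "(\<mu>, \<nu>) \<in> path_pairs G" "regular_vertex G (path_range G \<mu>)"
    then have "path_range G \<nu> = path_range G \<mu>" by (simp add: path_pairs_def)
    then show "T (\<mu>, \<nu>) - (\<Sum>e\<in>out_arcs G (path_range G \<mu>). T (path_snoc \<mu> e, path_snoc \<nu> e))
        \<in> leavitt_ideal G"
      using ck2_compatible_monomial[where 'c='r] path_pairs_swap[OF p(1)] p(2)
      unfolding ck2_compatible_def T_def by fastforce
  qed
  have FA: "T p \<in> free_algebra G" if "p \<in> path_pairs G" for p
    using that path_pairs_swap by (cases p) (simp add: T_def monomial_free_algebra)
  have "leavitt_involution G = leavitt_ext G T"
    unfolding leavitt_involution_def
  proof (rule the_equality, intro conjI ballI)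
    show lin: "alg_linear (leavitt_path_algebra G) (leavitt_path_algebra G) (leavitt_ext G T)"
      by (rule alg_linear_leavitt_ext[OF T FA])
    fix \<alpha> \<beta> assume paths: "\<alpha> \<in> paths G" "\<beta> \<in> paths G"
    show "leavitt_ext G T (leavitt_monomial G \<alpha> \<beta>) = leavitt_monomial G \<beta> \<alpha>"
    proof (cases "path_range G \<alpha> = path_range G \<beta>")
      case True
      then show ?thesis
        using leavitt_ext_monomial[OF T, of "(\<alpha>, \<beta>)"] paths
        by (simp add: leavitt_monomial_eq path_pairs_def T_def)
    next
      case False
      have *: "leavitt_monomial G \<mu> \<nu> = (lzero :: ('a, 'b, 'r) lpa)"
        if "\<mu> \<in> paths G" "\<nu> \<in> paths G" "path_range G \<mu> \<noteq> path_range G \<nu>" for \<mu> \<nu>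
        using monomial_null[OF that] that leavitt_class_eqI[of "monomial (\<mu>, \<nu>)" 0]
        by (simp add: leavitt_monomial_eq leavitt_zero)
      show ?thesis
        using False paths alg_linear_leavitt_zero[OF lin] by (simp add: *)
    qed
  next
    fix f :: "('a, 'b, 'r) lpa \<Rightarrow> ('a, 'b, 'r) lpa"
    assume f: "alg_linear (leavitt_path_algebra G) (leavitt_path_algebra G) f \<and>
      (\<forall>\<alpha>\<in>paths G. \<forall>\<beta>\<in>paths G. f (leavitt_monomial G \<alpha> \<beta>) = leavitt_monomial G \<beta> \<alpha>)"
    show "f = leavitt_ext G T"
    proof (rule alg_linear_leavitt_eqI')
      fix p :: "('a, 'b) path \<times> ('a, 'b) path"
      assume "p \<in> path_pairs G"
      then show "f (leavitt_class G (monomial p)) = leavitt_ext G T (leavitt_class G (monomial p))"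
        using f leavitt_ext_monomial[OF T, of p]
        by (auto simp: path_pairs_def T_def simp flip: leavitt_monomial_eq)
    qed (use f alg_linear_leavitt_ext[OF T FA] in auto)
  qed
  then show ?thesis
    using leavitt_ext_monomial[OF T assms] by (simp add: T_def)
qed

text \<open>By \<open>\<nu>\<^sup>*\<nu> = r(\<nu>)\<close>, the products of
  \<open>\<mu>\<nu>\<^sup>*\<close> with its adjoint are the idempotents
  \<open>\<mu>\<mu>\<^sup>*\<close> and \<open>\<nu>\<nu>\<^sup>*\<close>.\<close>

lemma leavitt_normal_monomial_iff:
  assumes "(\<mu>, \<nu>) \<in> path_pairs G"
  shows "leavitt_normal G (leavitt_class G (monomial (\<mu>, \<nu>) :: _ \<Rightarrow>\<^sub>0 'r::{comm_ring, comm_monoid_mult}))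
    \<longleftrightarrow> monomial (\<mu>, \<mu>) - (monomial (\<nu>, \<nu>) :: _ \<Rightarrow>\<^sub>0 'r) \<in> leavitt_ideal G"
proof -
  have *: "lmult (leavitt_class G (monomial (\<mu>, \<nu>)))
        (leavitt_class G (monomial (\<nu>, \<mu>)))
      = (leavitt_class G (monomial (\<mu>, \<mu>)) :: ('a, 'b, 'r) lpa)"
    if "(\<mu>, \<nu>) \<in> path_pairs G" for \<mu> \<nu>
  proof -
    obtain u p w q where eq: "\<mu> = (u, p)" "\<nu> = (w, q)" by (metis prod.collapse)
    show ?thesis
      using that path_pairs_swap[OF that] monomial_word_act_longer[of u p w q "[]"]
      by (simp add: monomial_mult eq)
  qed
  have "(\<mu>, \<mu>) \<in> path_pairs G"
    using assms by (simp add: path_pairs_def)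
  then show ?thesis
    unfolding leavitt_normal_def
    using assms path_pairs_swap[OF assms]
    by (simp add: leavitt_involution_monomial * leavitt_class_eq_iff monomial_free_algebra)
qed

end

section \<open>Trails\<close>

lemma stream_eqI: "(\<And>n. s !! n = t !! n) \<Longrightarrow> s = t"
  using smap_alt[of id s t] by (simp add: stream.map_id)

lemma shift_snth_add: "(p @- s) !! (length p + n) = s !! n"
  by simp

lemma shift_eq_shift:
  "p @- s = q @- t \<Longrightarrow> length p \<le> length q \<Longrightarrow> \<exists>r. q = p @ r \<and> s = r @- t"
proof (induction p arbitrary: q)
  case (Cons a p)
  then show ?case by (cases q) auto
qed simp

lemma periodic_from_mult:
  assumes "periodic_from j k \<omega>" "n \<ge> j"
  shows "\<omega> !! (n + t * k) = \<omega> !! n"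
proof (induction t)
  case (Suc t)
  have "\<omega> !! (n + t * k + k) = \<omega> !! (n + t * k)"
    using assms unfolding periodic_from_def by (meson trans_le_add1)
  then show ?case using Suc by (simp add: algebra_simps)
qed simp

text \<open>Minimality of \<open>j + k\<close> determines both numbers: the least period length
  \<open>k\<close> and the least preperiod \<open>j\<close> for it are minimal simultaneously,
  because \<open>k\<close> is a period from every \<open>j'\<close> at which some other period
  length \<open>k'\<close> works.\<close>

lemma period_eq:
  assumes "periodic \<omega>"
  shows "\<exists>j k. periodic_from j k \<omega> \<and> period \<omega> = stake k (sdrop j \<omega>)"
proof -
  define k where "k = (LEAST k. \<exists>j. periodic_from j k \<omega>)"
  define j where "j = (LEAST j. periodic_from j k \<omega>)"
  have "\<exists>j. periodic_from j k \<omega>"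
    unfolding k_def by (rule LeastI_ex) (use assms in \<open>auto simp: periodic_def\<close>)
  then have jk: "periodic_from j k \<omega>"
    unfolding j_def by (rule LeastI_ex)
  have min: "k \<le> k' \<and> j \<le> j'" if "periodic_from j' k' \<omega>" for j' k'
  proof
    show "k \<le> k'" unfolding k_def by (rule Least_le) (use that in blast)
    have "\<omega> !! (n + k) = \<omega> !! n" if n: "n \<ge> j'" for n
    proof -
      have "k' \<ge> 1" using \<open>periodic_from j' k' \<omega>\<close> by (simp add: periodic_from_def)
      \<comment> \<open>Translation by \<open>j * k'\<close> moves \<open>n\<close> past
        \<open>j\<close>, where \<open>k\<close> is a period; periodicity with \<open>k'\<close>
        translates the equation back to \<open>n\<close>.\<close>
      then have "n + j * k' \<ge> j" by (cases k') auto
      then have "\<omega> !! (n + j * k' + k) = \<omega> !! (n + j * k')"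
        using jk by (simp add: periodic_from_def)
      then show ?thesis
        using periodic_from_mult[OF \<open>periodic_from j' k' \<omega>\<close>, of n j]
          periodic_from_mult[OF \<open>periodic_from j' k' \<omega>\<close>, of "n + k" j] n
        by (simp add: algebra_simps)
    qed
    then have "periodic_from j' k \<omega>"
      using jk by (simp add: periodic_from_def)
    then show "j \<le> j'" unfolding j_def by (rule Least_le)
  qed
  have "period \<omega> = stake k (sdrop j \<omega>)"
    unfolding period_def
  proof (rule the_equality)
    show "\<exists>j' k'. periodic_from j' k' \<omega> \<and>
        (\<forall>j'' k''. periodic_from j'' k'' \<omega> \<longrightarrow> j' + k' \<le> j'' + k'') \<and>
        stake k (sdrop j \<omega>) = stake k' (sdrop j' \<omega>)"
      using jk by (intro exI[of _ j] exI[of _ k]) (auto dest: min intro: add_mono)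
    fix p
    assume "\<exists>j' k'. periodic_from j' k' \<omega> \<and>
        (\<forall>j'' k''. periodic_from j'' k'' \<omega> \<longrightarrow> j' + k' \<le> j'' + k'') \<and>
        p = stake k' (sdrop j' \<omega>)"
    then obtain j' k' where "periodic_from j' k' \<omega>" "j' + k' \<le> j + k" "p = stake k' (sdrop j' \<omega>)"
      using jk by blast
    with min[of j' k'] have "j' = j" "k' = k" by auto
    with \<open>p = _\<close> show "p = stake k (sdrop j \<omega>)" by simp
  qed
  with jk show ?thesis by blast
qed

lemma trail_append_Nil [simp]: "trail_source E \<tau> = u \<Longrightarrow> trail_append (u, []) \<tau> = \<tau>"
  by (cases \<tau>) auto

text \<open>The outer \<open>trail_append\<close> discards the start \<open>v\<close> of the inner
  path. It is therefore arbitrary here and has to be instantiated when the equation is used for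
  rewriting.\<close>

lemma trail_append_append:
  "trail_append (u, p @ q) \<tau> = trail_append (u, p) (trail_append (v, q) \<tau>)"
  by (cases \<tau>) auto

lemma trail_append_Cons:
  "trail_append (u, e # p) \<tau> = trail_append (u, [e]) (trail_append (v, p) \<tau>)"
  by (cases \<tau>) auto

lemma trail_append_cancel:
  "trail_append (u, p) \<beta> = trail_append (w, p) \<beta>' \<Longrightarrow> trail_source E \<beta> = trail_source E \<beta>' \<Longrightarrow> \<beta> = \<beta>'"
  by (cases \<beta>; cases \<beta>') auto

text \<open>Acts on all trails, because normality is decided by all of them. The integer is the
  degree in the trail module.\<close>

fun tact :: "('v, 'e) pre_digraph \<Rightarrow> ('v, 'e) gen \<Rightarrow> int \<times> ('v, 'e) trail \<Rightarrow>
    (int \<times> ('v, 'e) trail) option" where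
  "tact E (Vertex v) (n, \<tau>) = (if v = trail_source E \<tau> then Some (n, \<tau>) else None)"
| "tact E (Edge e) (n, \<tau>) = (if head E e = trail_source E \<tau>
     then Some (1 + n, trail_append (tail E e, [e]) \<tau>) else None)"
| "tact E (Ghost e) (n, \<tau>) = (if initial_segment E (tail E e, [e]) \<tau>
     then Some (n - 1, THE \<beta>. trail_remainder E (tail E e, [e]) \<tau> \<beta>) else None)"

definition trail_equiv :: "('v, 'e) pre_digraph \<Rightarrow> ('v, 'e) path \<Rightarrow> ('v, 'e) path \<Rightarrow> bool" where
  "trail_equiv E \<mu> \<nu> \<longleftrightarrow> path_range E \<mu> = path_range E \<nu> \<and>
     (\<forall>\<beta>. is_trail E \<beta> \<longrightarrow> trail_source E \<beta> = path_range E \<mu> \<longrightarrow>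
        trail_append \<mu> \<beta> = trail_append \<nu> \<beta>)"

lemma trail_equiv_refl [simp]: "trail_equiv E \<mu> \<mu>"
  and trail_equiv_sym: "trail_equiv E \<mu> \<nu> \<Longrightarrow> trail_equiv E \<nu> \<mu>"
  and trail_equiv_trans: "trail_equiv E \<mu> \<nu> \<Longrightarrow> trail_equiv E \<nu> \<rho> \<Longrightarrow> trail_equiv E \<mu> \<rho>"
  by (simp_all add: trail_equiv_def)

context wf_digraph
begin

lemma is_trail_Inf_Cons:
  "is_trail G (Inf_Trail (e ## \<omega>)) \<longleftrightarrow>
     e \<in> arcs G \<and> head G e = tail G (shd \<omega>) \<and> is_trail G (Inf_Trail \<omega>)"
proof
  assume *: "is_trail G (Inf_Trail (e ## \<omega>))"
  then have "head G ((e ## \<omega>) !! Suc n) = tail G ((e ## \<omega>) !! Suc (Suc n))" for n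
    by (simp del: snth.simps)
  moreover have "head G ((e ## \<omega>) !! 0) = tail G ((e ## \<omega>) !! Suc 0)"
    using * by (simp del: snth.simps)
  ultimately show "e \<in> arcs G \<and> head G e = tail G (shd \<omega>) \<and> is_trail G (Inf_Trail \<omega>)"
    using * by simp
next
  assume *: "e \<in> arcs G \<and> head G e = tail G (shd \<omega>) \<and> is_trail G (Inf_Trail \<omega>)"
  have "head G ((e ## \<omega>) !! n) = tail G ((e ## \<omega>) !! Suc n)" for n
    using * by (cases n) auto
  then show "is_trail G (Inf_Trail (e ## \<omega>))" using * by simp
qed

lemma trail_source_verts: "is_trail G \<tau> \<Longrightarrow> trail_source G \<tau> \<in> verts G"
proof (cases \<tau>)
  case (Inf_Trail \<omega>)
  moreover have "shd \<omega> \<in> sset \<omega>" by (cases \<omega>) auto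
  ultimately show "is_trail G \<tau> \<Longrightarrow> ?thesis" by auto
qed (auto simp: paths_iff_walk walk_source)

lemma trail_append_arc:
  assumes "is_trail G \<tau>" "e \<in> arcs G" "trail_source G \<tau> = head G e"
  shows "is_trail G (trail_append (tail G e, [e]) \<tau>)"
  using assms by (cases \<tau>) (auto simp: is_trail_Inf_Cons paths_iff_walk simp del: is_trail.simps(2))

lemma trail_append_closed:
  assumes "walk G u p" "is_trail G \<tau>" "trail_source G \<tau> = path_range G (u, p)"
  shows "is_trail G (trail_append (u, p) \<tau>)" "trail_source G (trail_append (u, p) \<tau>) = u"
proof -
  have "is_trail G (trail_append (u, p) \<tau>) \<and> trail_source G (trail_append (u, p) \<tau>) = u"
    using assms
  proof (induction p arbitrary: u)
    case (Cons e p)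
    let ?\<delta> = "trail_append (head G e, p) \<tau>"
    have "is_trail G ?\<delta>" "trail_source G ?\<delta> = head G e"
      using Cons by auto
    then have "is_trail G (trail_append (tail G e, [e]) ?\<delta>)"
      using Cons.prems by (intro trail_append_arc) auto
    moreover have "trail_append (u, e # p) \<tau> = trail_append (tail G e, [e]) ?\<delta>"
      using Cons.prems trail_append_Cons by auto
    moreover have "trail_source G (trail_append (u, e # p) \<tau>) = u"
      using Cons.prems by (cases \<tau>) auto
    ultimately show ?case by simp
  qed simp
  then show "is_trail G (trail_append (u, p) \<tau>)" "trail_source G (trail_append (u, p) \<tau>) = u"
    by auto
qed

lemma trail_remainder_unique:
  "trail_remainder G \<alpha> \<tau> \<beta> \<Longrightarrow> trail_remainder G \<alpha> \<tau> \<beta>' \<Longrightarrow> \<beta> = \<beta>'"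
  by (cases \<alpha>) (auto simp: trail_remainder_def intro: trail_append_cancel[where E = G])

lemma the_trail_remainder:
  "trail_remainder G \<alpha> \<tau> \<beta> \<Longrightarrow> (THE \<beta>. trail_remainder G \<alpha> \<tau> \<beta>) = \<beta>"
  using trail_remainder_unique by blast

lemma trail_remainderI:
  "is_trail G \<beta> \<Longrightarrow> trail_source G \<beta> = path_range G \<alpha> \<Longrightarrow> trail_remainder G \<alpha> (trail_append \<alpha> \<beta>) \<beta>"
  by (simp add: trail_remainder_def)

lemma trail_remainder_Cons:
  assumes "walk G u (e # p)"
  shows "trail_remainder G (u, e # p) \<tau> \<beta> \<longleftrightarrow>
    (\<exists>\<delta>. trail_remainder G (u, [e]) \<tau> \<delta> \<and> trail_remainder G (head G e, p) \<delta> \<beta>)"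
  using assms trail_append_closed[of "head G e" p \<beta>] trail_append_Cons[of u e p \<beta> "head G e"]
  by (auto simp: trail_remainder_def)

lemma tact_Ghost:
  "trail_remainder G (tail G e, [e]) \<tau> \<beta> \<Longrightarrow> tact G (Ghost e) (n, \<tau>) = Some (n - 1, \<beta>)"
  by (auto simp: initial_segment_def the_trail_remainder)

lemma tact_Ghost_None:
  "(\<And>\<beta>. \<not> trail_remainder G (tail G e, [e]) \<tau> \<beta>) \<Longrightarrow> tact G (Ghost e) (n, \<tau>) = None"
  by (auto simp: initial_segment_def)

text \<open>Together with \<open>ghost_word_tact\<close>, written in the shape of the formulas in
  \<open>S_op\<close> and \<open>S_star_op\<close>, with which the action of words is compared
  later.\<close>

lemma path_word_tact:
  assumes "walk G u p" "is_trail G \<tau>"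
  shows "wact (tact G) (path_word (u, p)) (n, \<tau>) = (if path_range G (u, p) = trail_source G \<tau>
    then Some (int (length p) + n, trail_append (u, p) \<tau>) else None)"
proof (cases "p = []")
  case False
  have "wact (tact G) (map Edge p) (n, \<tau>) = (if path_range G (u, p) = trail_source G \<tau>
    then Some (int (length p) + n, trail_append (u, p) \<tau>) else None)"
    using assms(1) False
  proof (induction p arbitrary: u)
    case (Cons e p)
    show ?case
    proof (cases "p = []")
      case False
      with Cons assms(2) show ?thesis
        using trail_append_closed(2)[of "head G e" p \<tau>] trail_append_Cons[of u e p \<tau> "head G e"]
        by auto
    qed (use Cons in auto)
  qed simp
  with False show ?thesis by (simp add: path_word_def)
qed (auto simp: path_word_def)

lemma ghost_word_tact:
  assumes "walk G u p" "is_trail G \<tau>"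
  shows "wact (tact G) (ghost_word (u, p)) (n, \<tau>) = (if initial_segment G (u, p) \<tau>
    then Some (n - int (length p), THE \<beta>. trail_remainder G (u, p) \<tau> \<beta>) else None)"
proof (cases "p = []")
  case True
  have "trail_remainder G (u, []) \<tau> \<beta> \<longleftrightarrow> trail_source G \<tau> = u \<and> \<beta> = \<tau>" for \<beta>
    using assms(2) by (auto simp: trail_remainder_def)
  then show ?thesis by (auto simp: True ghost_word_def initial_segment_def)
next
  case False
  have "wact (tact G) (map Ghost (rev p)) (n, \<tau>) = (if initial_segment G (u, p) \<tau>
    then Some (n - int (length p), THE \<beta>. trail_remainder G (u, p) \<tau> \<beta>) else None)"
    using assms False
  proof (induction p arbitrary: u n \<tau>)
    case (Cons e p)
    have e: "u = tail G e" using Cons.prems by simp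
    show ?case
    proof (cases "\<exists>\<delta>. trail_remainder G (tail G e, [e]) \<tau> \<delta>")
      case True
      then obtain \<delta> where \<delta>: "trail_remainder G (tail G e, [e]) \<tau> \<delta>" by blast
      have rem: "trail_remainder G (u, e # p) \<tau> = trail_remainder G (head G e, p) \<delta>"
        using trail_remainder_Cons[OF Cons.prems(1)] \<delta> trail_remainder_unique e by blast
      show ?thesis
      proof (cases "p = []")
        case True
        then show ?thesis
          using \<delta> e by (auto simp: initial_segment_def)
      next
        case False
        have "is_trail G \<delta>" using \<delta> by (simp add: trail_remainder_def)
        then show ?thesis
          using Cons.IH[of "head G e" \<delta> "n - 1"] Cons.prems False rem
          by (simp add: tact_Ghost[OF \<delta>] initial_segment_def del: tact.simps)
      qed
    next
      case False
      then show ?thesis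
        using trail_remainder_Cons[OF Cons.prems(1)] e
        by (simp add: tact_Ghost_None initial_segment_def del: tact.simps)
    qed
  qed simp
  with False show ?thesis by (simp add: ghost_word_def)
qed

lemma initial_arc_unique:
  assumes "trail_remainder G (u, [e]) \<tau> \<beta>" "trail_remainder G (w, [f]) \<tau> \<beta>'"
  shows "e = f"
  using assms by (cases \<beta>; cases \<beta>') (auto simp: trail_remainder_def)

lemma trail_first_arc:
  assumes "is_trail G \<tau>" "out_arcs G (trail_source G \<tau>) \<noteq> {}"
  shows "\<exists>e\<in>out_arcs G (trail_source G \<tau>). \<exists>\<beta>. trail_remainder G (trail_source G \<tau>, [e]) \<tau> \<beta>"
proof (cases \<tau>)
  case (Fin_Trail \<alpha>)
  obtain u p where \<alpha>: "\<alpha> = (u, p)" by fastforce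
  show ?thesis
  proof (cases p)
    case Nil
    then show ?thesis using assms by (simp add: Fin_Trail \<alpha> sink_def)
  next
    case (Cons e q)
    then show ?thesis
      using assms by (auto simp: Fin_Trail \<alpha> trail_remainder_def out_arcs_def paths_iff_walk
          intro!: bexI[of _ e] exI[of _ "Fin_Trail (head G e, q)"])
  qed
next
  case (Inf_Trail \<omega>)
  then have "is_trail G (Inf_Trail (shd \<omega> ## stl \<omega>))" using assms by simp
  then show ?thesis unfolding is_trail_Inf_Cons
    by (auto simp: Inf_Trail trail_remainder_def out_arcs_def simp del: is_trail.simps
        intro!: bexI[of _ "shd \<omega>"] exI[of _ "Inf_Trail (stl \<omega>)"])
qed

text \<open>Either some path from \<open>v\<close> ends at a sink and is itself a trail, or every
  vertex reachable from \<open>v\<close> emits an edge and a fixed choice of edges can be followed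
  forever. Quantification over the trails from a vertex is thus never vacuous.\<close>

lemma trail_exists:
  assumes "v \<in> verts G"
  shows "\<exists>\<tau>. is_trail G \<tau> \<and> trail_source G \<tau> = v"
proof (cases "\<exists>p. walk G v p \<and> sink G (path_range G (v, p))")
  case True
  then show ?thesis by (auto simp: paths_iff_walk intro: exI[of _ "Fin_Trail (v, _)"])
next
  case False
  define c where "c u = (SOME e. e \<in> out_arcs G u)" for u
  define vs where "vs = siterate (\<lambda>u. head G (c u)) v"
  define \<omega> where "\<omega> = smap c vs"
  have step: "c u \<in> arcs G \<and> tail G (c u) = u" if "walk G v p" "u = path_range G (v, p)" for u p
  proof -
    have "out_arcs G u \<noteq> {}"
      using False that walk_range by (auto simp: sink_def)
    then have "c u \<in> out_arcs G u" unfolding c_def by (rule some_in_eq[THEN iffD2])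
    then show ?thesis by (simp add: out_arcs_def)
  qed
  have walk: "\<exists>p. walk G v p \<and> vs !! n = path_range G (v, p)" for n
  proof (induction n)
    case 0
    then show ?case using assms by (auto simp: vs_def intro!: exI[of _ "[]"])
  next
    case (Suc n)
    then obtain p where p: "walk G v p" "vs !! n = path_range G (v, p)" by blast
    from step[OF p] p have "walk G v (p @ [c (vs !! n)])"
      by auto
    moreover have "vs !! Suc n = path_range G (v, p @ [c (vs !! n)])"
      by (simp add: vs_def snth_siterate del: snth.simps)
    ultimately show ?case by blast
  qed
  have *: "\<omega> !! n \<in> arcs G \<and> tail G (\<omega> !! n) = vs !! n" for n
    using walk[of n] step by (auto simp: \<omega>_def)
  moreover have "head G (\<omega> !! n) = vs !! Suc n" for n
    by (simp add: \<omega>_def vs_def snth_siterate del: snth.simps)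
  ultimately have "is_trail G (Inf_Trail \<omega>)"
    by (auto simp: sset_range simp del: snth.simps)
  moreover have "trail_source G (Inf_Trail \<omega>) = v"
    using *[of 0] by (simp add: vs_def)
  ultimately show ?thesis by blast
qed

end

definition trail_basis :: "int \<times> ('v, 'e) trail \<Rightarrow> ('v, 'e, 'r::{comm_ring, comm_monoid_mult}) trail_comb" where
  "trail_basis z = Poly_Mapping.single z 1"

context wf_digraph
begin

lemma tact_closed:
  assumes "g \<in> generators G" "is_trail G (snd z)" "tact G g z = Some z'"
  shows "is_trail G (snd z')"
proof (cases g)
  case (Ghost e)
  obtain n \<tau> where z: "z = (n, \<tau>)" by fastforce
  obtain \<beta> where \<beta>: "trail_remainder G (tail G e, [e]) \<tau> \<beta>"
    using assms(3) by (auto simp: Ghost z initial_segment_def split: if_splits)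
  have "z' = (n - 1, \<beta>)"
    using assms(3) tact_Ghost[OF \<beta>, of n] by (simp add: Ghost z del: tact.simps)
  with \<beta> show ?thesis by (simp add: trail_remainder_def)
qed (use assms trail_append_arc in \<open>cases z; auto split: if_splits\<close>)+

text \<open>A trail from a regular vertex is not the trivial one, so it starts with exactly one of
  the edges there, and exactly one summand survives. The sum relation thus holds for every
  \<open>T\<close>, with equality.\<close>

lemma tact_out_arc:
  assumes z: "is_trail G \<tau>" and v: "regular_vertex G v"
  shows "opt_ext T (wact (tact G) (a @ [Vertex v]) (n, \<tau>))
    = (\<Sum>e\<in>out_arcs G v. opt_ext T (wact (tact G) (a @ [Edge e, Ghost e]) (n, \<tau>)))"
proof (cases "v = trail_source G \<tau>")
  case True
  then obtain e \<beta> where e: "e \<in> out_arcs G v" and \<beta>: "trail_remainder G (v, [e]) \<tau> \<beta>"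
    using trail_first_arc[OF z] v unfolding regular_vertex_def by blast
  have tl: "tail G f = v" if "f \<in> out_arcs G v" for f
    using that by (simp add: out_arcs_def)
  have "(\<Sum>f\<in>out_arcs G v. opt_ext T (wact (tact G) (a @ [Edge f, Ghost f]) (n, \<tau>)))
    = (\<Sum>f\<in>out_arcs G v. if f = e then opt_ext T (wact (tact G) a (n, \<tau>)) else 0)"
  proof (intro sum.cong refl)
    fix f assume f: "f \<in> out_arcs G v"
    show "opt_ext T (wact (tact G) (a @ [Edge f, Ghost f]) (n, \<tau>))
      = (if f = e then opt_ext T (wact (tact G) a (n, \<tau>)) else 0)"
    proof (cases "f = e")
      case True
      have "tact G (Ghost e) (n, \<tau>) = Some (n - 1, \<beta>)"
        using \<beta> tl[OF e] by (intro tact_Ghost) simp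
      then show ?thesis
        using \<beta> tl[OF e] True by (simp add: trail_remainder_def del: tact.simps(3))
    next
      case False
      then have "tact G (Ghost f) (n, \<tau>) = None"
        using \<beta> initial_arc_unique by (intro tact_Ghost_None) blast
      then show ?thesis using False by (simp del: tact.simps)
    qed
  qed
  also have "\<dots> = opt_ext T (wact (tact G) a (n, \<tau>))"
    using e v by (simp add: regular_vertex_def)
  finally show ?thesis using True by simp
next
  case False
  have "opt_ext T (wact (tact G) (a @ [Edge f, Ghost f]) (n, \<tau>)) = 0" if f: "f \<in> out_arcs G v" for f
  proof -
    have "\<not> trail_remainder G (tail G f, [f]) \<tau> \<beta>" for \<beta>
      using trail_append_closed(2)[of v "[f]" \<beta>] f False
      by (auto simp: trail_remainder_def out_arcs_def)
    then have "tact G (Ghost f) (n, \<tau>) = None" by (rule tact_Ghost_None)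
    then show ?thesis by (simp del: tact.simps)
  qed
  then show ?thesis using False by simp
qed

lemma leavitt_action_tact: "leavitt_action G {z. is_trail G (snd z)} (tact G) T {0}"
proof
  show "z' \<in> {z. is_trail G (snd z)}"
    if "g \<in> generators G" "z \<in> {z. is_trail G (snd z)}" "tact G g z = Some z'" for g z z'
    using tact_closed that by blast
  show "submodule {0}" by (rule submodule_trivial)
  show "opt_ext T (wact (tact G) (a @ [Vertex v]) z)
      - (\<Sum>e\<in>out_arcs G v. opt_ext T (wact (tact G) (a @ [Edge e, Ghost e]) z)) \<in> {0}"
    if "regular_vertex G v" "z \<in> {z. is_trail G (snd z)}" for v a z
    using that tact_out_arc[of "snd z" v T a "fst z"] by (simp del: wact_append wact_Cons)
next
  fix z :: "int \<times> ('a, 'b) trail"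
  assume "z \<in> {z. is_trail G (snd z)}"
  then obtain n \<tau> where z: "z = (n, \<tau>)" and \<tau>: "is_trail G \<tau>" by (cases z) auto
  show "wact (tact G) [Vertex v, Vertex v] z = wact (tact G) [Vertex v] z" for v
    by (simp add: z)
  show "wact (tact G) [Vertex v, Vertex w] z = None" if "v \<noteq> w" for v w
    using that by (auto simp: z)
  fix e assume e: "e \<in> arcs G"
  show "wact (tact G) [Vertex (tail G e), Edge e] z = wact (tact G) [Edge e] z"
    using trail_append_closed(2)[of "tail G e" "[e]" \<tau>] e \<tau> by (simp add: z)
  show "wact (tact G) [Edge e, Vertex (head G e)] z = wact (tact G) [Edge e] z"
    by (simp add: z)
  show "wact (tact G) [Vertex (head G e), Ghost e] z = wact (tact G) [Ghost e] z"
  proof (cases "\<exists>\<beta>. trail_remainder G (tail G e, [e]) \<tau> \<beta>")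
    case True
    then obtain \<beta> where \<beta>: "trail_remainder G (tail G e, [e]) \<tau> \<beta>" by blast
    then show ?thesis
      by (simp add: z tact_Ghost[OF \<beta>] del: tact.simps(3)) (simp add: trail_remainder_def)
  qed (simp add: z tact_Ghost_None del: tact.simps)
  show "wact (tact G) [Ghost e, Vertex (tail G e)] z = wact (tact G) [Ghost e] z"
  proof (cases "\<exists>\<beta>. trail_remainder G (tail G e, [e]) \<tau> \<beta>")
    case True
    then show ?thesis
      using trail_append_closed(2)[of "tail G e" "[e]"] e by (auto simp: z trail_remainder_def)
  next
    case False
    then have "tact G (Ghost e) (n, \<tau>) = None" by (intro tact_Ghost_None) blast
    then show ?thesis by (simp add: z del: tact.simps(3))
  qed
  show "wact (tact G) [Ghost e, Edge e] z = wact (tact G) [Vertex (head G e)] z"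
    using trail_remainderI[OF \<tau>, of "(tail G e, [e])"]
    by (auto simp: z tact_Ghost simp del: tact.simps(3))
  show "wact (tact G) [Ghost e, Edge f] z = None" if "f \<in> arcs G" "e \<noteq> f" for f
  proof (cases "head G f = trail_source G \<tau>")
    case True
    then have "trail_remainder G (tail G f, [f]) (trail_append (tail G f, [f]) \<tau>) \<tau>"
      using trail_remainderI[OF \<tau>, of "(tail G f, [f])"] by simp
    then have "\<not> trail_remainder G (tail G e, [e]) (trail_append (tail G f, [f]) \<tau>) \<beta>" for \<beta>
      using initial_arc_unique \<open>e \<noteq> f\<close> by blast
    then show ?thesis using True by (simp add: z tact_Ghost_None del: tact.simps(3))
  qed (simp add: z)
qed

text \<open>Makes the action well defined on classes, and is the test by which elements are
  recognised as lying outside the ideal.\<close>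

lemma linext_tact_leavitt_ideal:
  assumes "x \<in> leavitt_ideal G" "is_trail G (snd z)"
  shows "linext (\<lambda>w. opt_ext T (wact (tact G) (letters w) z)) x = 0"
proof -
  interpret leavitt_action G "{z. is_trail G (snd z)}" "tact G" T "{0}"
    by (rule leavitt_action_tact)
  show ?thesis using linext_leavitt_ideal[OF assms(1), of "[]" z] assms(2) by simp
qed

lemma monomial_word_tact:
  assumes "(\<mu>, \<nu>) \<in> path_pairs G" "is_trail G \<tau>"
  shows "trail_remainder G \<nu> \<tau> \<beta> \<Longrightarrow> wact (tact G) (monomial_word (\<mu>, \<nu>)) (n, \<tau>)
      = Some (n - int (path_length \<nu>) + int (path_length \<mu>), trail_append \<mu> \<beta>)"
    and "\<not> initial_segment G \<nu> \<tau> \<Longrightarrow> wact (tact G) (monomial_word (\<mu>, \<nu>)) (n, \<tau>) = None"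
proof -
  obtain u p w q where eq: "\<mu> = (u, p)" "\<nu> = (w, q)" by (metis prod.collapse)
  have walks: "walk G u p" "walk G w q" "path_range G (u, p) = path_range G (w, q)"
    using assms by (auto simp: eq path_pairs_iff)
  show "wact (tact G) (monomial_word (\<mu>, \<nu>)) (n, \<tau>) = None" if "\<not> initial_segment G \<nu> \<tau>"
    using that ghost_word_tact[OF walks(2) assms(2), of n] by (simp add: monomial_word_def eq)
  show "wact (tact G) (monomial_word (\<mu>, \<nu>)) (n, \<tau>)
      = Some (n - int (path_length \<nu>) + int (path_length \<mu>), trail_append \<mu> \<beta>)"
    if \<beta>: "trail_remainder G \<nu> \<tau> \<beta>"
    using ghost_word_tact[OF walks(2) assms(2), of n] \<beta> the_trail_remainder[OF \<beta>]
      path_word_tact[OF walks(1), of \<beta>] walks(3)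
    by (auto simp: monomial_word_def eq initial_segment_def trail_remainder_def path_length_def)
qed

subsection \<open>Paths with the same action on trails\<close>

lemma trail_append_eq_cases:
  assumes "walk G u p" "walk G w q" "is_trail G \<beta>" "is_trail G \<beta>'"
    and "trail_source G \<beta> = path_range G (u, p)" "trail_source G \<beta>' = path_range G (w, q)"
    and eq: "trail_append (u, p) \<beta> = trail_append (w, q) \<beta>'"
    and len: "length p \<le> length q"
  shows "u = w" "\<exists>\<alpha>. q = p @ \<alpha> \<and> \<beta> = trail_append (path_range G (u, p), \<alpha>) \<beta>'"
proof -
  show "u = w"
    using trail_append_closed(2)[of u p \<beta>] trail_append_closed(2)[of w q \<beta>'] assms by simp
  show "\<exists>\<alpha>. q = p @ \<alpha> \<and> \<beta> = trail_append (path_range G (u, p), \<alpha>) \<beta>'"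
  proof (cases \<beta>)
    case (Inf_Trail \<omega>)
    with eq obtain \<omega>' where "\<beta>' = Inf_Trail \<omega>'" "p @- \<omega> = q @- \<omega>'"
      by (cases \<beta>') auto
    with Inf_Trail shift_eq_shift[OF _ len] show ?thesis by auto
  next
    case (Fin_Trail \<gamma>)
    with eq obtain \<gamma>' where \<gamma>': "\<beta>' = Fin_Trail \<gamma>'" "p @ snd \<gamma> = q @ snd \<gamma>'"
      by (cases \<beta>') auto
    with len obtain \<alpha> where "q = p @ \<alpha>" "snd \<gamma> = \<alpha> @ snd \<gamma>'"
      by (auto simp: append_eq_append_conv2)
    then show ?thesis
      using assms(5) by (auto simp: Fin_Trail \<gamma>' intro: prod_eqI)
  qed
qed

lemma trail_equiv_append:
  assumes "trail_equiv G (u, p) (w, q)" "walk G (path_range G (u, p)) c"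
  shows "trail_equiv G (u, p @ c) (w, q @ c)"
proof -
  have "trail_append (u, p @ c) \<beta> = trail_append (w, q @ c) \<beta>"
    if "is_trail G \<beta>" "trail_source G \<beta> = path_range G (u, p @ c)" for \<beta>
    using assms that trail_append_closed[of "path_range G (u, p)" c \<beta>]
    by (simp add: trail_append_append[where v = "path_range G (u, p)"] trail_equiv_def)
  then show ?thesis using assms by (simp add: trail_equiv_def)
qed

text \<open>The common prefix \<open>p\<close> cancels, so the claim concerns only the closed path
  \<open>\<alpha>\<close> at the range of \<open>p\<close>.\<close>

lemma trail_equiv_self_append:
  assumes "walk G u (p @ \<alpha>)" "path_range G (u, p @ \<alpha>) = path_range G (u, p)"
  shows "trail_equiv G (u, p) (u, p @ \<alpha>) \<longleftrightarrow>
    (\<forall>\<beta>. is_trail G \<beta> \<longrightarrow> trail_source G \<beta> = path_range G (u, p) \<longrightarrow>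
       trail_append (path_range G (u, p), \<alpha>) \<beta> = \<beta>)"
proof -
  let ?v = "path_range G (u, p)"
  have "trail_append (u, p) \<beta> = trail_append (u, p @ \<alpha>) \<beta> \<longleftrightarrow> trail_append (?v, \<alpha>) \<beta> = \<beta>"
    if "is_trail G \<beta>" "trail_source G \<beta> = ?v" for \<beta>
    using that assms trail_append_closed(2)[of ?v \<alpha> \<beta>]
      trail_append_cancel[of u p \<beta> u "trail_append (?v, \<alpha>) \<beta>" G]
    by (auto simp: trail_append_append[where v = ?v])
  then show ?thesis using assms by (auto simp: trail_equiv_def)
qed

lemma trail_equiv_cases:
  assumes "walk G u p" "walk G w q" "is_trail G \<beta>" "trail_source G \<beta> = path_range G (u, p)"
    and "path_range G (w, q) = path_range G (u, p)"
    and "trail_append (u, p) \<beta> = trail_append (w, q) \<beta>"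
  obtains \<alpha> where "w = u" "q = p @ \<alpha>" | \<alpha> where "w = u" "p = q @ \<alpha>"
proof (cases "length p \<le> length q")
  case True
  then show ?thesis
    using trail_append_eq_cases[OF assms(1,2,3,3)] assms that(1) by auto
next
  case False
  then show ?thesis
    using trail_append_eq_cases[OF assms(2,1,3,3)] assms that(2) by auto
qed

text \<open>A power of \<open>\<alpha>\<close> has the form \<open>cc'\<close>; so a trail \<open>\<delta>\<close> from the base point of \<open>\<alpha>\<close>
  yields the trail \<open>c'\<delta>\<close> from the range of \<open>c\<close>, to which the hypothesis applies.\<close>

lemma trail_equiv_append_closed:
  assumes walks: "walk G u (p @ \<alpha>)" "walk G v c" "path_range G (u, p) = v"
      "path_range G (u, p @ \<alpha>) = v"
    and equiv: "trail_equiv G (u, p @ c) (u, (p @ \<alpha>) @ c)"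
  shows "trail_equiv G (u, p) (u, p @ \<alpha>)"
proof (cases "\<alpha> = []")
  case False
  have \<alpha>: "walk G v \<alpha>" "path_range G (v, \<alpha>) = v" using walks by auto
  define x where "x = path_range G (v, c)"
  have H: "trail_append (v, \<alpha>) (trail_append (v, c) \<beta>) = trail_append (v, c) \<beta>"
    if \<beta>: "is_trail G \<beta>" "trail_source G \<beta> = x" for \<beta>
  proof (rule trail_append_cancel)
    note \<beta>c = trail_append_closed[OF walks(2) \<beta>[unfolded x_def]]
    have "trail_append (u, p @ c) \<beta> = trail_append (u, (p @ \<alpha>) @ c) \<beta>"
      using equiv \<beta> walks by (simp add: trail_equiv_def x_def)
    then show "trail_append (u, p) (trail_append (v, \<alpha>) (trail_append (v, c) \<beta>))
        = trail_append (u, p) (trail_append (v, c) \<beta>)"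
      by (simp only: trail_append_append[where v = v])
    show "trail_source G (trail_append (v, \<alpha>) (trail_append (v, c) \<beta>))
        = trail_source G (trail_append (v, c) \<beta>)"
      using \<beta>c \<alpha> trail_append_closed(2)[of v \<alpha> "trail_append (v, c) \<beta>"] by simp
  qed
  define power where "power n = concat (replicate n \<alpha>)" for n
  have power: "walk G v (power n)" "path_range G (v, power n) = v" for n
  proof -
    have "walk G v (power n) \<and> path_range G (v, power n) = v"
      by (induction n) (use \<alpha> walk_source in \<open>auto simp: power_def\<close>)
    then show "walk G v (power n)" "path_range G (v, power n) = v" by auto
  qed
  have len: "length (power n) \<ge> n" for n
    by (induction n; cases \<alpha>) (use False in \<open>auto simp: power_def\<close>)
  have comm: "power n @ \<alpha> = \<alpha> @ power n" for n
    by (induction n) (simp_all add: power_def)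
  obtain \<beta>0 where \<beta>0: "is_trail G \<beta>0" "trail_source G \<beta>0 = x"
    using trail_exists walk_range[OF walks(2)] by (auto simp: x_def)
  define X where "X = trail_append (v, c) \<beta>0"
  have X: "is_trail G X" "trail_source G X = v"
    using trail_append_closed[OF walks(2) \<beta>0[unfolded x_def]] by (auto simp: X_def)
  have powX: "trail_append (v, power n) X = X" for n
  proof (induction n)
    case (Suc n)
    have "trail_append (v, power (Suc n)) X = trail_append (v, \<alpha>) (trail_append (v, power n) X)"
      using trail_append_append[of v \<alpha> "power n" X v] by (simp add: power_def)
    also have "\<dots> = X" using Suc H[OF \<beta>0] by (simp add: X_def)
    finally show ?case .
  qed (simp add: power_def trail_append_Nil[OF X(2)])
  \<comment> \<open>All powers of \<open>\<alpha>\<close> fix \<open>X = c\<beta>0\<close>. As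
    \<open>\<alpha>\<close> is nonempty, the power with exponent \<open>length c\<close> is at least
    as long as \<open>c\<close>; both are initial segments of \<open>X\<close>, so \<open>c\<close>
    is a prefix of it.\<close>
  have "\<exists>c'. power (length c) = c @ c' \<and> \<beta>0 = trail_append (path_range G (v, c), c') X"
    by (rule trail_append_eq_cases(2)[OF walks(2) power(1) \<beta>0(1) X(1)])
      (use powX[of "length c"] \<beta>0 X power len in \<open>auto simp: x_def X_def\<close>)
  then obtain c' where c': "power (length c) = c @ c'" by blast
  have "trail_append (v, \<alpha>) \<delta> = \<delta>" if \<delta>: "is_trail G \<delta>" "trail_source G \<delta> = v" for \<delta>
  proof -
    let ?P = "power (length c)"
    have "walk G x c'" "path_range G (x, c') = v"
      using power[of "length c"] by (auto simp: c' x_def)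
    then have "is_trail G (trail_append (x, c') \<delta>)" "trail_source G (trail_append (x, c') \<delta>) = x"
      using trail_append_closed \<delta> by auto
    from H[OF this] have "trail_append (v, \<alpha>) (trail_append (v, ?P) \<delta>) = trail_append (v, ?P) \<delta>"
      by (simp only: c' trail_append_append[where v = x])
    \<comment> \<open>\<open>\<alpha>\<close> commutes with its powers, which brings the power to
      the front, where it cancels.\<close>
    then have "trail_append (v, ?P) (trail_append (v, \<alpha>) \<delta>) = trail_append (v, ?P) \<delta>"
      by (simp only: trail_append_append[where v = v, symmetric] comm)
    then show ?thesis
      using trail_append_closed(2)[OF \<alpha>(1) \<delta>(1)] \<delta>(2) \<alpha>(2)
      by (intro trail_append_cancel[of v ?P "trail_append (v, \<alpha>) \<delta>" v \<delta> G]) simp_all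
  qed
  then show ?thesis
    using walks by (subst trail_equiv_self_append) auto
qed simp

text \<open>For the direction that removes \<open>c\<close>, one trail \<open>X\<close> through
  \<open>c\<close> already satisfies \<open>pX = qX\<close>. Hence one of the two paths extends the
  other by a closed path, which is the case of \<open>trail_equiv_append_closed\<close>.\<close>

lemma trail_equiv_append_iff:
  assumes "((u, p), (w, q)) \<in> path_pairs G" "walk G (path_range G (u, p)) c"
  shows "trail_equiv G (u, p @ c) (w, q @ c) \<longleftrightarrow> trail_equiv G (u, p) (w, q)"
proof
  assume *: "trail_equiv G (u, p @ c) (w, q @ c)"
  let ?v = "path_range G (u, p)"
  have walks: "walk G u p" "walk G w q" "path_range G (w, q) = ?v"
    using assms(1) by (auto simp: path_pairs_iff)
  obtain \<beta> where \<beta>: "is_trail G \<beta>" "trail_source G \<beta> = path_range G (?v, c)"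
    using trail_exists[OF walk_range[OF assms(2)]] by blast
  define X where "X = trail_append (?v, c) \<beta>"
  have X: "is_trail G X" "trail_source G X = ?v"
    using trail_append_closed[OF assms(2) \<beta>] by (auto simp: X_def)
  have "trail_append (u, p @ c) \<beta> = trail_append (w, q @ c) \<beta>"
    using * \<beta> by (simp add: trail_equiv_def)
  then have "trail_append (u, p) X = trail_append (w, q) X"
    by (simp add: X_def trail_append_append[where v = ?v])
  from walks(1,2) X walks(3) this show "trail_equiv G (u, p) (w, q)"
  proof (cases rule: trail_equiv_cases)
    case (1 \<alpha>)
    then show ?thesis
      using trail_equiv_append_closed[of u p \<alpha> ?v c] walks assms(2) * by auto
  next
    case (2 \<alpha>)
    have "trail_equiv G (u, q) (u, q @ \<alpha>)"
    proof (rule trail_equiv_append_closed)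
      show "walk G u (q @ \<alpha>)" using walks(1) unfolding 2 .
      show "walk G ?v c" by (rule assms(2))
      show "path_range G (u, q) = ?v" using walks(3) unfolding 2(1) .
      show "path_range G (u, q @ \<alpha>) = ?v" unfolding 2 ..
      show "trail_equiv G (u, q @ c) (u, (q @ \<alpha>) @ c)" using trail_equiv_sym[OF *] unfolding 2 .
    qed
    from trail_equiv_sym[OF this] show ?thesis unfolding 2 .
  qed
qed (use trail_equiv_append assms in auto)

end

section \<open>Normal monomials\<close>

text \<open>For periodic trails this replaces the condition that the period has no exits. It does
  not mention the period and is visibly unaffected by a change of finitely many edges.\<close>

definition exit_free_tail :: "('v, 'e) pre_digraph \<Rightarrow> 'e stream \<Rightarrow> bool" where
  "exit_free_tail E \<omega> \<longleftrightarrow> (\<exists>N. \<forall>n\<ge>N. out_arcs E (tail E (\<omega> !! n)) = {\<omega> !! n})"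

lemma periodic_shift: "periodic (p @- \<omega>) \<longleftrightarrow> periodic \<omega>"
proof
  assume "periodic (p @- \<omega>)"
  then obtain j k where *: "periodic_from j k (p @- \<omega>)" by (auto simp: periodic_def)
  have "\<omega> !! (n + k) = \<omega> !! n" if "n \<ge> j" for n
  proof -
    have "(p @- \<omega>) !! (length p + n + k) = (p @- \<omega>) !! (length p + n)"
      using * that trans_le_add2[of j n "length p"] unfolding periodic_from_def by blast
    then show ?thesis by (simp add: add.assoc)
  qed
  with * show "periodic \<omega>" by (auto simp: periodic_def periodic_from_def)
next
  assume "periodic \<omega>"
  then obtain j k where *: "periodic_from j k \<omega>" by (auto simp: periodic_def)
  have "(p @- \<omega>) !! (n + k) = (p @- \<omega>) !! n" if "n \<ge> length p + j" for n
  proof -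
    have "j \<le> n - length p" using that by simp
    then have "\<omega> !! (n - length p + k) = \<omega> !! (n - length p)"
      using * unfolding periodic_from_def by blast
    moreover have "n - length p + k = n + k - length p" using that by simp
    ultimately show ?thesis using that by simp
  qed
  with * have "periodic_from (length p + j) k (p @- \<omega>)" by (simp add: periodic_from_def)
  then show "periodic (p @- \<omega>)" by (auto simp: periodic_def)
qed

lemma exit_free_tail_shift: "exit_free_tail E (p @- \<omega>) \<longleftrightarrow> exit_free_tail E \<omega>"
proof
  assume "exit_free_tail E (p @- \<omega>)"
  then obtain N where N: "\<And>n. n \<ge> N \<Longrightarrow> out_arcs E (tail E ((p @- \<omega>) !! n)) = {(p @- \<omega>) !! n}"
    by (auto simp: exit_free_tail_def)
  have "out_arcs E (tail E (\<omega> !! n)) = {\<omega> !! n}" if "n \<ge> N" for n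
    using N[of "length p + n"] that by simp
  then show "exit_free_tail E \<omega>" by (auto simp: exit_free_tail_def)
next
  assume "exit_free_tail E \<omega>"
  then obtain N where N: "\<And>n. n \<ge> N \<Longrightarrow> out_arcs E (tail E (\<omega> !! n)) = {\<omega> !! n}"
    by (auto simp: exit_free_tail_def)
  have "out_arcs E (tail E ((p @- \<omega>) !! n)) = {(p @- \<omega>) !! n}" if "n \<ge> length p + N" for n
    using N[of "n - length p"] that by simp
  then show "exit_free_tail E (p @- \<omega>)" unfolding exit_free_tail_def by blast
qed

context wf_digraph
begin

text \<open>Every edge at \<open>v\<close> continues to some trail, and this has to begin with
  \<open>\<alpha>\<close>; so the only edge at \<open>v\<close> is the first one of
  \<open>\<alpha>\<close>. The sum relation then has a single summand, and the argument repeats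
  along \<open>\<alpha>\<close>.\<close>

lemma monomial_forced_extension:
  assumes "walk G v \<alpha>" "(\<mu>, \<nu>) \<in> path_pairs G" "path_range G \<mu> = v"
    and "\<And>\<delta>. is_trail G \<delta> \<Longrightarrow> trail_source G \<delta> = v \<Longrightarrow> initial_segment G (v, \<alpha>) \<delta>"
  shows "monomial (\<mu>, \<nu>) - monomial ((fst \<mu>, snd \<mu> @ \<alpha>), (fst \<nu>, snd \<nu> @ \<alpha>))
    \<in> (leavitt_ideal G :: (_ \<Rightarrow>\<^sub>0 'r::{comm_ring, comm_monoid_mult}) set)"
  using assms
proof (induction \<alpha> arbitrary: v \<mu> \<nu>)
  case Nil
  then show ?case by (simp add: leavitt_ideal.zero)
next
  case (Cons e \<alpha>)
  have e: "e \<in> arcs G" "tail G e = v" "walk G (head G e) \<alpha>"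
    using Cons.prems by auto
  have rem: "\<exists>\<beta>. trail_remainder G (v, [e]) \<delta> \<beta> \<and> initial_segment G (head G e, \<alpha>) \<beta>"
    if "is_trail G \<delta>" "trail_source G \<delta> = v" for \<delta>
    using Cons.prems(4)[OF that] trail_remainder_Cons[OF Cons.prems(1)]
    by (auto simp: initial_segment_def)
  have "out_arcs G v = {e}"
  proof
    show "out_arcs G v \<subseteq> {e}"
    proof
      fix f assume f: "f \<in> out_arcs G v"
      obtain \<beta> where \<beta>: "is_trail G \<beta>" "trail_source G \<beta> = head G f"
        using trail_exists[of "head G f"] f by (auto simp: out_arcs_def)
      have "walk G v [f]" using f by (auto simp: out_arcs_def)
      from trail_append_closed[OF this \<beta>(1)] rem \<beta>(2)
      obtain \<beta>' where "trail_remainder G (v, [e]) (trail_append (v, [f]) \<beta>) \<beta>'" by fastforce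
      moreover have "trail_remainder G (v, [f]) (trail_append (v, [f]) \<beta>) \<beta>"
        using \<beta> by (intro trail_remainderI) auto
      ultimately show "f \<in> {e}" using initial_arc_unique by blast
    qed
  qed (use e in \<open>auto simp: out_arcs_def\<close>)
  then have "regular_vertex G v"
    using e by (auto simp: regular_vertex_def)
  with \<open>out_arcs G v = {e}\<close> have 1: "monomial (\<mu>, \<nu>) - monomial (path_snoc \<mu> e, path_snoc \<nu> e)
      \<in> (leavitt_ideal G :: (_ \<Rightarrow>\<^sub>0 'r) set)"
    using ck2_compatible_monomial Cons.prems(2,3) unfolding ck2_compatible_def by fastforce
  have "initial_segment G (head G e, \<alpha>) \<delta>" if \<delta>: "is_trail G \<delta>" "trail_source G \<delta> = head G e" for \<delta>
  proof -
    have closed: "is_trail G (trail_append (v, [e]) \<delta>)" "trail_source G (trail_append (v, [e]) \<delta>) = v"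
      using trail_append_closed[of v "[e]" \<delta>] e \<delta> by auto
    from rem[OF this] obtain \<beta> where \<beta>: "trail_remainder G (v, [e]) (trail_append (v, [e]) \<delta>) \<beta>"
      "initial_segment G (head G e, \<alpha>) \<beta>" by blast
    moreover have "trail_remainder G (v, [e]) (trail_append (v, [e]) \<delta>) \<delta>"
      using \<delta> by (intro trail_remainderI) auto
    ultimately show ?thesis using trail_remainder_unique by blast
  qed
  then have "monomial (path_snoc \<mu> e, path_snoc \<nu> e)
      - monomial ((fst (path_snoc \<mu> e), snd (path_snoc \<mu> e) @ \<alpha>), (fst (path_snoc \<nu> e), snd (path_snoc \<nu> e) @ \<alpha>))
      \<in> (leavitt_ideal G :: (_ \<Rightarrow>\<^sub>0 'r) set)"
    using path_pairs_snoc[OF Cons.prems(2), of e] Cons.prems(3) e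
    by (intro Cons.IH[OF e(3)]) (auto simp: out_arcs_def)
  from leavitt_idealD(2)[OF 1 this] show ?case
    by (simp add: path_snoc_def)
qed

text \<open>Up to exchange, \<open>\<nu> = \<mu>\<alpha>\<close> with \<open>\<alpha>\<close> fixing
  every trail from its base point. Each such trail thus begins with \<open>\<alpha>\<close>, and
  \<open>\<mu>\<mu>\<^sup>*\<close> can be extended by \<open>\<alpha>\<close> on both
  sides.\<close>

lemma trail_equiv_monomial:
  assumes pair: "(\<mu>, \<nu>) \<in> path_pairs G" and equiv: "trail_equiv G \<mu> \<nu>"
  shows "monomial (\<mu>, \<mu>) - monomial (\<nu>, \<nu>) \<in> leavitt_ideal G"
proof -
  obtain u p w q where eq: "\<mu> = (u, p)" "\<nu> = (w, q)" by (metis prod.collapse)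
  have longer: "monomial ((u, p), (u, p)) - monomial ((u, p @ \<alpha>), (u, p @ \<alpha>)) \<in> leavitt_ideal G"
    if "((u, p), (u, p @ \<alpha>)) \<in> path_pairs G" "trail_equiv G (u, p) (u, p @ \<alpha>)" for u p \<alpha>
  proof -
    let ?v = "path_range G (u, p)"
    have walk: "walk G u (p @ \<alpha>)" "path_range G (u, p @ \<alpha>) = ?v"
      using that(1) by (auto simp: path_pairs_iff)
    have "initial_segment G (?v, \<alpha>) \<delta>" if \<delta>: "is_trail G \<delta>" "trail_source G \<delta> = ?v" for \<delta>
    proof -
      have "trail_append (?v, \<alpha>) \<delta> = \<delta>"
        using trail_equiv_self_append[OF walk] \<open>trail_equiv G (u, p) (u, p @ \<alpha>)\<close> \<delta> by blast
      then show ?thesis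
        using trail_remainderI[OF \<delta>(1), of "(?v, \<alpha>)"] walk \<delta>(2) by (auto simp: initial_segment_def)
    qed
    moreover have "walk G ?v \<alpha>" "((u, p), (u, p)) \<in> path_pairs G"
      using walk(1) by (simp_all add: path_pairs_iff)
    ultimately show ?thesis
      using monomial_forced_extension[of ?v \<alpha> "(u, p)" "(u, p)"] by simp
  qed
  obtain \<beta> where \<beta>: "is_trail G \<beta>" "trail_source G \<beta> = path_range G \<mu>"
    using trail_exists[of "path_range G \<mu>"] walk_range pair by (auto simp: eq path_pairs_iff)
  have "trail_append (u, p) \<beta> = trail_append (w, q) \<beta>"
    using equiv \<beta> by (simp add: trail_equiv_def eq)
  moreover have "walk G u p" "walk G w q" "path_range G (w, q) = path_range G (u, p)"
    using pair by (auto simp: eq path_pairs_iff)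
  ultimately consider \<alpha> where "w = u" "q = p @ \<alpha>" | \<alpha> where "w = u" "p = q @ \<alpha>"
    using trail_equiv_cases[of u p w q \<beta>] \<beta> unfolding eq by blast
  then show ?thesis
  proof cases
    case 1
    then show ?thesis using longer pair equiv by (simp add: eq)
  next
    case 2
    then have "monomial (\<nu>, \<nu>) - monomial (\<mu>, \<mu>) \<in> leavitt_ideal G"
      using longer path_pairs_swap[OF pair] trail_equiv_sym[OF equiv] by (simp add: eq)
    from leavitt_idealD(4)[OF this] show ?thesis by simp
  qed
qed

text \<open>Removing \<open>\<alpha>\<close> from a trail leaves a trail from the same vertex, so
  the removal can be repeated. Finite trails are excluded by descent on their length, and two
  infinite ones agree at each index by strong induction.\<close>

lemma closed_forced_trail_unique:
  assumes "\<alpha> \<noteq> []" "path_range G (v, \<alpha>) = v"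
    and init: "\<And>\<delta>. is_trail G \<delta> \<Longrightarrow> trail_source G \<delta> = v \<Longrightarrow> initial_segment G (v, \<alpha>) \<delta>"
    and \<beta>: "is_trail G \<beta>" "trail_source G \<beta> = v" "is_trail G \<beta>'" "trail_source G \<beta>' = v"
  shows "\<beta> = \<beta>'"
proof -
  have rem: "\<exists>\<delta>'. is_trail G \<delta>' \<and> trail_source G \<delta>' = v \<and> \<delta> = trail_append (v, \<alpha>) \<delta>'"
    if "is_trail G \<delta>" "trail_source G \<delta> = v" for \<delta>
    using init[OF that] assms(2) by (auto simp: initial_segment_def trail_remainder_def)
  have fin: "\<not> is_trail G (Fin_Trail (v, b))" for b
  proof (induction b rule: length_induct)
    case (1 b)
    show ?case
    proof
      assume "is_trail G (Fin_Trail (v, b))"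
      with rem obtain \<delta>' where \<delta>': "is_trail G \<delta>'" "trail_source G \<delta>' = v"
        "Fin_Trail (v, b) = trail_append (v, \<alpha>) \<delta>'" by fastforce
      then obtain b' where b': "\<delta>' = Fin_Trail (v, b')" "b = \<alpha> @ b'" by (cases \<delta>') auto
      with assms(1) have "length b' < length b" by simp
      with 1 have "\<not> is_trail G (Fin_Trail (v, b'))" by blast
      with \<delta>'(1) show False unfolding b'(1) by contradiction
    qed
  qed
  have inf: "s !! n = t !! n"
    if "is_trail G (Inf_Trail s)" "tail G (shd s) = v" "is_trail G (Inf_Trail t)" "tail G (shd t) = v"
    for n s t
    using that
  proof (induction n arbitrary: s t rule: less_induct)
    case (less n)
    obtain s' where s': "is_trail G (Inf_Trail s')" "tail G (shd s') = v" "s = \<alpha> @- s'"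
      using rem[OF less.prems(1)] less.prems(2) by (metis trail_append.simps(2) trail_append.simps(1)
        trail.exhaust trail.inject(2) trail.distinct(1) trail_source.simps(2) snd_conv)
    obtain t' where t': "is_trail G (Inf_Trail t')" "tail G (shd t') = v" "t = \<alpha> @- t'"
      using rem[OF less.prems(3)] less.prems(4) by (metis trail_append.simps(2) trail_append.simps(1)
        trail.exhaust trail.inject(2) trail.distinct(1) trail_source.simps(2) snd_conv)
    show ?case
    proof (cases "n < length \<alpha>")
      case False
      then have "s' !! (n - length \<alpha>) = t' !! (n - length \<alpha>)"
        using assms(1) by (intro less.IH s' t') (cases \<alpha>; simp)
      with False show ?thesis by (simp add: s' t')
    qed (simp add: s' t')
  qed
  have "\<exists>s. \<delta> = Inf_Trail s" if "is_trail G \<delta>" "trail_source G \<delta> = v" for \<delta>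
  proof (cases \<delta>)
    case (Fin_Trail \<gamma>)
    with that have "\<gamma> = (v, snd \<gamma>)" by (cases \<gamma>) simp
    with that Fin_Trail fin[of "snd \<gamma>"] show ?thesis by metis
  qed simp
  then obtain s t where st: "\<beta> = Inf_Trail s" "\<beta>' = Inf_Trail t"
    using \<beta> by blast
  with \<beta> have "s !! n = t !! n" for n
    by (intro inf) (simp_all only: trail_source.simps)
  then show ?thesis
    unfolding st by (intro arg_cong[of _ _ Inf_Trail] stream_eqI)
qed

lemma diagonal_tact:
  assumes "(\<mu>, \<mu>) \<in> path_pairs G" "is_trail G \<tau>"
  shows "opt_ext T (wact (tact G) (monomial_word (\<mu>, \<mu>)) (n, \<tau>))
    = (if initial_segment G \<mu> \<tau> then T (n, \<tau>) else 0)"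
proof (cases "initial_segment G \<mu> \<tau>")
  case True
  then obtain \<beta> where \<beta>: "trail_remainder G \<mu> \<tau> \<beta>" by (auto simp: initial_segment_def)
  then show ?thesis
    using monomial_word_tact(1)[OF assms \<beta>, of n] True by (simp add: trail_remainder_def)
next
  case False
  then show ?thesis using monomial_word_tact(2)[OF assms, of n] by simp
qed

text \<open>On trails, \<open>\<mu>\<mu>\<^sup>*\<close> projects onto those that begin with
  \<open>\<mu>\<close>. Equality of the projections for \<open>\<mu>\<close> and its extension
  \<open>\<mu>\<alpha>\<close> says that every trail from the range begins with
  \<open>\<alpha>\<close>; such a trail is unique and hence fixed by
  \<open>\<alpha>\<close>.\<close>

lemma monomial_trail_equiv:
  assumes pair: "(\<mu>, \<nu>) \<in> path_pairs G" and nontriv: "(1 :: 'r::{comm_ring, comm_monoid_mult}) \<noteq> 0"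
    and ideal: "monomial (\<mu>, \<mu>) - (monomial (\<nu>, \<nu>) :: _ \<Rightarrow>\<^sub>0 'r) \<in> leavitt_ideal G"
  shows "trail_equiv G \<mu> \<nu>"
proof -
  have refl: "(\<mu>, \<mu>) \<in> path_pairs G" "(\<nu>, \<nu>) \<in> path_pairs G"
    using pair by (auto simp: path_pairs_def)
  \<comment> \<open>The degree 0 is arbitrary. The coefficient at the trail itself is 1 or 0 for
    each projection, and these values differ since the ring is nontrivial.\<close>
  have init: "initial_segment G \<mu> \<tau> \<longleftrightarrow> initial_segment G \<nu> \<tau>" if \<tau>: "is_trail G \<tau>" for \<tau>
    using linext_tact_leavitt_ideal[OF ideal, of "(0, \<tau>)" trail_basis] \<tau> nontriv
    by (auto simp: linext_minus monomial_def diagonal_tact[OF refl(1) \<tau>] diagonal_tact[OF refl(2) \<tau>] trail_basis_def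
        dest!: arg_cong[of _ _ "\<lambda>m. Poly_Mapping.lookup m (0, \<tau>)"] split: if_splits)
  have longer: "trail_equiv G (u, p) (u, p @ \<alpha>)"
    if pair: "((u, p), (u, p @ \<alpha>)) \<in> path_pairs G"
      and init: "\<And>\<tau>. is_trail G \<tau> \<Longrightarrow> initial_segment G (u, p) \<tau> \<Longrightarrow> initial_segment G (u, p @ \<alpha>) \<tau>"
    for u p \<alpha>
  proof (cases "\<alpha> = []")
    case False
    let ?v = "path_range G (u, p)"
    have walk: "walk G u (p @ \<alpha>)" "path_range G (u, p @ \<alpha>) = ?v"
      using pair by (auto simp: path_pairs_iff)
    have init': "initial_segment G (?v, \<alpha>) \<delta>" if \<delta>: "is_trail G \<delta>" "trail_source G \<delta> = ?v" for \<delta>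
    proof -
      have "is_trail G (trail_append (u, p) \<delta>)"
        using trail_append_closed(1) walk \<delta> by simp
      moreover have "initial_segment G (u, p) (trail_append (u, p) \<delta>)"
        using trail_remainderI \<delta> by (auto simp: initial_segment_def)
      ultimately obtain \<delta>' where \<delta>': "trail_remainder G (u, p @ \<alpha>) (trail_append (u, p) \<delta>) \<delta>'"
        using init by (auto simp: initial_segment_def)
      then have src: "is_trail G \<delta>'" "trail_source G \<delta>' = ?v"
        using walk by (auto simp: trail_remainder_def)
      have "trail_append (u, p) \<delta> = trail_append (u, p) (trail_append (?v, \<alpha>) \<delta>')"
        using \<delta>' by (simp add: trail_remainder_def trail_append_append[where v = ?v])
      then have "\<delta> = trail_append (?v, \<alpha>) \<delta>'"
        using \<delta> trail_append_closed(2)[of ?v \<alpha> \<delta>'] walk src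
        by (intro trail_append_cancel[of u p \<delta> u _ G]) auto
      with src walk show ?thesis
        by (auto simp: initial_segment_def trail_remainder_def)
    qed
    \<comment> \<open>Both sides are trails from the base point of \<open>\<alpha>\<close>, where
      there is only one.\<close>
    have "trail_append (?v, \<alpha>) \<beta> = \<beta>" if "is_trail G \<beta>" "trail_source G \<beta> = ?v" for \<beta>
      using that trail_append_closed[of ?v \<alpha> \<beta>] walk
      by (intro closed_forced_trail_unique[OF False _ init', of "trail_append (?v, \<alpha>) \<beta>" \<beta>]) auto
    with walk show ?thesis by (subst trail_equiv_self_append) auto
  qed simp
  obtain u p w q where eq: "\<mu> = (u, p)" "\<nu> = (w, q)" by (metis prod.collapse)
  have walks: "walk G u p" "walk G w q"
    using pair by (auto simp: eq path_pairs_iff)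
  obtain \<beta> where \<beta>: "is_trail G \<beta>" "trail_source G \<beta> = path_range G (u, p)"
    using trail_exists walk_range[OF walks(1)] by blast
  have "is_trail G (trail_append (u, p) \<beta>)"
    using trail_append_closed(1)[OF walks(1) \<beta>] .
  moreover have "initial_segment G (u, p) (trail_append (u, p) \<beta>)"
    using trail_remainderI[OF \<beta>] by (auto simp: initial_segment_def)
  ultimately obtain \<beta>' where "trail_remainder G (w, q) (trail_append (u, p) \<beta>) \<beta>'"
    using init unfolding eq by (auto simp: initial_segment_def)
  then have \<beta>': "is_trail G \<beta>'" "trail_source G \<beta>' = path_range G (w, q)"
    "trail_append (u, p) \<beta> = trail_append (w, q) \<beta>'"
    by (auto simp: trail_remainder_def)
  show ?thesis
  proof (cases "length p \<le> length q")
    case True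
    from trail_append_eq_cases[OF walks \<beta>(1) \<beta>'(1) \<beta>(2) \<beta>'(2) \<beta>'(3) True] obtain \<alpha>
      where "w = u" "q = p @ \<alpha>" by blast
    with longer[of u p \<alpha>] init pair show ?thesis by (simp add: eq)
  next
    case False
    then have "length q \<le> length p" by simp
    from trail_append_eq_cases[OF walks(2,1) \<beta>'(1) \<beta>(1) \<beta>'(2) \<beta>(2) \<beta>'(3)[symmetric] this]
    obtain \<alpha> where "w = u" "p = q @ \<alpha>" by blast
    with longer[of u q \<alpha>] init path_pairs_swap[OF pair] show ?thesis
      by (intro trail_equiv_sym[of G \<nu>]) (simp add: eq)
  qed
qed

lemma leavitt_normal_iff_trail_equiv:
  assumes "(\<mu>, \<nu>) \<in> path_pairs G"
  shows "leavitt_normal G (leavitt_class G (monomial (\<mu>, \<nu>) :: _ \<Rightarrow>\<^sub>0 'r::{comm_ring, comm_monoid_mult}))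
    \<longleftrightarrow> trail_equiv G \<mu> \<nu> \<or> (1 :: 'r) = 0"
proof (cases "(1 :: 'r) = 0")
  case True
  then have "monomial (\<mu>, \<mu>) - (monomial (\<nu>, \<nu>) :: _ \<Rightarrow>\<^sub>0 'r) = 0"
    by (simp add: monomial_def)
  with True show ?thesis by (simp add: leavitt_normal_monomial_iff[OF assms] leavitt_ideal.zero)
next
  case False
  then show ?thesis
    using leavitt_normal_monomial_iff[OF assms] trail_equiv_monomial[OF assms]
      monomial_trail_equiv[OF assms False] by blast
qed

section \<open>Essentially aperiodic trails\<close>

lemma walk_stake:
  assumes "is_trail G (Inf_Trail \<omega>)"
  shows "walk G (tail G (shd \<omega>)) (stake k \<omega>) \<and> path_range G (tail G (shd \<omega>), stake k \<omega>) = tail G (\<omega> !! k)"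
  using assms
proof (induction k arbitrary: \<omega>)
  case 0
  then show ?case using trail_source_verts[OF 0] by simp
next
  case (Suc k)
  have "is_trail G (Inf_Trail (shd \<omega> ## stl \<omega>))" using Suc.prems by simp
  then show ?case
    using Suc.IH[of "stl \<omega>"] unfolding is_trail_Inf_Cons by simp
qed

lemma is_trail_sdrop: "is_trail G (Inf_Trail \<omega>) \<Longrightarrow> is_trail G (Inf_Trail (sdrop n \<omega>))"
  by (auto simp: sset_range sdrop_snth simp del: snth.simps simp flip: add_Suc_right)

text \<open>The period of a periodic trail is always a closed path, so only its exits are in
  question. Every index past the preperiod reduces modulo \<open>k\<close> to one within the period,
  and each index of the period recurs beyond any bound.\<close>

lemma essentially_aperiodic_Inf_iff:
  assumes \<omega>: "is_trail G (Inf_Trail \<omega>)"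
  shows "essentially_aperiodic G (Inf_Trail \<omega>) \<longleftrightarrow> (periodic \<omega> \<longrightarrow> exit_free_tail G \<omega>)"
proof (cases "periodic \<omega>")
  case True
  then obtain j k where jk: "periodic_from j k \<omega>" and period: "period \<omega> = stake k (sdrop j \<omega>)"
    using period_eq by blast
  have k: "k \<ge> 1" using jk by (simp add: periodic_from_def)
  have arcs: "\<omega> !! n \<in> arcs G" for n using \<omega> snth_sset[of \<omega> n] by auto
  have "walk G (tail G (\<omega> !! j)) (period \<omega>)"
    "path_range G (tail G (\<omega> !! j), period \<omega>) = tail G (\<omega> !! j)"
    using walk_stake[OF is_trail_sdrop[OF \<omega>, of j], of k] jk
    by (simp_all add: period sdrop_snth periodic_from_def)
  then have closed: "closed_path G (period \<omega>)"
    using k unfolding closed_path_def awalk_iff_walk by (metis One_nat_def Suc_le_D period stake_invert_Nil nat.distinct(1))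
  have no_exit: "out_arcs G (tail G (\<omega> !! n)) = {\<omega> !! n} \<longleftrightarrow>
      (\<forall>e\<in>arcs G. tail G e = tail G (\<omega> !! n) \<longrightarrow> e = \<omega> !! n)" for n
    using arcs by (auto simp: out_arcs_def)
  have "has_exit G (period \<omega>) \<longleftrightarrow> \<not> (\<forall>i<k. out_arcs G (tail G (\<omega> !! (j + i))) = {\<omega> !! (j + i)})"
    by (simp add: has_exit_def period sdrop_snth no_exit cong: conj_cong)
  moreover have "(\<forall>i<k. out_arcs G (tail G (\<omega> !! (j + i))) = {\<omega> !! (j + i)}) \<longleftrightarrow> exit_free_tail G \<omega>"
  proof
    assume *: "\<forall>i<k. out_arcs G (tail G (\<omega> !! (j + i))) = {\<omega> !! (j + i)}"
    have "out_arcs G (tail G (\<omega> !! n)) = {\<omega> !! n}" if "n \<ge> j" for n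
    proof -
      have "j + (n - j) mod k + ((n - j) div k) * k = n"
        using that by (metis add.assoc le_add_diff_inverse mod_div_mult_eq)
      then have "\<omega> !! n = \<omega> !! (j + (n - j) mod k)"
        using periodic_from_mult[OF jk, of "j + (n - j) mod k" "(n - j) div k"] by simp
      with * k show ?thesis by simp
    qed
    then show "exit_free_tail G \<omega>" unfolding exit_free_tail_def by blast
  next
    assume "exit_free_tail G \<omega>"
    then obtain N where N: "\<And>n. n \<ge> N \<Longrightarrow> out_arcs G (tail G (\<omega> !! n)) = {\<omega> !! n}"
      by (auto simp: exit_free_tail_def)
    have "out_arcs G (tail G (\<omega> !! (j + i))) = {\<omega> !! (j + i)}" for i
    proof -
      \<comment> \<open>A translation by the multiple \<open>N * k\<close> of the period length
        moves any index past \<open>N\<close>.\<close>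
      have "N \<le> N * k" using k by simp
      then have "N \<le> j + i + N * k" by linarith
      from N[OF this] show ?thesis using periodic_from_mult[OF jk, of "j + i" N] by simp
    qed
    then show "\<forall>i<k. out_arcs G (tail G (\<omega> !! (j + i))) = {\<omega> !! (j + i)}" by blast
  qed
  ultimately show ?thesis using True closed by simp
qed simp

text \<open>Periodicity and an exit-free tail depend only on the edges far out. This is what keeps
  the essentially aperiodic trails invariant under the action.\<close>

lemma ess_aperiodic_append_iff:
  assumes "walk G u p" "is_trail G \<tau>" "trail_source G \<tau> = path_range G (u, p)"
  shows "trail_append (u, p) \<tau> \<in> ess_aperiodic_trails G \<longleftrightarrow> \<tau> \<in> ess_aperiodic_trails G"
  using trail_append_closed(1)[OF assms] assms(2)
  by (cases \<tau>) (auto simp: ess_aperiodic_trails_def essentially_aperiodic_Inf_iff periodic_shift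
      exit_free_tail_shift simp del: is_trail.simps(2) essentially_aperiodic.simps(2))

text \<open>Each vertex on the way emits one edge only, so every step is forced and no sink can be
  reached.\<close>

lemma exit_free_trail_unique:
  assumes "is_trail G (Inf_Trail \<omega>)" "\<And>n. out_arcs G (tail G (\<omega> !! n)) = {\<omega> !! n}"
    and \<delta>: "is_trail G \<delta>" "trail_source G \<delta> = tail G (shd \<omega>)"
  shows "\<delta> = Inf_Trail \<omega>"
proof (cases \<delta>)
  case (Fin_Trail \<gamma>)
  have "\<not> (walk G (tail G (\<omega> !! n)) b \<and> sink G (path_range G (tail G (\<omega> !! n), b)))" for b n
  proof (induction b arbitrary: n)
    case Nil
    then show ?case using assms(2)[of n] by (simp add: sink_def)
  next
    case (Cons e b)
    show ?case
    proof
      assume *: "walk G (tail G (\<omega> !! n)) (e # b) \<and> sink G (path_range G (tail G (\<omega> !! n), e # b))"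
      then have "e \<in> out_arcs G (tail G (\<omega> !! n))" by (simp add: out_arcs_def)
      then have "head G e = tail G (\<omega> !! Suc n)" using assms(1,2) by simp
      with * Cons[of "Suc n"] show False by simp
    qed
  qed
  from this[of 0 "snd \<gamma>"] \<delta> show ?thesis
    by (cases \<gamma>) (auto simp: Fin_Trail paths_iff_walk)
next
  case (Inf_Trail s)
  have "s !! n = \<omega> !! n" for n
  proof (induction n)
    case 0
    have "s !! 0 \<in> out_arcs G (tail G (\<omega> !! 0))"
      using \<delta> snth_sset[of s 0] by (auto simp: Inf_Trail out_arcs_def)
    then show ?case unfolding assms(2) by simp
  next
    case (Suc n)
    have "head G (s !! n) = tail G (s !! Suc n)" "head G (\<omega> !! n) = tail G (\<omega> !! Suc n)"
      using \<delta>(1) assms(1) by (auto simp: Inf_Trail simp del: snth.simps)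
    then have "s !! Suc n \<in> out_arcs G (tail G (\<omega> !! Suc n))"
      using \<delta>(1) Suc snth_sset[of s "Suc n"]
      by (auto simp: Inf_Trail out_arcs_def simp del: snth.simps snth_sset)
    then show ?case unfolding assms(2) by simp
  qed
  then show ?thesis by (simp add: Inf_Trail stream_eqI)
qed

text \<open>The one place where essential aperiodicity is decisive. Cancellation yields
  \<open>\<beta> = \<alpha>\<beta>\<close> with \<open>\<alpha>\<close> closed. If
  \<open>\<alpha>\<close> is nontrivial, \<open>\<beta>\<close> is periodic from its first edge,
  hence without exits, hence the only trail from its source; so \<open>\<alpha>\<close> fixes all
  trails there.\<close>

lemma ess_aperiodic_trail_equiv:
  assumes pair: "(\<mu>, \<nu>) \<in> path_pairs G"
    and \<beta>: "\<beta> \<in> ess_aperiodic_trails G" "trail_source G \<beta> = path_range G \<mu>"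
    and eq: "trail_append \<mu> \<beta> = trail_append \<nu> \<beta>"
  shows "trail_equiv G \<mu> \<nu>"
proof -
  have trail: "is_trail G \<beta>" using \<beta> by (simp add: ess_aperiodic_trails_def)
  have longer: "trail_equiv G (u, p) (u, p @ \<alpha>)"
    if pair: "((u, p), (u, p @ \<alpha>)) \<in> path_pairs G" and src: "trail_source G \<beta> = path_range G (u, p)"
      and eq: "trail_append (u, p) \<beta> = trail_append (u, p @ \<alpha>) \<beta>" for u p \<alpha>
  proof (cases "\<alpha> = []")
    case False
    let ?v = "path_range G (u, p)"
    have walk: "walk G u (p @ \<alpha>)" "path_range G (u, p @ \<alpha>) = ?v"
      using pair by (auto simp: path_pairs_iff)
    obtain \<omega> where \<omega>: "\<beta> = Inf_Trail \<omega>"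
      using eq False by (cases \<beta>) auto
    then have shift: "\<alpha> @- \<omega> = \<omega>" using eq by simp
    have per: "\<omega> !! (n + length \<alpha>) = \<omega> !! n" for n
      using shift_snth_add[of \<alpha> \<omega> n] shift by (simp add: add.commute)
    then have per0: "periodic_from 0 (length \<alpha>) \<omega>"
      using False by (simp add: periodic_from_def Suc_le_eq)
    then have "exit_free_tail G \<omega>"
      using \<beta>(1) essentially_aperiodic_Inf_iff[of \<omega>] trail
      by (auto simp: \<omega> ess_aperiodic_trails_def periodic_def
          simp del: essentially_aperiodic.simps is_trail.simps)
    then obtain N where N: "\<And>n. n \<ge> N \<Longrightarrow> out_arcs G (tail G (\<omega> !! n)) = {\<omega> !! n}"
      by (auto simp: exit_free_tail_def)
    \<comment> \<open>There is no preperiod, so the absence of exits beyond \<open>N\<close> carries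
      over to all indices.\<close>
    have det: "out_arcs G (tail G (\<omega> !! n)) = {\<omega> !! n}" for n
    proof -
      have "N \<le> N * length \<alpha>" using False by (cases \<alpha>) auto
      then have "N \<le> n + N * length \<alpha>" by linarith
      from N[OF this] show ?thesis using periodic_from_mult[OF per0, of n N] by simp
    qed
    have "trail_append (?v, \<alpha>) \<delta> = \<delta>" if "is_trail G \<delta>" "trail_source G \<delta> = ?v" for \<delta>
    proof -
      have "\<delta> = Inf_Trail \<omega>"
        using that trail src by (intro exit_free_trail_unique det) (auto simp: \<omega>)
      then show ?thesis by (simp add: shift)
    qed
    with walk show ?thesis by (subst trail_equiv_self_append) auto
  qed simp
  obtain u p w q where paths: "\<mu> = (u, p)" "\<nu> = (w, q)" by (metis prod.collapse)
  have walks: "walk G u p" "walk G w q" "path_range G (w, q) = path_range G (u, p)"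
    using pair by (auto simp: paths path_pairs_iff)
  show ?thesis
  proof (cases rule: trail_equiv_cases[OF walks(1,2) trail \<beta>(2)[unfolded paths] walks(3) eq[unfolded paths]])
    case (1 \<alpha>)
    then show ?thesis using longer[of u p \<alpha>] pair eq \<beta>(2) by (simp add: paths)
  next
    case (2 \<alpha>)
    have "trail_equiv G (u, q) (u, q @ \<alpha>)"
    proof (rule longer)
      show "((u, q), (u, q @ \<alpha>)) \<in> path_pairs G"
        using path_pairs_swap[OF pair] unfolding paths 2 .
      show "trail_source G \<beta> = path_range G (u, q)"
        using \<beta>(2) walks(3) unfolding paths 2(1) by simp
      show "trail_append (u, q) \<beta> = trail_append (u, q @ \<alpha>) \<beta>"
        using eq[symmetric] unfolding paths 2 .
    qed
    from trail_equiv_sym[OF this] show ?thesis unfolding paths 2 .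
  qed
qed

end

section \<open>The conditional expectation onto the commutative core\<close>

text \<open>The case distinction is by trail equivalence, a property of the paths, rather than by
  normality. The two differ over the zero ring, where both values are zero anyway.\<close>

definition equiv_monomial :: "('v, 'e) pre_digraph \<Rightarrow> ('v, 'e) path \<times> ('v, 'e) path \<Rightarrow>
    (('v, 'e) gen word \<Rightarrow>\<^sub>0 'r::{comm_ring, comm_monoid_mult})" where
  "equiv_monomial E p = (if trail_equiv E (fst p) (snd p) then monomial p else 0)"

definition core_expectation :: "('v, 'e) pre_digraph \<Rightarrow>
    ('v, 'e, 'r::{comm_ring, comm_monoid_mult}) lpa \<Rightarrow> ('v, 'e, 'r) lpa" where
  "core_expectation E = leavitt_ext E (equiv_monomial E)"

context wf_digraph
begin

text \<open>By \<open>trail_equiv_append_iff\<close> with a single edge, a monomial and all summands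
  of its expansion are kept together or dropped together.\<close>

lemma ck2_compatible_equiv_monomial: "ck2_compatible G (leavitt_ideal G) (equiv_monomial G)"
  unfolding ck2_compatible_def
proof (intro conjI allI impI)
  show "submodule (leavitt_ideal G)" by (rule leavitt_ideal_submodule)
  fix \<mu> \<nu> assume p: "(\<mu>, \<nu>) \<in> path_pairs G" "regular_vertex G (path_range G \<mu>)"
  have equiv: "trail_equiv G (path_snoc \<mu> e) (path_snoc \<nu> e) \<longleftrightarrow> trail_equiv G \<mu> \<nu>"
    if "e \<in> out_arcs G (path_range G \<mu>)" for e
    using trail_equiv_append_iff[of "fst \<mu>" "snd \<mu>" "fst \<nu>" "snd \<nu>" "[e]"] p(1) that
    by (simp add: path_snoc_def out_arcs_def)
  show "equiv_monomial G (\<mu>, \<nu>)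
      - (\<Sum>e\<in>out_arcs G (path_range G \<mu>). equiv_monomial G (path_snoc \<mu> e, path_snoc \<nu> e))
      \<in> (leavitt_ideal G :: (('a, 'b) gen word \<Rightarrow>\<^sub>0 'c) set)"
  proof (cases "trail_equiv G \<mu> \<nu>")
    case True
    have "monomial (\<mu>, \<nu>) - (\<Sum>e\<in>out_arcs G (path_range G \<mu>). monomial (path_snoc \<mu> e, path_snoc \<nu> e))
        \<in> (leavitt_ideal G :: (('a, 'b) gen word \<Rightarrow>\<^sub>0 'c) set)"
      using ck2_compatible_monomial p unfolding ck2_compatible_def by blast
    with True show ?thesis by (simp add: equiv_monomial_def equiv)
  qed (simp add: equiv_monomial_def equiv leavitt_ideal.zero)
qed

lemma equiv_monomial_free_algebra: "p \<in> path_pairs G \<Longrightarrow> equiv_monomial G p \<in> free_algebra G"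
  by (simp add: equiv_monomial_def monomial_free_algebra free_algebraD(1))

lemma core_expectation_linear:
  "alg_linear (leavitt_path_algebra G) (leavitt_path_algebra G) (core_expectation G)"
  unfolding core_expectation_def
  by (rule alg_linear_leavitt_ext[OF ck2_compatible_equiv_monomial equiv_monomial_free_algebra])

lemma core_expectation_simps:
  assumes "X \<in> lcarrier"
  shows "core_expectation G X \<in> lcarrier"
    and "core_expectation G (lscale c X)
      = lscale c (core_expectation G X)"
    and "Y \<in> lcarrier \<Longrightarrow>
      core_expectation G (ladd X Y)
      = ladd (core_expectation G X) (core_expectation G Y)"
  using core_expectation_linear assms by (auto simp: alg_linear_def)

lemma core_expectation_zero [simp]:
  "core_expectation G lzero = lzero"
  by (rule alg_linear_leavitt_zero[OF core_expectation_linear])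

lemma core_expectation_monomial:
  "p \<in> path_pairs G \<Longrightarrow>
    core_expectation G (leavitt_class G (monomial p)) = leavitt_class G (equiv_monomial G p)"
  unfolding core_expectation_def by (rule leavitt_ext_monomial[OF ck2_compatible_equiv_monomial])

lemma core_expectation_idem:
  fixes X :: "('a, 'b, 'r::{comm_ring, comm_monoid_mult}) lpa"
  assumes "X \<in> lcarrier"
  shows "core_expectation G (core_expectation G X) = core_expectation G X"
  using assms
proof (induction rule: leavitt_induct)
  case (monomial_add c p X)
  have "core_expectation G (leavitt_class G (equiv_monomial G p :: _ \<Rightarrow>\<^sub>0 'r))
      = leavitt_class G (equiv_monomial G p)"
    using core_expectation_monomial[OF monomial_add(1)] core_expectation_zero
    by (auto simp: equiv_monomial_def leavitt_zero)
  then show ?case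
    using monomial_add by (simp add: core_expectation_simps core_expectation_monomial leavitt_closed
        leavitt_carrierI monomial_free_algebra equiv_monomial_free_algebra)
qed simp

text \<open>The longer of the two inner paths \<open>\<nu>\<close> and \<open>\<mu>'\<close> serves
  as a middle path \<open>\<mu>1\<close>: the pair \<open>\<rho>\<close>, \<open>\<mu>1\<close>
  comes from \<open>\<mu>\<close>, \<open>\<nu>\<close> and the pair \<open>\<mu>1\<close>,
  \<open>\<sigma>\<close> from \<open>\<mu>'\<close>, \<open>\<nu>'\<close>, each by appending a
  common path or none. Transitivity then gives both claims.\<close>

lemma trail_equiv_mult:
  assumes "(\<mu>, \<nu>) \<in> path_pairs G" "(\<mu>', \<nu>') \<in> path_pairs G"
    and "wact (pact G) (monomial_word (\<mu>, \<nu>)) (\<mu>', \<nu>') = Some (\<rho>, \<sigma>)"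
  shows "trail_equiv G \<mu> \<nu> \<Longrightarrow> trail_equiv G \<rho> \<sigma> \<longleftrightarrow> trail_equiv G \<mu>' \<nu>'"
    and "trail_equiv G \<mu>' \<nu>' \<Longrightarrow> trail_equiv G \<rho> \<sigma> \<longleftrightarrow> trail_equiv G \<mu> \<nu>"
proof -
  obtain u p w q where eq: "\<mu> = (u, p)" "\<nu> = (w, q)" by (metis prod.collapse)
  obtain u' p' w' q' where eq': "\<mu>' = (u', p')" "\<nu>' = (w', q')" by (metis prod.collapse)
  have walks: "walk G u p" "walk G w q" "path_range G (u, p) = path_range G (w, q)"
    using assms(1) by (auto simp: eq path_pairs_iff)
  have walks': "walk G u' p'" "walk G w' q'" "path_range G (u', p') = path_range G (w', q')"
    using assms(2) by (auto simp: eq' path_pairs_iff)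
  have "u' = w \<and> (\<exists>c. p' = q @ c \<or> q = p' @ c)"
    using monomial_word_actD[OF assms(1)[unfolded eq] walks'(1), of "(w', q')"] assms(3)
    by (simp add: eq eq')
  then consider c where "\<mu>' = (w, q @ c)" | c where "\<nu> = (u', p' @ c)"
    unfolding eq eq' by blast
  then have "\<exists>\<mu>1. (trail_equiv G \<mu> \<nu> \<longleftrightarrow> trail_equiv G \<rho> \<mu>1) \<and> (trail_equiv G \<mu>' \<nu>' \<longleftrightarrow> trail_equiv G \<mu>1 \<sigma>)"
  proof cases
    case (1 c)
    have "\<rho> = (u, p @ c)" "\<sigma> = \<nu>'"
      using assms(3) monomial_word_act_longer[OF assms(1)[unfolded eq], of c \<nu>'] 1 by (auto simp: eq)
    moreover have "walk G (path_range G (u, p)) c"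
      using walks walks'(1) 1 by (simp add: eq')
    ultimately show ?thesis
      using trail_equiv_append_iff[OF assms(1)[unfolded eq], of c] unfolding 1 eq by blast
  next
    case (2 c)
    then have "w = u'" "q = p' @ c" by (simp_all add: eq)
    then have "\<rho> = \<mu>" "\<sigma> = (w', q' @ c)"
      using assms(3) monomial_word_act_shorter[of u p u' p' c w' q'] assms(1) by (auto simp: eq eq')
    moreover have "walk G (path_range G (u', p')) c"
      using walks(2) \<open>w = u'\<close> \<open>q = p' @ c\<close> by simp
    ultimately show ?thesis
      using trail_equiv_append_iff[OF assms(2)[unfolded eq'], of c] unfolding 2 eq' by blast
  qed
  then obtain \<mu>1 where "trail_equiv G \<mu> \<nu> \<longleftrightarrow> trail_equiv G \<rho> \<mu>1"
    "trail_equiv G \<mu>' \<nu>' \<longleftrightarrow> trail_equiv G \<mu>1 \<sigma>" by blast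
  then show "trail_equiv G \<mu> \<nu> \<Longrightarrow> trail_equiv G \<rho> \<sigma> \<longleftrightarrow> trail_equiv G \<mu>' \<nu>'"
    and "trail_equiv G \<mu>' \<nu>' \<Longrightarrow> trail_equiv G \<rho> \<sigma> \<longleftrightarrow> trail_equiv G \<mu> \<nu>"
    using trail_equiv_trans[of G \<rho> \<mu>1 \<sigma>] trail_equiv_trans[of G \<mu>1 \<rho> \<sigma>]
      trail_equiv_sym[of G \<rho> \<mu>1] trail_equiv_trans[of G \<rho> \<sigma> \<mu>1] trail_equiv_sym[of G \<mu>1 \<sigma>]
    by argo+
qed

lemma core_expectation_monomial_mult:
  assumes p: "p \<in> path_pairs G" and q: "q \<in> path_pairs G"
  shows "core_expectation G (lmult
        (leavitt_class G (equiv_monomial G p))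
        (leavitt_class G (monomial q :: _ \<Rightarrow>\<^sub>0 'r::{comm_ring, comm_monoid_mult})))
      = lmult
        (leavitt_class G (equiv_monomial G p)) (leavitt_class G (equiv_monomial G q))"
    and "core_expectation G (lmult
        (leavitt_class G (monomial p :: _ \<Rightarrow>\<^sub>0 'r)) (leavitt_class G (equiv_monomial G q)))
      = lmult
        (leavitt_class G (equiv_monomial G p)) (leavitt_class G (equiv_monomial G q))"
proof -
  have zero: "leavitt_class G (0 :: _ \<Rightarrow>\<^sub>0 'r) = lzero"
    by (simp add: leavitt_zero)
  note simps = zero leavitt_mult_zero leavitt_zero_closed leavitt_monomial_closed core_expectation_monomial
    monomial_mult equiv_monomial_def p q
  have equiv: "r \<in> path_pairs G"
    "trail_equiv G (fst p) (snd p) \<Longrightarrow> trail_equiv G (fst r) (snd r) \<longleftrightarrow> trail_equiv G (fst q) (snd q)"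
    "trail_equiv G (fst q) (snd q) \<Longrightarrow> trail_equiv G (fst r) (snd r) \<longleftrightarrow> trail_equiv G (fst p) (snd p)"
    if "wact (pact G) (monomial_word p) q = Some r" for r
    using trail_equiv_mult[of "fst p" "snd p" "fst q" "snd q" "fst r" "snd r"] p q that
      wact_pact_closed[OF monomial_word_generators[OF p] q] by simp_all
  show "core_expectation G (lmult
        (leavitt_class G (equiv_monomial G p)) (leavitt_class G (monomial q :: _ \<Rightarrow>\<^sub>0 'r)))
      = lmult
        (leavitt_class G (equiv_monomial G p)) (leavitt_class G (equiv_monomial G q))"
    using equiv(1,2) by (cases "wact (pact G) (monomial_word p) q") (simp_all add: simps)
  show "core_expectation G (lmult
        (leavitt_class G (monomial p :: _ \<Rightarrow>\<^sub>0 'r)) (leavitt_class G (equiv_monomial G q)))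
      = lmult
        (leavitt_class G (equiv_monomial G p)) (leavitt_class G (equiv_monomial G q))"
    using equiv(1,3) by (cases "wact (pact G) (monomial_word p) q") (simp_all add: simps)
qed

text \<open>Stated for elements of the image rather than of the core, so that both sides are
  bilinear in \<open>X\<close> and \<open>Y\<close> and a double induction reduces them to
  monomials.\<close>

lemma core_expectation_module:
  fixes X Y :: "('a, 'b, 'r::{comm_ring, comm_monoid_mult}) lpa"
  assumes X: "X \<in> lcarrier" and Y: "Y \<in> lcarrier"
  shows "core_expectation G (lmult (core_expectation G X) Y)
      = lmult (core_expectation G X) (core_expectation G Y)"
    and "core_expectation G (lmult X (core_expectation G Y))
      = lmult (core_expectation G X) (core_expectation G Y)"
proof -
  note simps = core_expectation_simps core_expectation_monomial leavitt_closed leavitt_distrib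
    leavitt_mult_zero leavitt_carrierI[OF equiv_monomial_free_algebra] leavitt_monomial_closed
    core_expectation_monomial_mult
  have "core_expectation G (lmult (core_expectation G X) Y)
      = lmult (core_expectation G X) (core_expectation G Y)
    \<and> core_expectation G (lmult X (core_expectation G Y))
      = lmult (core_expectation G X) (core_expectation G Y)"
    using X
  proof (induction rule: leavitt_induct)
    case zero
    then show ?case using Y by (simp add: simps)
  next
    case (monomial_add c p X)
    have "core_expectation G (lmult (leavitt_class G (equiv_monomial G p :: _ \<Rightarrow>\<^sub>0 'r)) Y)
        = lmult (leavitt_class G (equiv_monomial G p)) (core_expectation G Y)
      \<and> core_expectation G (lmult (leavitt_class G (monomial p)) (core_expectation G Y))
        = lmult (leavitt_class G (equiv_monomial G p)) (core_expectation G Y)"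
      using Y
    proof (induction rule: leavitt_induct)
      case zero
      then show ?case using monomial_add by (simp add: simps)
    next
      case (monomial_add d q Y)
      then show ?case using \<open>p \<in> path_pairs G\<close> by (simp add: simps)
    qed
    with monomial_add Y show ?case by (simp add: simps)
  qed
  then show "core_expectation G (lmult (core_expectation G X) Y)
      = lmult (core_expectation G X) (core_expectation G Y)"
    and "core_expectation G (lmult X (core_expectation G Y))
      = lmult (core_expectation G X) (core_expectation G Y)"
    by auto
qed

lemma normal_monomials_iff:
  assumes "p \<in> path_pairs G"
  shows "leavitt_class G (monomial p :: _ \<Rightarrow>\<^sub>0 'r::{comm_ring, comm_monoid_mult}) \<in> normal_monomials G
    \<longleftrightarrow> trail_equiv G (fst p) (snd p) \<or> (1 :: 'r) = 0"
  using assms leavitt_normal_iff_trail_equiv[of "fst p" "snd p"]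
  by (auto simp: normal_monomials_def leavitt_monomials_eq)

lemma core_expectation_leavitt_monomials:
  fixes x :: "('a, 'b, 'r::{comm_ring, comm_monoid_mult}) lpa"
  assumes "x \<in> leavitt_monomials G"
  shows "core_expectation G x
    = (if x \<in> normal_monomials G then x else lzero)"
proof -
  obtain p where p: "p \<in> path_pairs G" "x = leavitt_class G (monomial p)"
    using assms by (auto simp: leavitt_monomials_eq)
  have "equiv_monomial G p = (monomial p :: _ \<Rightarrow>\<^sub>0 'r)" if "(1 :: 'r) = 0"
    using that by (simp add: equiv_monomial_def monomial_def)
  then show ?thesis
    using p by (auto simp: core_expectation_monomial normal_monomials_iff leavitt_zero equiv_monomial_def)
qed

text \<open>Some subalgebra containing \<open>X\<close> must exist: the intersection of the empty
  family would be the whole type.\<close>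

lemma subalgebra_generated_subalgebra:
  assumes "X \<subseteq> B" "subalgebra A B"
  shows "subalgebra A (subalgebra_generated A X)"
proof -
  have "subalgebra_generated A X \<subseteq> acarrier A"
    using assms by (auto simp: subalgebra_generated_def subalgebra_def)
  then show ?thesis
    unfolding subalgebra_def[of A "subalgebra_generated A X"]
    by (simp add: subalgebra_generated_def) (simp add: subalgebra_def)
qed

lemma leavitt_subalgebra: "subalgebra (leavitt_path_algebra G) lcarrier"
  by (simp add: subalgebra_def leavitt_closed)

lemma normal_monomials_carrier: "normal_monomials G \<subseteq> lcarrier"
  by (auto simp: normal_monomials_def leavitt_monomials_eq leavitt_monomial_closed)

text \<open>The image is spanned by normal monomials, hence lies in the core. Conversely, the module
  property makes the image a subalgebra, and it contains the normal monomials, which are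
  fixed.\<close>

lemma core_expectation_image:
  "core_expectation G ` lcarrier
    = (commutative_core G :: ('a, 'b, 'r::{comm_ring, comm_monoid_mult}) lpa set)"
proof
  have core: "subalgebra (leavitt_path_algebra G) (commutative_core G :: ('a, 'b, 'r) lpa set)"
    unfolding commutative_core_def
    by (rule subalgebra_generated_subalgebra[OF normal_monomials_carrier leavitt_subalgebra])
  have normal: "normal_monomials G \<subseteq> (commutative_core G :: ('a, 'b, 'r) lpa set)"
    by (auto simp: commutative_core_def subalgebra_generated_def)
  show "core_expectation G ` lcarrier \<subseteq> (commutative_core G :: ('a, 'b, 'r) lpa set)"
  proof
    fix Y :: "('a, 'b, 'r) lpa"
    assume "Y \<in> core_expectation G ` lcarrier"
    then obtain X :: "('a, 'b, 'r) lpa" where X: "X \<in> lcarrier" "Y = core_expectation G X" by blast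
    from X(1) have "core_expectation G X \<in> commutative_core G"
    proof (induction rule: leavitt_induct)
      case zero
      then show ?case using core by (simp add: subalgebra_def)
    next
      case (monomial_add c p X)
      then have "core_expectation G (leavitt_class G (monomial p :: _ \<Rightarrow>\<^sub>0 'r)) \<in> (commutative_core G :: ('a, 'b, 'r) lpa set)"
        using core normal core_expectation_leavitt_monomials[of "leavitt_class G (monomial p :: _ \<Rightarrow>\<^sub>0 'r)"]
        by (auto simp: subalgebra_def leavitt_monomials_eq)
      with monomial_add core show ?case
        by (simp add: core_expectation_simps leavitt_closed leavitt_monomial_closed subalgebra_def)
    qed
    with X show "Y \<in> commutative_core G" by simp
  qed
  have "subalgebra (leavitt_path_algebra G)
      (core_expectation G ` lcarrier :: ('a, 'b, 'r) lpa set)"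
    unfolding subalgebra_def
  proof (intro conjI ballI allI)
    show "lzero \<in> core_expectation G ` lcarrier"
      using leavitt_zero_closed core_expectation_zero by (metis imageI)
    show "core_expectation G ` lcarrier
        \<subseteq> (lcarrier :: ('a, 'b, 'r) lpa set)"
      by (auto intro: core_expectation_simps(1))
    fix X :: "('a, 'b, 'r) lpa" and c
    assume "X \<in> core_expectation G ` lcarrier"
    then obtain X' where X': "X' \<in> lcarrier" "X = core_expectation G X'"
      by blast
    then have "lscale c X
        = core_expectation G (lscale c X')"
      by (simp add: core_expectation_simps)
    then show "lscale c X \<in> core_expectation G ` lcarrier"
      using X'(1) by (simp add: leavitt_closed)
    fix Y :: "('a, 'b, 'r) lpa"
    assume "Y \<in> core_expectation G ` lcarrier"
    then obtain Y' where Y': "Y' \<in> lcarrier" "Y = core_expectation G Y'"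
      by blast
    have "ladd X Y
        = core_expectation G (ladd X' Y')"
      using X' Y' by (simp add: core_expectation_simps)
    then show "ladd X Y \<in> core_expectation G ` lcarrier"
      using X'(1) Y'(1) by (simp add: leavitt_closed)
    \<comment> \<open>Only one factor is replaced by its preimage, so that the module property
      exhibits the product as a value of the expectation.\<close>
    have "lmult X Y
        = core_expectation G (lmult X Y')"
      using X' Y' by (simp add: core_expectation_module)
    then show "lmult X Y \<in> core_expectation G ` lcarrier"
      using X' Y'(1) by (simp add: leavitt_closed core_expectation_simps(1))
  qed
  moreover have "normal_monomials G
      \<subseteq> (core_expectation G ` lcarrier :: ('a, 'b, 'r) lpa set)"
  proof
    fix x :: "('a, 'b, 'r) lpa" assume x: "x \<in> normal_monomials G"
    then have "core_expectation G x = x"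
      using core_expectation_leavitt_monomials[of x] by (simp add: normal_monomials_def)
    with x normal_monomials_carrier show "x \<in> core_expectation G ` lcarrier"
      by (metis image_eqI subsetD)
  qed
  ultimately show "commutative_core G
      \<subseteq> (core_expectation G ` lcarrier :: ('a, 'b, 'r) lpa set)"
    by (auto simp: commutative_core_def subalgebra_generated_def)
qed

lemma core_expectation_conditional:
  "algebraic_conditional_expectation (leavitt_path_algebra G) (commutative_core G)
    (core_expectation G :: ('a, 'b, 'r::{comm_ring, comm_monoid_mult}) lpa \<Rightarrow> _)"
  unfolding algebraic_conditional_expectation_def
proof (intro conjI ballI)
  show "subalgebra (leavitt_path_algebra G) (commutative_core G :: ('a, 'b, 'r) lpa set)"
    unfolding commutative_core_def
    by (rule subalgebra_generated_subalgebra[OF normal_monomials_carrier leavitt_subalgebra])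
  fix X B :: "('a, 'b, 'r) lpa"
  assume X: "X \<in> lcarrier" and "B \<in> commutative_core G"
  then obtain Y where "Y \<in> lcarrier" "B = core_expectation G Y"
    using core_expectation_image by blast
  with X show "core_expectation G (lmult B X)
      = lmult B (core_expectation G X)"
    and "core_expectation G (lmult X B)
      = lmult (core_expectation G X) B"
    by (simp_all add: core_expectation_module)
qed (simp_all add: core_expectation_linear core_expectation_idem core_expectation_image)

end

section \<open>The essentially aperiodic representation\<close>

lemma linext_fun_add: "linext (\<lambda>k. f k + g k) x = linext f x + linext g x"
  using linext_fun_diff[of "\<lambda>k. f k + g k" g x] by (simp add: algebra_simps)

lemma linext_fun_scale: "linext (\<lambda>k. pm_scale c (f k)) x = pm_scale c (linext f x)"
  by (simp add: linext_def pm_scale_sum mult.commute)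

lemma linext_opt_ext: "linext b (opt_ext trail_basis y) = opt_ext b y"
  by (cases y) (simp_all add: trail_basis_def)

lemma linext_trail_basis: "linext trail_basis m = m"
  by (simp add: trail_basis_def[abs_def] linext_id)

definition word_op :: "('v, 'e) pre_digraph \<Rightarrow>
    (('v, 'e) gen word \<Rightarrow>\<^sub>0 'r::{comm_ring, comm_monoid_mult}) \<Rightarrow>
    int \<times> ('v, 'e) trail \<Rightarrow> ('v, 'e, 'r) trail_comb" where
  "word_op E x z = linext (\<lambda>w. opt_ext trail_basis (wact (tact E) (letters w) z)) x"

text \<open>An explicit candidate for \<open>\<Pi>_ap\<close>, which is given only by a description;
  again the representative is arbitrary.\<close>

definition trail_rep :: "('v, 'e) pre_digraph \<Rightarrow>
    ('v, 'e, 'r::{comm_ring, comm_monoid_mult}) lpa \<Rightarrow> ('v, 'e, 'r) trail_op" where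
  "trail_rep E = (\<lambda>X\<in>acarrier (leavitt_path_algebra E).
     \<lambda>m\<in>trail_module E. linext (word_op E (SOME x. x \<in> X)) m)"

fun gen_degree :: "('v, 'e) gen \<Rightarrow> int" where
  "gen_degree (Vertex v) = 0"
| "gen_degree (Edge e) = 1"
| "gen_degree (Ghost e) = - 1"

definition word_degree :: "('v, 'e) gen word \<Rightarrow> int" where
  "word_degree w = (\<Sum>g\<leftarrow>letters w. gen_degree g)"

lemma tact_degree: "tact E g z = Some z' \<Longrightarrow> fst z' = fst z + gen_degree g"
  by (cases z; cases g) (auto split: if_splits)

lemma wact_tact_degree:
  "wact (tact E) w z = Some z' \<Longrightarrow> fst z' = fst z + (\<Sum>g\<leftarrow>w. gen_degree g)"
  by (induction w arbitrary: z') (auto simp: Option.bind_eq_Some_conv dest: tact_degree)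

lemma word_op_linear:
  "word_op E 0 z = 0" "word_op E (x + y) z = word_op E x z + word_op E y z"
  "word_op E (x - y) z = word_op E x z - word_op E y z"
  "word_op E (pm_scale c x) z = pm_scale c (word_op E x z)"
  "word_op E (Poly_Mapping.single w 1) z = opt_ext trail_basis (wact (tact E) (letters w) z)"
  by (simp_all add: word_op_def linext_add linext_minus linext_scale)

lemma word_op_mult: "word_op E (x * y) z = linext (word_op E x) (word_op E y z)"
proof -
  have "word_op E (x * y) z
      = linext (\<lambda>w. linext (\<lambda>u. opt_ext trail_basis (wact (tact E) (letters u @ letters w) z)) x) y"
    unfolding word_op_def linext_mult letters_plus by (rule linext_commute)
  also have "\<dots> = linext (\<lambda>w. opt_ext (word_op E x) (wact (tact E) (letters w) z)) y"
  proof (rule linext_cong)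
    fix w
    show "linext (\<lambda>u. opt_ext trail_basis (wact (tact E) (letters u @ letters w) z)) x
        = opt_ext (word_op E x) (wact (tact E) (letters w) z)"
      by (cases "wact (tact E) (letters w) z") (simp_all add: word_op_def)
  qed
  also have "\<dots> = linext (word_op E x) (word_op E y z)"
    by (simp add: word_op_def[of E y] linext_linext linext_opt_ext)
  finally show ?thesis .
qed

lemma lin_op_linext: "lin_op E b = (\<lambda>m\<in>trail_module E. linext (\<lambda>z. b (fst z) (snd z)) m)"
  unfolding lin_op_def linext_def by (intro restrict_ext sum.cong) auto

lemma submodule_trail_module: "submodule (trail_module E)"
  unfolding submodule_def trail_module_def
  by (auto dest!: subsetD[OF keys_add] subsetD[OF keys_pm_scale])

lemma submodule_trail_module_deg: "submodule (trail_module_deg E i)"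
proof -
  have "submodule {m :: ('a, 'b, 'c) trail_comb. fst ` Poly_Mapping.keys m \<subseteq> {i}}"
    unfolding submodule_def by (auto dest!: subsetD[OF keys_add] subsetD[OF keys_pm_scale])
  with submodule_trail_module show ?thesis
    by (auto simp: trail_module_deg_def submodule_def)
qed

lemma trail_basis_module: "snd z \<in> ess_aperiodic_trails E \<Longrightarrow> trail_basis z \<in> trail_module E"
  by (auto simp: trail_module_def trail_basis_def)

lemma trail_module_keys:
  "m \<in> trail_module E \<Longrightarrow> z \<in> Poly_Mapping.keys m \<Longrightarrow> snd z \<in> ess_aperiodic_trails E"
  by (auto simp: trail_module_def)

lemma linext_trail_module:
  assumes "\<And>z. snd z \<in> ess_aperiodic_trails E \<Longrightarrow> b z \<in> trail_module E" "m \<in> trail_module E"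
  shows "linext b m \<in> trail_module E"
  using assms trail_module_keys by (intro submodule_linext[OF submodule_trail_module]) blast

lemma linext_trail_endos:
  fixes b :: "int \<times> ('v, 'e) trail \<Rightarrow> ('v, 'e, 'r::{comm_ring, comm_monoid_mult}) trail_comb"
  assumes b: "\<And>z. snd z \<in> ess_aperiodic_trails E \<Longrightarrow> b z \<in> trail_module E"
  shows "(\<lambda>m\<in>trail_module E. linext b m) \<in> trail_endos E"
proof -
  have M: "submodule (trail_module E :: ('v, 'e, 'r) trail_comb set)"
    by (rule submodule_trail_module)
  show ?thesis
    unfolding trail_endos_def using linext_trail_module[of E b] b submoduleD[OF M]
    by (auto simp: linext_add linext_scale)
qed

lemma trail_endos_linext:
  fixes T :: "('v, 'e, 'r::{comm_ring, comm_monoid_mult}) trail_op"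
  assumes T: "T \<in> trail_endos E" and b: "\<And>z. z \<in> Poly_Mapping.keys m \<Longrightarrow> b z \<in> trail_module E"
  shows "T (linext b m) = linext (\<lambda>z. T (b z)) m"
proof -
  have "submodule (trail_module E :: ('v, 'e, 'r) trail_comb set)"
    by (rule submodule_trail_module)
  note M = submoduleD[OF this]
  have "T (pm_scale 0 0) = pm_scale 0 (T 0)"
    using T M(1) unfolding trail_endos_def by blast
  then have T0: "T 0 = 0" by simp
  \<comment> \<open>\<open>T\<close> is additive and homogeneous only on the module, so the
    membership of the partial sums is carried through the induction.\<close>
  have "(\<Sum>z\<in>A. pm_scale (Poly_Mapping.lookup m z) (b z)) \<in> trail_module E \<and>
      T (\<Sum>z\<in>A. pm_scale (Poly_Mapping.lookup m z) (b z))
        = (\<Sum>z\<in>A. pm_scale (Poly_Mapping.lookup m z) (T (b z)))"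
    if "finite A" "A \<subseteq> Poly_Mapping.keys m" for A
    using that
  proof (induction A)
    case (insert z A)
    let ?S = "\<Sum>z\<in>A. pm_scale (Poly_Mapping.lookup m z) (b z)"
    have S: "?S \<in> trail_module E"
      "T ?S = (\<Sum>z\<in>A. pm_scale (Poly_Mapping.lookup m z) (T (b z)))"
      using insert by auto
    have "b z \<in> trail_module E" using b insert.prems by blast
    then have scale: "pm_scale c (b z) \<in> trail_module E" "T (pm_scale c (b z)) = pm_scale c (T (b z))" for c
      using T M(3) unfolding trail_endos_def by blast+
    have "T (pm_scale c (b z) + ?S) = T (pm_scale c (b z)) + T ?S" for c
      using T S(1) scale(1) unfolding trail_endos_def by blast
    then show ?case
      using insert.hyps M(2)[OF scale(1) S(1)] by (simp only: sum.insert S scale simp_thms)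
  qed (simp add: T0 M)
  from this[OF finite_keys subset_refl] show ?thesis by (simp only: linext_def)
qed

lemma trail_endos_eq_linext:
  assumes "T \<in> trail_endos E" "m \<in> trail_module E"
  shows "T m = linext (\<lambda>z. T (trail_basis z)) m"
proof -
  have "T (linext trail_basis m) = linext (\<lambda>z. T (trail_basis z)) m"
    by (rule trail_endos_linext[OF assms(1)])
      (intro trail_basis_module trail_module_keys[OF assms(2)])
  then show ?thesis by (simp add: linext_trail_basis)
qed

context wf_digraph
begin

lemma tact_ess_aperiodic:
  assumes "g \<in> generators G" "snd z \<in> ess_aperiodic_trails G" "tact G g z = Some z'"
  shows "snd z' \<in> ess_aperiodic_trails G"
proof -
  obtain n \<tau> where z: "z = (n, \<tau>)" by fastforce
  have \<tau>: "\<tau> \<in> ess_aperiodic_trails G" "is_trail G \<tau>"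
    using assms by (auto simp: z ess_aperiodic_trails_def)
  show ?thesis
  proof (cases g)
    case (Vertex v)
    then show ?thesis using assms z by (auto split: if_splits)
  next
    case (Edge e)
    then have z': "trail_source G \<tau> = head G e" "z' = (1 + n, trail_append (tail G e, [e]) \<tau>)"
      using assms(3) by (auto simp: z split: if_splits)
    have "walk G (tail G e) [e]" using assms(1) Edge by simp
    from ess_aperiodic_append_iff[OF this \<tau>(2)] \<tau>(1) z' show ?thesis by simp
  next
    case (Ghost e)
    obtain \<beta> where \<beta>: "trail_remainder G (tail G e, [e]) \<tau> \<beta>"
      using assms(3) by (auto simp: Ghost z initial_segment_def split: if_splits)
    have "z' = (n - 1, \<beta>)"
      using assms(3) tact_Ghost[OF \<beta>, of n] by (simp add: Ghost z del: tact.simps)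
    moreover have "walk G (tail G e) [e]" using assms(1) Ghost by simp
    moreover have "is_trail G \<beta>" "trail_source G \<beta> = head G e" "\<tau> = trail_append (tail G e, [e]) \<beta>"
      using \<beta> by (simp_all add: trail_remainder_def)
    ultimately show ?thesis
      using ess_aperiodic_append_iff[of "tail G e" "[e]" \<beta>] \<tau>(1) by simp
  qed
qed

lemma wact_tact_ess_aperiodic:
  "set w \<subseteq> generators G \<Longrightarrow> snd z \<in> ess_aperiodic_trails G \<Longrightarrow> wact (tact G) w z = Some z' \<Longrightarrow>
    snd z' \<in> ess_aperiodic_trails G"
  by (induction w arbitrary: z') (auto simp: Option.bind_eq_Some_conv intro: tact_ess_aperiodic)

lemma opt_ext_trail_basis_module:
  assumes "set w \<subseteq> generators G" "snd z \<in> ess_aperiodic_trails G"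
  shows "opt_ext trail_basis (wact (tact G) w z)
    \<in> (trail_module G :: ('a, 'b, 'r::{comm_ring, comm_monoid_mult}) trail_comb set)"
proof (cases "wact (tact G) w z")
  case (Some z')
  from trail_basis_module[OF wact_tact_ess_aperiodic[OF assms Some]] Some show ?thesis by simp
qed (simp add: submoduleD[OF submodule_trail_module])

lemma word_op_module:
  assumes "x \<in> free_algebra G" "snd z \<in> ess_aperiodic_trails G"
  shows "word_op G x z \<in> trail_module G"
  unfolding word_op_def using assms
  by (intro submodule_linext[OF submodule_trail_module] opt_ext_trail_basis_module)
    (auto simp: free_algebra_def)

lemma trail_rep_class:
  assumes x: "x \<in> free_algebra G"
  shows "trail_rep G (leavitt_class G x) = (\<lambda>m\<in>trail_module G. linext (word_op G x) m)"
proof -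
  define y where "y = (SOME y. y \<in> leavitt_class G x)"
  have "y \<in> leavitt_class G x"
    unfolding y_def using mem_leavitt_class[OF x] by (rule someI)
  then have ideal: "y - x \<in> leavitt_ideal G" by (simp add: leavitt_class_def)
  have "word_op G y z = word_op G x z" if "snd z \<in> ess_aperiodic_trails G" for z
    using linext_tact_leavitt_ideal[OF ideal, of z trail_basis] that
    by (simp add: word_op_def linext_minus ess_aperiodic_trails_def)
  then have "linext (word_op G y) m = linext (word_op G x) m" if "m \<in> trail_module G" for m
    using trail_module_keys[OF that] by (intro linext_cong) blast
  then show ?thesis
    using leavitt_carrierI[OF x] by (auto simp: trail_rep_def y_def intro: restrict_ext)
qed

text \<open>The words of \<open>x\<close> are sorted by degree, where edges count 1 and ghost edges
  -1. Finitely many degrees occur, and the words of degree \<open>i\<close> shift the grading by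
  \<open>i\<close>.\<close>

lemma trail_rep_homogeneous:
  assumes x: "x \<in> free_algebra G"
  shows "(\<lambda>m\<in>trail_module G. linext (word_op G x) m) \<in> acarrier (graded_endos G)"
proof -
  define part where "part i z = linext (\<lambda>w. if word_degree w = i
    then opt_ext trail_basis (wact (tact G) (letters w) z) else 0) x" for i z
  have gens: "set (letters w) \<subseteq> generators G" if "w \<in> Poly_Mapping.keys x" for w
    using x that by (auto simp: free_algebra_def)
  have part: "part i z \<in> trail_module G" if "snd z \<in> ess_aperiodic_trails G" for i z
    unfolding part_def using that
    by (intro submodule_linext[OF submodule_trail_module])
      (simp add: gens opt_ext_trail_basis_module submoduleD(1)[OF submodule_trail_module])
  define I where "I = word_degree ` Poly_Mapping.keys x"
  have sum: "word_op G x z = (\<Sum>i\<in>I. part i z)" for z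
    unfolding word_op_def part_def linext_fun_sum[symmetric]
    by (rule linext_cong) (simp add: I_def)
  have deg: "(\<lambda>m\<in>trail_module G. linext (part i) m) \<in> trail_endos_deg G i" for i
    unfolding trail_endos_deg_def
  proof (intro CollectI conjI allI subsetI)
    show "(\<lambda>m\<in>trail_module G. linext (part i) m) \<in> trail_endos G"
      by (intro linext_trail_endos part)
    fix t m'
    assume "m' \<in> (\<lambda>m\<in>trail_module G. linext (part i) m) ` trail_module_deg G t"
    then obtain m where m: "m \<in> trail_module G" "fst ` Poly_Mapping.keys m \<subseteq> {t}"
      and m': "m' = linext (part i) m"
      by (auto simp: trail_module_deg_def)
    have "part i z \<in> trail_module_deg G (t + i)" if z: "z \<in> Poly_Mapping.keys m" for z
      unfolding part_def
    proof (rule submodule_linext[OF submodule_trail_module_deg])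
      fix w assume w: "w \<in> Poly_Mapping.keys x"
      show "(if word_degree w = i then opt_ext trail_basis (wact (tact G) (letters w) z) else 0)
          \<in> trail_module_deg G (t + i)"
      proof (cases "word_degree w = i \<and> wact (tact G) (letters w) z \<noteq> None")
        case True
        then obtain z' where z': "wact (tact G) (letters w) z = Some z'" by auto
        have "fst z = t" using m(2) z by auto
        then have "fst z' = t + i"
          using wact_tact_degree[OF z'] True by (simp add: word_degree_def)
        moreover have "opt_ext trail_basis (wact (tact G) (letters w) z) \<in> trail_module G"
          using opt_ext_trail_basis_module gens[OF w] trail_module_keys[OF m(1) z] by blast
        ultimately show ?thesis
          using True z' by (auto simp: trail_module_deg_def trail_basis_def)
      next
        case False
        then show ?thesis
          by (cases "wact (tact G) (letters w) z") (auto simp: submoduleD(1)[OF submodule_trail_module_deg])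
      qed
    qed
    then show "m' \<in> trail_module_deg G (t + i)"
      unfolding m' by (intro submodule_linext[OF submodule_trail_module_deg])
  qed
  have endo: "(\<lambda>m\<in>trail_module G. linext (word_op G x) m) \<in> trail_endos G"
    by (intro linext_trail_endos word_op_module[OF x])
  have "linext (word_op G x) m = (\<Sum>i\<in>I. linext (part i) m)" for m
    unfolding linext_fun_sum[symmetric] sum ..
  then have "\<forall>m\<in>trail_module G. (\<lambda>m\<in>trail_module G. linext (word_op G x) m) m
      = (\<Sum>i\<in>I. (\<lambda>m\<in>trail_module G. linext (part i) m) m)"
    by simp
  moreover have "finite I" by (simp add: I_def)
  ultimately have "\<exists>F g. finite F \<and> (\<forall>i\<in>F. g i \<in> trail_endos_deg G i) \<and>
      (\<forall>m\<in>trail_module G. (\<lambda>m\<in>trail_module G. linext (word_op G x) m) m = (\<Sum>i\<in>F. g i m))"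
    using deg by (intro exI[of _ I] exI[of _ "\<lambda>i. \<lambda>m\<in>trail_module G. linext (part i) m"]) blast
  with endo show ?thesis by (simp add: graded_endos_def)
qed

lemma alg_hom_trail_rep:
  "alg_hom (leavitt_path_algebra G) (graded_endos G)
    (trail_rep G :: ('a, 'b, 'r::{comm_ring, comm_monoid_mult}) lpa \<Rightarrow> _)"
  unfolding alg_hom_def alg_linear_def
proof (intro conjI ballI allI)
  show "trail_rep G \<in> lcarrier \<rightarrow>\<^sub>E
      (acarrier (graded_endos G) :: ('a, 'b, 'r) trail_op set)"
  proof (rule PiE_I)
    fix X :: "('a, 'b, 'r) lpa"
    assume "X \<in> lcarrier"
    then show "trail_rep G X \<in> acarrier (graded_endos G)"
      by (elim leavitt_carrierE) (simp add: trail_rep_class trail_rep_homogeneous)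
  qed (simp add: trail_rep_def)
  fix X :: "('a, 'b, 'r) lpa"
  assume "X \<in> lcarrier"
  then obtain x where x: "x \<in> free_algebra G" "X = leavitt_class G x" by (rule leavitt_carrierE)
  show "trail_rep G (lscale c X) = ascale (graded_endos G) c (trail_rep G X)" for c
    using x by (auto simp: leavitt_class_scale trail_rep_class free_algebraD graded_endos_def
        word_op_linear linext_fun_scale[symmetric] intro!: restrict_ext linext_cong)
  fix Y :: "('a, 'b, 'r) lpa"
  assume "Y \<in> lcarrier"
  then obtain y where y: "y \<in> free_algebra G" "Y = leavitt_class G y" by (rule leavitt_carrierE)
  show "trail_rep G (ladd X Y)
      = aadd (graded_endos G) (trail_rep G X) (trail_rep G Y)"
    using x y by (auto simp: leavitt_class_add trail_rep_class free_algebraD graded_endos_def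
        word_op_linear linext_fun_add[symmetric] intro!: restrict_ext linext_cong)
  have "linext (word_op G (x * y)) m = linext (word_op G x) (linext (word_op G y) m)" for m
    by (simp add: linext_linext word_op_mult[abs_def])
  moreover have "linext (word_op G y) m \<in> trail_module G" if "m \<in> trail_module G" for m
    using that y(1) by (intro linext_trail_module word_op_module)
  ultimately show "trail_rep G (lmult X Y)
      = amult (graded_endos G) (trail_rep G X) (trail_rep G Y)"
    using x y by (auto simp: leavitt_class_mult trail_rep_class free_algebra_mult graded_endos_def
        compose_def intro!: restrict_ext)
qed

lemma trail_rep_monomial:
  assumes "\<alpha> \<in> paths G" "\<beta> \<in> paths G"
  shows "trail_rep G (leavitt_monomial G \<alpha> \<beta>)
    = amult (graded_endos G) (S_op G \<alpha>)
        (S_star_op G \<beta> :: ('a, 'b, 'r::{comm_ring, comm_monoid_mult}) trail_op)"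
proof -
  obtain u p w q where eq: "\<alpha> = (u, p)" "\<beta> = (w, q)" by (metis prod.collapse)
  have walks: "walk G u p" "walk G w q" using assms by (auto simp: eq paths_iff_walk)
  define a :: "int \<times> ('a, 'b) trail \<Rightarrow> ('a, 'b, 'r) trail_comb" where
    "a = (\<lambda>z. if path_range G \<alpha> = trail_source G (snd z)
       then \<xi> (int (path_length \<alpha>) + fst z) (trail_append \<alpha> (snd z)) else 0)"
  define b :: "int \<times> ('a, 'b) trail \<Rightarrow> ('a, 'b, 'r) trail_comb" where
    "b = (\<lambda>z. if initial_segment G \<beta> (snd z)
       then \<xi> (fst z - int (path_length \<beta>)) (THE \<delta>. trail_remainder G \<beta> (snd z) \<delta>) else 0)"
  have ab: "word_op G (monomial (\<alpha>, \<beta>)) z = linext a (b z)" "b z \<in> trail_module G"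
    if z: "snd z \<in> ess_aperiodic_trails G" for z
  proof -
    have \<tau>: "is_trail G (snd z)" using z by (simp add: ess_aperiodic_trails_def)
    have word: "word_op G (monomial (\<alpha>, \<beta>)) z
        = opt_ext trail_basis (Option.bind (wact (tact G) (ghost_word \<beta>) z) (wact (tact G) (path_word \<alpha>)))"
      by (simp add: monomial_def word_op_linear monomial_word_def)
    have "word_op G (monomial (\<alpha>, \<beta>)) z = linext a (b z) \<and> b z \<in> trail_module G"
    proof (cases "initial_segment G \<beta> (snd z)")
      case True
      then obtain \<delta> where \<delta>: "trail_remainder G \<beta> (snd z) \<delta>" by (auto simp: initial_segment_def)
      then have trail: "is_trail G \<delta>" "trail_source G \<delta> = path_range G (w, q)" "snd z = trail_append (w, q) \<delta>"
        by (auto simp: trail_remainder_def eq)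
      then have "\<delta> \<in> ess_aperiodic_trails G"
        using z ess_aperiodic_append_iff[OF walks(2) trail(1,2)] by simp
      then have "b z \<in> trail_module G"
        using True the_trail_remainder[OF \<delta>] by (auto simp: b_def \<xi>_def trail_module_def)
      moreover have "wact (tact G) (ghost_word \<beta>) z = Some (fst z - int (path_length \<beta>), \<delta>)"
        using ghost_word_tact[OF walks(2) \<tau>, of "fst z"] True the_trail_remainder[OF \<delta>]
        by (simp add: eq path_length_def)
      ultimately show ?thesis
        unfolding word using path_word_tact[OF walks(1) trail(1)] True the_trail_remainder[OF \<delta>]
        by (simp add: a_def b_def \<xi>_def trail_basis_def eq path_length_def)
    next
      case False
      then show ?thesis
        unfolding word using ghost_word_tact[OF walks(2) \<tau>, of "fst z"]
        by (simp add: b_def eq submoduleD(1)[OF submodule_trail_module])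
    qed
    then show "word_op G (monomial (\<alpha>, \<beta>)) z = linext a (b z)" "b z \<in> trail_module G" by auto
  qed
  have FA: "monomial (\<alpha>, \<beta>) \<in> (free_algebra G :: (('a, 'b) gen word \<Rightarrow>\<^sub>0 'r) set)"
    unfolding monomial_def monomial_word_def using assms path_word_generators ghost_word_generators
    by (intro free_algebra_single) auto
  have "linext (word_op G (monomial (\<alpha>, \<beta>))) m = linext a (linext b m)"
    if "m \<in> trail_module G" for m
    unfolding linext_linext using ab trail_module_keys[OF that] by (intro linext_cong) blast
  then show ?thesis
    using ab(2) linext_trail_module[of G b]
    by (auto simp: leavitt_monomial_eq[OF assms] trail_rep_class[OF FA] graded_endos_def compose_def
        S_op_def S_star_op_def lin_op_linext a_def[symmetric] b_def[symmetric] intro!: restrict_ext)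
qed

text \<open>For uniqueness, a homomorphism is determined by its values at the monomials and at zero.
  The latter is forced because scaling by 0 in \<open>graded_endos\<close> yields the zero
  map.\<close>

lemma \<Pi>_ap_eq_trail_rep:
  "\<Pi>_ap G = (trail_rep G :: ('a, 'b, 'r::{comm_ring, comm_monoid_mult}) lpa \<Rightarrow> _)"
  unfolding \<Pi>_ap_def
proof (rule the_equality, intro conjI ballI)
  show "alg_hom (leavitt_path_algebra G) (graded_endos G) (trail_rep G :: ('a, 'b, 'r) lpa \<Rightarrow> _)"
    by (rule alg_hom_trail_rep)
  show "trail_rep G (leavitt_monomial G \<alpha> \<beta>)
      = amult (graded_endos G) (S_op G \<alpha>) (S_star_op G \<beta> :: ('a, 'b, 'r) trail_op)"
    if "\<alpha> \<in> paths G" "\<beta> \<in> paths G" for \<alpha> \<beta>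
    by (rule trail_rep_monomial[OF that])
  fix f :: "('a, 'b, 'r) lpa \<Rightarrow> ('a, 'b, 'r) trail_op"
  assume f: "alg_hom (leavitt_path_algebra G) (graded_endos G) f \<and>
    (\<forall>\<alpha>\<in>paths G. \<forall>\<beta>\<in>paths G. f (leavitt_monomial G \<alpha> \<beta>)
      = amult (graded_endos G) (S_op G \<alpha>) (S_star_op G \<beta>))"
  have zero: "g lzero = (\<lambda>m\<in>trail_module G. 0)"
    if "alg_hom (leavitt_path_algebra G) (graded_endos G) g"
    for g :: "('a, 'b, 'r) lpa \<Rightarrow> ('a, 'b, 'r) trail_op"
  proof -
    let ?z = "lzero :: ('a, 'b, 'r) lpa"
    have "?z = lscale 0 ?z"
      by (simp add: leavitt_zero leavitt_class_scale free_algebraD(1))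
    moreover have "g (lscale 0 ?z) = ascale (graded_endos G) 0 (g ?z)"
      using that leavitt_zero_closed unfolding alg_hom_def alg_linear_def by blast
    ultimately show ?thesis by (simp add: graded_endos_def)
  qed
  show "f = trail_rep G"
  proof (rule alg_linear_leavitt_eqI)
    show "alg_linear (leavitt_path_algebra G) (graded_endos G) f"
      "alg_linear (leavitt_path_algebra G) (graded_endos G) (trail_rep G :: ('a, 'b, 'r) lpa \<Rightarrow> _)"
      using f alg_hom_trail_rep by (auto simp: alg_hom_def)
    show "f lzero = trail_rep G lzero"
      using zero[of f] zero[OF alg_hom_trail_rep] f by simp
    fix p :: "('a, 'b) path \<times> ('a, 'b) path"
    assume "p \<in> path_pairs G"
    then have paths: "fst p \<in> paths G" "snd p \<in> paths G" by (auto simp: path_pairs_def)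
    then have "f (leavitt_monomial G (fst p) (snd p)) = trail_rep G (leavitt_monomial G (fst p) (snd p))"
      using f by (simp add: trail_rep_monomial[OF paths])
    then show "f (leavitt_class G (monomial p)) = trail_rep G (leavitt_class G (monomial p))"
      by (simp add: leavitt_monomial_eq[OF paths])
  qed
qed

end

section \<open>The conditional expectation onto the diagonal\<close>

lemma linext_basis [simp]: "linext b (trail_basis z) = b z"
  by (simp add: trail_basis_def)

text \<open>\<open>Q_op\<close> without the restriction to the trail module, hence a linear
  extension on the whole type.\<close>

definition trail_part :: "('v, 'e) trail \<Rightarrow> ('v, 'e, 'r::{comm_ring, comm_monoid_mult}) trail_comb \<Rightarrow>
    ('v, 'e, 'r) trail_comb" where
  "trail_part \<tau> = linext (\<lambda>z. if snd z = \<tau> then trail_basis z else 0)"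

lemma lookup_linext_filter:
  "Poly_Mapping.lookup (linext (\<lambda>z. if P z then trail_basis z else 0) m) z
    = (if P z then Poly_Mapping.lookup m z else 0)"
  by (induction m rule: pm_induct)
    (auto simp: linext_add lookup_add trail_basis_def lookup_single when_def)

lemma lookup_trail_part:
  "Poly_Mapping.lookup (trail_part \<tau> m) z = (if snd z = \<tau> then Poly_Mapping.lookup m z else 0)"
  by (simp add: trail_part_def lookup_linext_filter)

lemma Q_op_eq: "m \<in> trail_module E \<Longrightarrow> Q_op E \<tau> m = trail_part \<tau> m"
  by (auto simp: Q_op_def lin_op_linext trail_part_def trail_basis_def \<xi>_def intro!: linext_cong)

lemma trail_part_module:
  assumes "m \<in> trail_module E"
  shows "trail_part \<tau> m \<in> trail_module E"
proof -
  have "Poly_Mapping.keys (trail_part \<tau> m) \<subseteq> Poly_Mapping.keys m"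
    by (auto simp: in_keys_iff lookup_trail_part split: if_splits)
  with assms show ?thesis by (auto simp: trail_module_def)
qed

lemma sum_trail_part:
  assumes "finite F"
  shows "(\<Sum>\<tau>\<in>F. trail_part \<tau> m) = m \<longleftrightarrow> snd ` Poly_Mapping.keys m \<subseteq> F"
proof -
  have "Poly_Mapping.lookup (\<Sum>\<tau>\<in>F. trail_part \<tau> m) z
      = (if snd z \<in> F then Poly_Mapping.lookup m z else 0)" for z
    using assms by (simp add: lookup_sum lookup_trail_part)
  then show ?thesis
    unfolding poly_mapping_eq_iff fun_eq_iff image_subset_iff Ball_def in_keys_iff by metis
qed

text \<open>The finite sets of trails whose projections recover \<open>m\<close> are exactly those
  containing all trails that occur in \<open>m\<close>, so a minimal one is this least one.\<close>

lemma trail_support_eq: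
  assumes m: "m \<in> trail_module E"
  shows "trail_support E m = snd ` Poly_Mapping.keys m"
proof -
  have *: "(\<Sum>\<tau>\<in>F. Q_op E \<tau> m) = m \<longleftrightarrow> snd ` Poly_Mapping.keys m \<subseteq> F" if "finite F" for F
    using sum_trail_part[OF that] by (simp add: Q_op_eq[OF m])
  show ?thesis
    unfolding trail_support_def
  proof (rule the_equality)
    show "finite (snd ` Poly_Mapping.keys m) \<and> snd ` Poly_Mapping.keys m \<subseteq> ess_aperiodic_trails E \<and>
        (\<Sum>\<tau>\<in>snd ` Poly_Mapping.keys m. Q_op E \<tau> m) = m \<and>
        (\<forall>F'. F' \<subset> snd ` Poly_Mapping.keys m \<longrightarrow> (\<Sum>\<tau>\<in>F'. Q_op E \<tau> m) \<noteq> m)"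
    proof (intro conjI allI impI)
      show "snd ` Poly_Mapping.keys m \<subseteq> ess_aperiodic_trails E"
        using m by (simp add: trail_module_def)
      fix F' assume F': "F' \<subset> snd ` Poly_Mapping.keys m"
      then have "finite F'" by (meson finite_imageI finite_keys finite_subset psubset_imp_subset)
      from *[OF this] F' show "(\<Sum>\<tau>\<in>F'. Q_op E \<tau> m) \<noteq> m" by blast
    qed (simp_all add: *)
  next
    fix F
    assume F: "finite F \<and> F \<subseteq> ess_aperiodic_trails E \<and> (\<Sum>\<tau>\<in>F. Q_op E \<tau> m) = m \<and>
      (\<forall>F'. F' \<subset> F \<longrightarrow> (\<Sum>\<tau>\<in>F'. Q_op E \<tau> m) \<noteq> m)"
    then have "snd ` Poly_Mapping.keys m \<subseteq> F" using *[of F] by blast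
    moreover have "(\<Sum>\<tau>\<in>snd ` Poly_Mapping.keys m. Q_op E \<tau> m) = m" by (simp add: *)
    ultimately show "F = snd ` Poly_Mapping.keys m" using F by blast
  qed
qed

text \<open>The sum in \<open>E_ap\<close> ranges over a set that depends on its argument. This form
  makes linearity apparent: each basis element keeps the component of its image along its own
  trail.\<close>

lemma E_ap_linext:
  fixes T :: "('v, 'e, 'r::{comm_ring, comm_monoid_mult}) trail_op"
  assumes T: "T \<in> trail_endos E" and m: "m \<in> trail_module E"
  shows "E_ap E T m = linext (\<lambda>z. trail_part (snd z) (T (trail_basis z))) m"
proof -
  define b :: "('v, 'e) trail \<Rightarrow> int \<times> ('v, 'e) trail \<Rightarrow> ('v, 'e, 'r) trail_comb" where
    "b = (\<lambda>\<tau> z. if snd z = \<tau> then trail_basis z else 0)"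
  have T0: "T 0 = 0"
    using trail_endos_linext[OF T, of 0 trail_basis] by simp
  have "trail_part \<tau> (T (trail_part \<tau> m))
      = linext (\<lambda>z. if snd z = \<tau> then trail_part (snd z) (T (trail_basis z)) else 0) m" for \<tau>
  proof -
    have "b \<tau> z \<in> trail_module E" if "z \<in> Poly_Mapping.keys m" for z
      by (simp add: b_def trail_basis_module[OF trail_module_keys[OF m that]]
          submoduleD(1)[OF submodule_trail_module])
    then have "T (linext (b \<tau>) m) = linext (\<lambda>z. T (b \<tau> z)) m"
      by (rule trail_endos_linext[OF T])
    then have "trail_part \<tau> (T (trail_part \<tau> m)) = linext (\<lambda>z. trail_part \<tau> (T (b \<tau> z))) m"
      by (simp add: trail_part_def b_def linext_linext)
    also have "\<dots> = linext (\<lambda>z. if snd z = \<tau> then trail_part (snd z) (T (trail_basis z)) else 0) m"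
      by (intro linext_cong) (auto simp: b_def T0 trail_part_def)
    finally show ?thesis .
  qed
  moreover have "T (trail_part \<tau> m) \<in> trail_module E" for \<tau>
    using T trail_part_module[OF m] by (auto simp: trail_endos_def)
  ultimately have "E_ap E T m = (\<Sum>\<tau>\<in>snd ` Poly_Mapping.keys m.
      linext (\<lambda>z. if snd z = \<tau> then trail_part (snd z) (T (trail_basis z)) else 0) m)"
    using m by (simp add: E_ap_def trail_support_eq Q_op_eq)
  also have "\<dots> = linext (\<lambda>z. trail_part (snd z) (T (trail_basis z))) m"
    unfolding linext_fun_sum[symmetric] by (intro linext_cong) simp
  finally show ?thesis .
qed

context wf_digraph
begin

text \<open>\<open>\<mu>\<nu>\<^sup>*\<close> maps \<open>\<nu>\<beta>\<close> to
  \<open>\<mu>\<beta>\<close>, which the projection keeps iff the two trails are equal. With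
  \<open>\<beta>\<close> essentially aperiodic, this happens iff the paths are trail equivalent. The
  degree may change, but the projection to a trail keeps all degrees.\<close>

lemma trail_part_monomial:
  assumes p: "p \<in> path_pairs G" and z: "snd z \<in> ess_aperiodic_trails G"
  shows "trail_part (snd z) (word_op G (monomial p) z) = word_op G (equiv_monomial G p) z"
proof -
  obtain \<mu> \<nu> where eq: "p = (\<mu>, \<nu>)" by (metis surj_pair)
  have walks: "walk G (fst \<nu>) (snd \<nu>)" "path_range G \<mu> = path_range G \<nu>"
    using p by (auto simp: eq path_pairs_def paths_iff_walk)
  have \<tau>: "is_trail G (snd z)" using z by (simp add: ess_aperiodic_trails_def)
  have word: "word_op G (monomial p) z = opt_ext trail_basis (wact (tact G) (monomial_word p) z)"
    by (simp add: monomial_def word_op_linear)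
  show ?thesis
  proof (cases "initial_segment G \<nu> (snd z)")
    case True
    then obtain \<beta> where \<beta>: "trail_remainder G \<nu> (snd z) \<beta>" by (auto simp: initial_segment_def)
    define n where "n = fst z - int (path_length \<nu>) + int (path_length \<mu>)"
    have val: "word_op G (monomial p) z = trail_basis (n, trail_append \<mu> \<beta>)"
      using monomial_word_tact(1)[OF p[unfolded eq] \<tau> \<beta>, of "fst z"] unfolding word
      by (simp add: eq n_def)
    have trail: "is_trail G \<beta>" "trail_source G \<beta> = path_range G \<nu>" "snd z = trail_append \<nu> \<beta>"
      using \<beta> by (auto simp: trail_remainder_def)
    then have ess: "\<beta> \<in> ess_aperiodic_trails G"
      using z ess_aperiodic_append_iff[OF walks(1) trail(1)] by simp
    show ?thesis
    proof (cases "trail_equiv G \<mu> \<nu>")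
      case True
      then have "trail_append \<mu> \<beta> = snd z"
        using trail walks(2) by (simp add: trail_equiv_def)
      with True show ?thesis
        by (simp add: eq equiv_monomial_def trail_part_def val[unfolded eq])
    next
      case False
      then have "trail_append \<mu> \<beta> \<noteq> snd z"
        using ess_aperiodic_trail_equiv[OF p[unfolded eq] ess] trail walks(2) by auto
      with False show ?thesis
        by (simp add: eq equiv_monomial_def word_op_linear trail_part_def val[unfolded eq])
    qed
  next
    case False
    then have "wact (tact G) (monomial_word p) z = None"
      using monomial_word_tact(2)[OF p[unfolded eq] \<tau>, of "fst z"] by (simp add: eq)
    then show ?thesis
      by (simp add: word equiv_monomial_def word_op_linear trail_part_def)
  qed
qed

text \<open>A representative need not be a combination of monomials. Its reduction differs from it
  by an element of the ideal, hence acts in the same way, and the monomial case applies term by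
  term.\<close>

lemma trail_part_word_op:
  assumes x: "x \<in> free_algebra G" and z: "snd z \<in> ess_aperiodic_trails G"
  shows "trail_part (snd z) (word_op G x z) = word_op G (pair_ext G (equiv_monomial G) x) z"
proof -
  have ideal: "word_op G y z = 0" if "y \<in> leavitt_ideal G" for y :: "_ \<Rightarrow>\<^sub>0 'c"
    using linext_tact_leavitt_ideal[OF that, of z trail_basis] z
    by (simp add: word_op_def ess_aperiodic_trails_def)
  have comp: "word_op G (pair_ext G T x) z
      = linext (\<lambda>w. word_op G (opt_ext T (red G (letters w))) z) x"
    for T :: "_ \<Rightarrow> _ \<Rightarrow>\<^sub>0 'c"
    by (simp add: pair_ext_def word_op_def linext_linext)
  have "word_op G x z = word_op G (pair_ext G monomial x) z"
    using ideal[OF diff_pair_ext_monomial[OF x]] by (simp add: word_op_linear)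
  then have "trail_part (snd z) (word_op G x z)
      = linext (\<lambda>w. trail_part (snd z) (word_op G (opt_ext monomial (red G (letters w))) z)) x"
    by (simp add: comp trail_part_def linext_linext)
  also have "\<dots> = linext (\<lambda>w. word_op G (opt_ext (equiv_monomial G) (red G (letters w))) z) x"
  proof (rule linext_cong)
    fix w assume "w \<in> Poly_Mapping.keys x"
    then have w: "letters w \<noteq> []" "set (letters w) \<subseteq> generators G"
      using x by (auto simp: free_algebra_def)
    show "trail_part (snd z) (word_op G (opt_ext monomial (red G (letters w))) z)
        = word_op G (opt_ext (equiv_monomial G) (red G (letters w))) z"
    proof (cases "red G (letters w)")
      case None
      then show ?thesis by (simp add: word_op_linear trail_part_def)
    next
      case (Some p)
      then show ?thesis using trail_part_monomial[OF red_closed[OF w Some] z] by simp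
    qed
  qed
  finally show ?thesis by (simp add: comp)
qed

lemma \<Pi>_ap_core_expectation:
  fixes X :: "('a, 'b, 'r::{comm_ring, comm_monoid_mult}) lpa"
  assumes "X \<in> lcarrier"
  shows "\<Pi>_ap G (core_expectation G X) = E_ap G (\<Pi>_ap G X)"
proof -
  obtain x where x: "x \<in> free_algebra G" "X = leavitt_class G x"
    using assms by (rule leavitt_carrierE)
  have y: "pair_ext G (equiv_monomial G) x \<in> free_algebra G"
    by (rule pair_ext_free_algebra[OF equiv_monomial_free_algebra x(1)])
  have core: "core_expectation G X = leavitt_class G (pair_ext G (equiv_monomial G) x)"
    using leavitt_ext_class[OF ck2_compatible_equiv_monomial x(1)]
    by (simp add: core_expectation_def x(2))
  define T where "T = (\<lambda>m\<in>trail_module G. linext (word_op G x) m)"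
  have T: "T \<in> trail_endos G"
    unfolding T_def by (intro linext_trail_endos word_op_module[OF x(1)])
  have "linext (word_op G (pair_ext G (equiv_monomial G) x)) m = E_ap G T m"
    if m: "m \<in> trail_module G" for m
    unfolding E_ap_linext[OF T m]
  proof (rule linext_cong)
    fix z assume "z \<in> Poly_Mapping.keys m"
    from trail_module_keys[OF m this] have z: "snd z \<in> ess_aperiodic_trails G" .
    have "T (trail_basis z) = word_op G x z"
      by (simp add: T_def trail_basis_module[OF z])
    with trail_part_word_op[OF x(1) z]
    show "word_op G (pair_ext G (equiv_monomial G) x) z = trail_part (snd z) (T (trail_basis z))"
      by simp
  qed
  then have "(\<lambda>m\<in>trail_module G. linext (word_op G (pair_ext G (equiv_monomial G) x)) m) = E_ap G T"
    by (auto simp: E_ap_def)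
  then show ?thesis
    unfolding \<Pi>_ap_eq_trail_rep core trail_rep_class[OF y]
    unfolding x(2) trail_rep_class[OF x(1)] T_def .
qed

section \<open>Separation of trails by paths, and the commutant of the projections\<close>

lemma finite_trail_maximal:
  assumes "sink G (path_range G \<alpha>)" "initial_segment G \<alpha> \<tau>"
  shows "\<tau> = Fin_Trail \<alpha>"
proof -
  let ?v = "path_range G \<alpha>"
  obtain \<beta> where \<beta>: "is_trail G \<beta>" "trail_source G \<beta> = ?v" "\<tau> = trail_append \<alpha> \<beta>"
    using assms(2) by (auto simp: initial_segment_def trail_remainder_def)
  have "\<beta> = Fin_Trail (?v, [])"
  proof (cases \<beta>)
    case (Fin_Trail \<gamma>)
    then show ?thesis
      using \<beta> assms(1) by (cases \<gamma>; cases "snd \<gamma>") (auto simp: paths_iff_walk sink_def out_arcs_def)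
  next
    case (Inf_Trail \<omega>)
    moreover have "shd \<omega> \<in> sset \<omega>" by (rule shd_sset)
    ultimately show ?thesis
      using \<beta> assms(1) by (auto simp: sink_def out_arcs_def)
  qed
  then show ?thesis using \<beta>(3) by simp
qed

text \<open>A finite trail, read as a path, is an initial segment of itself alone. Two infinite
  trails are separated by an initial segment of one that reaches an index where they differ.\<close>

lemma trails_separated:
  assumes "is_trail G \<tau>" "is_trail G \<tau>'" "\<tau> \<noteq> \<tau>'"
  shows "\<exists>\<alpha>\<in>paths G. initial_segment G \<alpha> \<tau> \<noteq> initial_segment G \<alpha> \<tau>'"
proof -
  have fin: "\<exists>\<alpha>\<in>paths G. initial_segment G \<alpha> \<sigma> \<noteq> initial_segment G \<alpha> \<sigma>'"
    if "is_trail G \<sigma>" "\<sigma> \<noteq> \<sigma>'" "\<sigma> = Fin_Trail \<alpha>" for \<sigma> \<sigma>' \<alpha>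
  proof (rule bexI[of _ \<alpha>])
    have \<alpha>: "\<alpha> \<in> paths G" "sink G (path_range G \<alpha>)" using that by auto
    have "is_trail G (Fin_Trail (path_range G \<alpha>, []))"
      using \<alpha> by (auto simp: paths_iff_walk sink_def)
    from trail_remainderI[OF this, of \<alpha>] have "initial_segment G \<alpha> \<sigma>"
      unfolding that(3) by (auto simp: initial_segment_def)
    then show "initial_segment G \<alpha> \<sigma> \<noteq> initial_segment G \<alpha> \<sigma>'"
      using finite_trail_maximal[OF \<alpha>(2)] that by blast
  qed (use that in simp)
  have inf: "\<exists>\<alpha>\<in>paths G. initial_segment G \<alpha> (Inf_Trail s) \<noteq> initial_segment G \<alpha> (Inf_Trail t)"
    if s: "is_trail G (Inf_Trail s)" and "s \<noteq> t" for s t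
  proof -
    obtain n where n: "s !! n \<noteq> t !! n" using stream_eqI \<open>s \<noteq> t\<close> by blast
    \<comment> \<open>Length \<open>Suc n\<close>, so that the edge with index \<open>n\<close> is
      included.\<close>
    define \<alpha> where "\<alpha> = (tail G (shd s), stake (Suc n) s)"
    have walk: "walk G (tail G (shd s)) (stake (Suc n) s)"
      "path_range G \<alpha> = tail G (s !! Suc n)"
      using walk_stake[OF s, of "Suc n"] by (auto simp: \<alpha>_def simp del: stake.simps snth.simps)
    have "trail_remainder G \<alpha> (Inf_Trail s) (Inf_Trail (sdrop (Suc n) s))"
      using is_trail_sdrop[OF s, of "Suc n"] walk(2)
      by (simp add: trail_remainder_def \<alpha>_def stake_sdrop sdrop_snth[of _ _ 0, simplified]
          del: stake.simps sdrop.simps is_trail.simps)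
    then have "initial_segment G \<alpha> (Inf_Trail s)" by (auto simp: initial_segment_def)
    moreover have "\<not> initial_segment G \<alpha> (Inf_Trail t)"
    proof
      assume "initial_segment G \<alpha> (Inf_Trail t)"
      then obtain \<beta> where "Inf_Trail t = trail_append \<alpha> \<beta>"
        by (auto simp: initial_segment_def trail_remainder_def)
      then obtain t' where "t = stake (Suc n) s @- t'" by (cases \<beta>) (auto simp: \<alpha>_def)
      then have "t !! n = s !! n" by (simp add: shift_snth_less del: stake.simps)
      with n show False by simp
    qed
    moreover have "\<alpha> \<in> paths G" using walk by (simp add: paths_iff_walk \<alpha>_def)
    ultimately show ?thesis by blast
  qed
  show ?thesis
  proof (cases \<tau>)
    case (Fin_Trail \<alpha>)
    then show ?thesis using fin assms by blast
  next
    case \<tau>: (Inf_Trail s)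
    show ?thesis
    proof (cases \<tau>')
      case (Fin_Trail \<alpha>)
      with fin[of \<tau>' \<tau>] assms show ?thesis by metis
    next
      case (Inf_Trail t)
      with inf[of s t] assms show ?thesis by (simp add: \<tau>)
    qed
  qed
qed

lemma P_op_eq:
  assumes "\<alpha> \<in> paths G"
  shows "P_op G \<alpha> = (\<lambda>m\<in>trail_module G. linext (\<lambda>z. if initial_segment G \<alpha> (snd z)
    then trail_basis z else (0 :: ('a, 'b, 'r::{comm_ring, comm_monoid_mult}) trail_comb)) m)"
proof -
  have pair: "(\<alpha>, \<alpha>) \<in> path_pairs G" using assms by (simp add: path_pairs_def)
  have "P_op G \<alpha> = (trail_rep G (leavitt_class G (monomial (\<alpha>, \<alpha>))) :: ('a, 'b, 'r) trail_op)"
    by (simp only: P_op_def trail_rep_monomial[OF assms assms, symmetric]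
        leavitt_monomial_eq[OF assms assms])
  also have "\<dots> = (\<lambda>m\<in>trail_module G. linext (word_op G (monomial (\<alpha>, \<alpha>))) m)"
    by (rule trail_rep_class[OF monomial_free_algebra[OF pair]])
  also have "\<dots> = (\<lambda>m\<in>trail_module G. linext (\<lambda>z. if initial_segment G \<alpha> (snd z)
    then trail_basis z else 0) m)"
  proof (intro restrict_ext linext_cong)
    fix m :: "('a, 'b, 'r) trail_comb" and z
    assume "m \<in> trail_module G" "z \<in> Poly_Mapping.keys m"
    from trail_module_keys[OF this] have "is_trail G (snd z)"
      by (simp add: ess_aperiodic_trails_def)
    then show "word_op G (monomial (\<alpha>, \<alpha>)) z
        = (if initial_segment G \<alpha> (snd z) then trail_basis z else (0 :: ('a, 'b, 'r) trail_comb))"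
      by (cases z) (simp add: monomial_def word_op_linear diagonal_tact[OF pair])
  qed
  finally show ?thesis .
qed

lemma E_ap_P_commutant:
  fixes T :: "('a, 'b, 'r::{comm_ring, comm_monoid_mult}) trail_op"
  assumes "T \<in> P_commutant G"
  shows "E_ap G T = T"
proof -
  have T: "T \<in> trail_endos G"
    using assms by (simp add: P_commutant_def graded_endos_def)
  have comm: "compose (trail_module G) T (P_op G \<alpha>) = compose (trail_module G) (P_op G \<alpha>) T"
    if "\<alpha> \<in> paths G" for \<alpha>
    using assms that by (simp add: P_commutant_def graded_endos_def)
  have M: "0 \<in> (trail_module G :: ('a, 'b, 'r) trail_comb set)"
    by (rule submoduleD(1)[OF submodule_trail_module])
  have T0: "T 0 = 0"
    using trail_endos_linext[OF T, of 0 trail_basis] by simp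
  have part: "trail_part (snd z) (T (trail_basis z)) = T (trail_basis z)"
    if z: "snd z \<in> ess_aperiodic_trails G" for z
  proof (rule poly_mapping_eqI)
    fix z'
    let ?t = "T (trail_basis z)"
    have b: "trail_basis z \<in> (trail_module G :: ('a, 'b, 'r) trail_comb set)"
      by (rule trail_basis_module[OF z])
    then have t: "?t \<in> trail_module G" using T by (auto simp: trail_endos_def)
    have "Poly_Mapping.lookup ?t z' = 0" if neq: "snd z' \<noteq> snd z"
    proof (rule ccontr)
      assume nz: "Poly_Mapping.lookup ?t z' \<noteq> 0"
      then have "snd z' \<in> ess_aperiodic_trails G"
        using trail_module_keys[OF t] by (simp add: in_keys_iff)
      then obtain \<alpha> where \<alpha>: "\<alpha> \<in> paths G"
        "initial_segment G \<alpha> (snd z') \<noteq> initial_segment G \<alpha> (snd z)"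
        using trails_separated[of "snd z'" "snd z"] neq z by (auto simp: ess_aperiodic_trails_def)
      \<comment> \<open>The coefficients at \<open>z'\<close> of the two sides are compared:
        \<open>\<alpha>\<close> is an initial segment of exactly one of the two trails, so one
        coefficient is that of \<open>?t\<close> and the other is 0.\<close>
      have "T (P_op G \<alpha> (trail_basis z)) = P_op G \<alpha> ?t"
        using fun_cong[OF comm[OF \<alpha>(1)], of "trail_basis z"] b by (simp add: compose_def)
      moreover have "P_op G \<alpha> (trail_basis z)
          = (if initial_segment G \<alpha> (snd z) then trail_basis z else (0 :: ('a, 'b, 'r) trail_comb))"
        using b by (simp add: P_op_eq[OF \<alpha>(1)])
      moreover have "Poly_Mapping.lookup (P_op G \<alpha> ?t) z'
          = (if initial_segment G \<alpha> (snd z') then Poly_Mapping.lookup ?t z' else 0)"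
        using t by (simp add: P_op_eq[OF \<alpha>(1)] lookup_linext_filter)
      ultimately show False
        using nz \<alpha>(2) T0 by (auto split: if_splits)
    qed
    then show "Poly_Mapping.lookup (trail_part (snd z) ?t) z' = Poly_Mapping.lookup ?t z'"
      by (auto simp: lookup_trail_part)
  qed
  show ?thesis
  proof
    fix m
    show "E_ap G T m = T m"
    proof (cases "m \<in> trail_module G")
      case True
      have "linext (\<lambda>z. trail_part (snd z) (T (trail_basis z))) m = linext (\<lambda>z. T (trail_basis z)) m"
        using part trail_module_keys[OF True] by (intro linext_cong) blast
      with True show ?thesis
        by (simp only: E_ap_linext[OF T True] trail_endos_eq_linext[OF T True, symmetric])
    next
      case False
      then show ?thesis
        using T by (auto simp: E_ap_def trail_endos_def PiE_def extensional_def)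
    qed
  qed
qed

end

theorem theorem4p12:
  fixes E :: "('v, 'e) pre_digraph"
  assumes "wf_digraph E"
  shows
    "(\<exists>E_M :: ('v, 'e, 'r::{comm_ring, comm_monoid_mult}) lpa \<Rightarrow> ('v, 'e, 'r) lpa.
        (algebraic_conditional_expectation (leavitt_path_algebra E) (commutative_core E) E_M \<and>
         (\<forall>x\<in>leavitt_monomials E.
            E_M x = (if x \<in> normal_monomials E then x else azero (leavitt_path_algebra E)))) \<and>
        (\<forall>F.
           algebraic_conditional_expectation (leavitt_path_algebra E) (commutative_core E) F \<and>
           (\<forall>x\<in>leavitt_monomials E.
              F x = (if x \<in> normal_monomials E then x else azero (leavitt_path_algebra E))) \<longrightarrow>
           F = E_M) \<and>
        (\<forall>x\<in>acarrier (leavitt_path_algebra E). \<Pi>_ap E (E_M x) = E_ap E (\<Pi>_ap E x))) \<and>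
     (\<forall>T\<in>(P_commutant E :: ('v, 'e, 'r) trail_op set). E_ap E T = T)"
proof -
  interpret wf_digraph E by fact
  have unique: "F = core_expectation E"
    if F: "algebraic_conditional_expectation (leavitt_path_algebra E) (commutative_core E) F"
      "\<forall>x\<in>leavitt_monomials E.
        F x = (if x \<in> normal_monomials E then x else azero (leavitt_path_algebra E))"
    for F :: "('v, 'e, 'r) lpa \<Rightarrow> ('v, 'e, 'r) lpa"
  proof (rule alg_linear_leavitt_eqI')
    show "alg_linear (leavitt_path_algebra E) (leavitt_path_algebra E) F"
      using F(1) by (simp add: algebraic_conditional_expectation_def)
    fix p :: "('v, 'e) path \<times> ('v, 'e) path"
    assume "p \<in> path_pairs E"
    then have "leavitt_class E (monomial p) \<in> (leavitt_monomials E :: ('v, 'e, 'r) lpa set)"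
      by (simp add: leavitt_monomials_eq)
    then show "F (leavitt_class E (monomial p)) = core_expectation E (leavitt_class E (monomial p))"
      using F(2) by (simp add: core_expectation_leavitt_monomials)
  qed (rule core_expectation_linear)
  show ?thesis
    using core_expectation_conditional core_expectation_leavitt_monomials unique
      \<Pi>_ap_core_expectation E_ap_P_commutant
    by (intro conjI exI[of _ "core_expectation E"]) blast+
qed

end
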